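(* Let $n\ge 3$, $p>1$, $0\le a<\frac{n-p}{p}$, $a\le b\le a+1$ and $q_1,q_2>1$. Consider the system $$-\mathrm{div}(|x|^{-ap}|\nabla u|^{p-2}\nabla u)=|x|^{-b(q_2+1)}v^{q_2},\qquad -\mathrm{div}(|x|^{-ap}|\nabla v|^{p-2}\nabla v)=|x|^{-b(q_1+1)}u^{q_1},\qquad u,v>0\text{ in }\mathbb{R}^n. \qquad( * )$$ Under the scaling transformation $u_\mu(x)=\mu^{\sigma_1}u(\mu x)$, $v_\mu(x)=\mu^{\sigma_2}v(\mu x)$, $\mu>0$, the system $( * )$ and the energy functionals $$\int_{\mathbb{R}^n}\frac{u^{q_1+1}}{|x|^{b(q_1+1)}}dx\quad\text{and}\quad\int_{\mathbb{R}^n}\frac{v^{q_2+1}}{|x|^{b(q_2+1)}}dx$$ are invariant if and only if one of the following two degenerate conditions holds: $p=2$, or $q_1=q_2$. Moreover, if $p=2$, the critical condition is $$\frac{1}{q_1+1}+\frac{1}{q_2+1}=\frac{n+2(b-a-1)}{n}.$$ If $q_1=q_2$, the critical condition is $q_1=q_2=\frac{np}{n-p+p(b-a)}-1$. In addition (in this case $q_1=q_2=:q$), $( * )$ is reduced to the single equation $$-\mathrm{div}(|x|^{-ap}|\nabla u|^{p-2}\nabla u)=|x|^{-b(q+1)}u^q,\qquad u>0\text{ in }\mathbb{R}^n,$$ in the weak sense (i.e. for $u,v\in\mathcal{D}_a^{1,p}(\mathbb{R}^n)$).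
   Context: $\mathcal{D}_a^{1,p}(\mathbb{R}^n)$ is the completion of $C_0^\infty(\mathbb{R}^n)$ with respect to the norm $\||x|^{-a}\nabla u\|_{L^p(\mathbb{R}^n)}$. Invariance under the scaling transformation means that $(u_\mu,v_\mu)$ again solves $( * )$ and that the two energies of $(u_\mu,v_\mu)$ equal those of $(u,v)$, with the same exponents $\sigma_1,\sigma_2$ used for the system and the energies. The "critical condition" is the relation between the exponents $q_1,q_2$ and $n,p,a,b$ that results from requiring this invariance.
   Formalization: Invariance is claimed for each weak solution with both energies finite, and "invariant iff p=2 or q1=q2" is read as: invariant for some σ1, σ2 iff p=2 or q1=q2 together with the corresponding critical condition, since the bare equivalence fails off the critical exponents. *)

theory Defs
  imports "HOL-Analysis.Analysis"
begin

text \<open>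
  Throughout, powers of \<^term>\<open>norm x\<close> are real powers, for which \<open>0 powr s = 0\<close>; the value at the
  origin only matters on a null set. Functions on \<open>\<real>\<^sup>n\<close> are taken up to equality almost everywhere,
  so \<open>u > 0 in \<real>\<^sup>n\<close> means positivity almost everywhere.
\<close>

definition gradient :: "('a::euclidean_space \<Rightarrow> real) \<Rightarrow> 'a \<Rightarrow> 'a"
  where "gradient f x = (THE D. GDERIV f x :> D)"

primrec Ck :: "nat \<Rightarrow> ('a::euclidean_space \<Rightarrow> real) \<Rightarrow> bool"
  where
    "Ck 0 f \<longleftrightarrow> continuous_on UNIV f"
  | "Ck (Suc k) f \<longleftrightarrow> (\<forall>x. f differentiable (at x)) \<and> (\<forall>i\<in>Basis. Ck k (\<lambda>x. gradient f x \<bullet> i))"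

definition test_functions :: "('a::euclidean_space \<Rightarrow> real) set"
  where "test_functions = {\<phi>. (\<forall>k. Ck k \<phi>) \<and> compact (closure {x. \<phi> x \<noteq> 0})}"

definition loc_integrable :: "('a::euclidean_space \<Rightarrow> 'b::{banach, second_countable_topology}) \<Rightarrow> bool"
  where "loc_integrable f \<longleftrightarrow> (\<forall>K. compact K \<longrightarrow> set_integrable lborel K f)"

definition weak_gradient :: "('a::euclidean_space \<Rightarrow> real) \<Rightarrow> ('a \<Rightarrow> 'a) \<Rightarrow> bool"
  where "weak_gradient u U \<longleftrightarrow> loc_integrable u \<and> loc_integrable U \<and>
    (\<forall>\<phi>\<in>test_functions.
      (LINT x|lborel. u x *\<^sub>R gradient \<phi> x) = - (LINT x|lborel. \<phi> x *\<^sub>R U x))"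

definition D_norm :: "real \<Rightarrow> real \<Rightarrow> ('a::euclidean_space \<Rightarrow> real) \<Rightarrow> real"
  where "D_norm a p \<phi> =
    (LINT x|lborel. (norm x powr (-a) * norm (gradient \<phi> x)) powr p) powr (1 / p)"

text \<open>
  The completion of the test functions under \<^const>\<open>D_norm\<close>, realised as a space of functions. For
  \<open>0 \<le> a < (n - p) / p\<close> Hardy's inequality bounds \<open>\<parallel>|x|\<^sup>-\<^sup>a\<^sup>-\<^sup>1 \<phi>\<parallel>\<^sub>p\<close> by a multiple of
  \<open>D_norm a p \<phi>\<close>, so every Cauchy sequence has a subsequence converging almost everywhere, and the
  almost-everywhere limit determines the element of the completion.
\<close>

definition D1p :: "real \<Rightarrow> real \<Rightarrow> ('a::euclidean_space \<Rightarrow> real) set"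
  where "D1p a p = {u \<in> borel_measurable lborel. \<exists>\<phi>::nat \<Rightarrow> 'a \<Rightarrow> real.
    (\<forall>k. \<phi> k \<in> test_functions) \<and>
    (\<forall>e>0. \<exists>N. \<forall>j\<ge>N. \<forall>k\<ge>N. D_norm a p (\<lambda>x. \<phi> j x - \<phi> k x) < e) \<and>
    (AE x in lborel. (\<lambda>k. \<phi> k x) \<longlonglongrightarrow> u x)}"

definition flux :: "real \<Rightarrow> real \<Rightarrow> ('a::euclidean_space \<Rightarrow> 'a) \<Rightarrow> 'a \<Rightarrow> 'a"
  where "flux a p U x = (norm x powr (-a * p) * norm (U x) powr (p - 2)) *\<^sub>R U x"

text \<open>Weak form of \<open>- div (|x|\<^sup>-\<^sup>a\<^sup>p |\<nabla>u|\<^sup>p\<^sup>-\<^sup>2 \<nabla>u) = f\<close> in \<open>\<real>\<^sup>n\<close>.\<close>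

definition weak_eq :: "real \<Rightarrow> real \<Rightarrow> ('a::euclidean_space \<Rightarrow> real) \<Rightarrow> ('a \<Rightarrow> real) \<Rightarrow> bool"
  where "weak_eq a p u f \<longleftrightarrow>
    (\<exists>U. weak_gradient u U \<and> loc_integrable (flux a p U) \<and> loc_integrable f \<and>
      (\<forall>\<phi>\<in>test_functions.
        (LINT x|lborel. flux a p U x \<bullet> gradient \<phi> x) = (LINT x|lborel. f x * \<phi> x)))"

definition solves_system ::
    "real \<Rightarrow> real \<Rightarrow> real \<Rightarrow> real \<Rightarrow> real \<Rightarrow> ('a::euclidean_space \<Rightarrow> real) \<Rightarrow> ('a \<Rightarrow> real) \<Rightarrow> bool"
  where "solves_system a b p q1 q2 u v \<longleftrightarrow>
    (AE x in lborel. u x > 0) \<and> (AE x in lborel. v x > 0) \<and>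
    weak_eq a p u (\<lambda>x. norm x powr (-b * (q2 + 1)) * v x powr q2) \<and>
    weak_eq a p v (\<lambda>x. norm x powr (-b * (q1 + 1)) * u x powr q1)"

definition solves_single ::
    "real \<Rightarrow> real \<Rightarrow> real \<Rightarrow> real \<Rightarrow> ('a::euclidean_space \<Rightarrow> real) \<Rightarrow> bool"
  where "solves_single a b p q u \<longleftrightarrow>
    (AE x in lborel. u x > 0) \<and>
    weak_eq a p u (\<lambda>x. norm x powr (-b * (q + 1)) * u x powr q)"

definition energy :: "real \<Rightarrow> real \<Rightarrow> ('a::euclidean_space \<Rightarrow> real) \<Rightarrow> ennreal"
  where "energy b q u =
    (\<integral>\<^sup>+ x. ennreal (u x powr (q + 1) / norm x powr (b * (q + 1))) \<partial>lborel)"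

definition rescale :: "real \<Rightarrow> real \<Rightarrow> ('a::euclidean_space \<Rightarrow> real) \<Rightarrow> 'a \<Rightarrow> real"
  where "rescale \<sigma> \<mu> u x = \<mu> powr \<sigma> * u (\<mu> *\<^sub>R x)"

definition scaling_invariant ::
    "real \<Rightarrow> real \<Rightarrow> real \<Rightarrow> real \<Rightarrow> real \<Rightarrow> real \<Rightarrow> real \<Rightarrow>
     ('a::euclidean_space \<Rightarrow> real) \<Rightarrow> ('a \<Rightarrow> real) \<Rightarrow> bool"
  where "scaling_invariant a b p q1 q2 \<sigma>1 \<sigma>2 u v \<longleftrightarrow>
    (\<forall>\<mu>>0. solves_system a b p q1 q2 (rescale \<sigma>1 \<mu> u) (rescale \<sigma>2 \<mu> v) \<and>
      energy b q1 (rescale \<sigma>1 \<mu> u) = energy b q1 u \<and>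
      energy b q2 (rescale \<sigma>2 \<mu> v) = energy b q2 v)"

end

theory Submission
  imports Defs
begin

text \<open>
  Scaling. Since the energies are finite and positive, their invariance forces
  \<open>\<sigma>\<^sub>i = n / (q\<^sub>i + 1) - b\<close>. A weak solution determines its right-hand side almost everywhere, so
  comparing powers of \<open>\<mu>\<close> in the two rescaled equations gives two linear relations between
  \<open>1 / (q\<^sub>1 + 1)\<close> and \<open>1 / (q\<^sub>2 + 1)\<close>; their difference is
  \<open>(p - 2) (1 / (q\<^sub>1 + 1) - 1 / (q\<^sub>2 + 1)) = 0\<close>.

  Reduction. If \<open>q\<^sub>1 = q\<^sub>2 = q\<close>, put \<open>w = u - v\<close> and test the difference of the two equations with \<open>w\<close>:
  the left-hand side is nonnegative by monotonicity of \<open>\<xi> \<mapsto> |\<xi>|\<^sup>p\<^sup>-\<^sup>2 \<xi>\<close>, the right-hand side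
  \<open>|x|\<^sup>-\<^sup>b\<^sup>(\<^sup>q\<^sup>+\<^sup>1\<^sup>) (v\<^sup>q - u\<^sup>q) w\<close> is nonpositive, hence \<open>\<nabla>u = \<nabla>v\<close> and \<open>u = v\<close>. As \<open>q\<close> is arbitrary, \<open>w\<close> is
  not an admissible test function; it is replaced by \<open>arctan \<rho>\<^sub>k \<zeta>\<^sub>R\<close> with \<open>\<rho>\<^sub>k \<rightarrow> w\<close> smooth and \<open>\<zeta>\<^sub>R\<close> a
  dilated cutoff, and the cutoff error is controlled by Hardy's inequality.
\<close>

subsection \<open>Gradients and smooth functions\<close>

text \<open>Membership in \<open>D1p\<close> yields test functions with Cauchy gradients that
  converge merely almost everywhere, while \<open>weak_eq\<close> supplies some weak gradient
  \<open>U\<close>; nothing links the two at the outset. Hardy's inequality does: it turns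
  convergence of gradients into local L1 convergence of the functions, so the limit of the gradients
  is itself a weak gradient and agrees with \<open>U\<close> by uniqueness. At the end it also
  yields u = v from equal gradients. The choice of arctan combines several properties: it is smooth,
  so the truncation remains a test function; it is bounded, which dominates the limit in k; it keeps
  the sign of w; |arctan t| <= |t| lets Hardy's inequality control the cutoff error; and its
  derivative 1/(1 + w^2) is positive, so that the pairing of the flux difference with the gradient
  of w can be recovered from the truncated integral. Estimates of Hoelder type come from Young's
  inequality with its parameter set to the size e of the small factor, which makes them linear in e.
  The rate (1/4)^k belongs to a subsequence and is fast enough to give pointwise convergence by
  summation.\<close>

lemma GDERIV_unique:
  assumes "GDERIV f x :> D" "GDERIV f x :> E"
  shows "D = E"
proof -
  have "(\<lambda>h. h \<bullet> D) = (\<lambda>h. h \<bullet> E)"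
    using assms has_derivative_unique unfolding gderiv_def by blast
  then show ?thesis by (metis inner_commute vector_eq_ldot)
qed

lemma gradient_eqI: "GDERIV f x :> D \<Longrightarrow> gradient f x = D"
  unfolding gradient_def using GDERIV_unique by blast

lemma GDERIV_gradient:
  fixes f :: "'a::euclidean_space \<Rightarrow> real"
  assumes "f differentiable (at x)"
  shows "GDERIV f x :> gradient f x"
proof -
  obtain L where L: "(f has_derivative L) (at x)"
    using assms unfolding differentiable_def by blast
  then interpret linear L using has_derivative_linear by blast
  have "L = (\<lambda>h. h \<bullet> (\<Sum>i\<in>Basis. L i *\<^sub>R i))"
  proof
    fix h
    have "L h = L (\<Sum>i\<in>Basis. (h \<bullet> i) *\<^sub>R i)" by (simp add: euclidean_representation)
    also have "\<dots> = h \<bullet> (\<Sum>i\<in>Basis. L i *\<^sub>R i)"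
      by (simp add: sum scale inner_sum_right mult.commute)
    finally show "L h = h \<bullet> (\<Sum>i\<in>Basis. L i *\<^sub>R i)" .
  qed
  with L have "GDERIV f x :> (\<Sum>i\<in>Basis. L i *\<^sub>R i)" unfolding gderiv_def by simp
  then show ?thesis using gradient_eqI by metis
qed

lemma GDERIV_imp_differentiable: "GDERIV f x :> D \<Longrightarrow> f differentiable (at x)"
  unfolding gderiv_def differentiable_def by blast

text \<open>The closure properties below are proved through this rule: an explicit derivative
  \<open>D\<close> replaces the description operator in \<open>gradient\<close>, and the induction
  on k continues with the components of \<open>D\<close>.\<close>

lemma Ck_SucI:
  assumes "\<And>x. GDERIV f x :> D x" "\<And>i. i \<in> Basis \<Longrightarrow> Ck k (\<lambda>x. D x \<bullet> i)"
  shows "Ck (Suc k) f"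
proof -
  have "gradient f = D" using assms(1) gradient_eqI by blast
  then show ?thesis using assms GDERIV_imp_differentiable[OF assms(1)] by simp
qed

lemma Ck_GDERIV: "Ck (Suc k) f \<Longrightarrow> GDERIV f x :> gradient f x"
  by (simp add: GDERIV_gradient)

lemma Ck_SucD: "Ck (Suc k) f \<Longrightarrow> Ck k f"
proof (induction k arbitrary: f)
  case 0
  then show ?case
    by (auto intro!: continuous_at_imp_continuous_on differentiable_imp_continuous_within)
qed simp

lemma Ck_imp_continuous: "Ck k f \<Longrightarrow> continuous_on UNIV f"
proof (induction k)
  case (Suc k)
  then show ?case using Ck_SucD by blast
qed simp

lemma Ck_const: "Ck k (\<lambda>x. c)"
proof (induction k arbitrary: c)
  case (Suc k)
  show ?case by (rule Ck_SucI[OF GDERIV_const]) (use Suc in simp)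
qed simp

lemma Ck_inner: "Ck k (\<lambda>x. x \<bullet> v)"
proof (cases k)
  case (Suc m)
  have "GDERIV (\<lambda>x. x \<bullet> v) x :> v" for x
    unfolding gderiv_def by (auto intro!: derivative_eq_intros)
  then show ?thesis unfolding Suc by (rule Ck_SucI) (rule Ck_const)
qed (auto intro!: continuous_intros)

lemma Ck_add: "Ck k f \<Longrightarrow> Ck k g \<Longrightarrow> Ck k (\<lambda>x. f x + g x)"
proof (induction k arbitrary: f g)
  case (Suc k)
  show ?case
    by (rule Ck_SucI[OF GDERIV_add[OF Ck_GDERIV[OF Suc.prems(1)] Ck_GDERIV[OF Suc.prems(2)]]])
      (use Suc in \<open>simp add: inner_add_left\<close>)
qed (auto intro!: continuous_intros)

lemma Ck_mult: "Ck k f \<Longrightarrow> Ck k g \<Longrightarrow> Ck k (\<lambda>x. f x * g x)"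
proof (induction k arbitrary: f g)
  case (Suc k)
  have fg: "Ck k f" "Ck k g" using Suc.prems by (auto dest: Ck_SucD simp del: Ck.simps)
  show ?case
    by (rule Ck_SucI[OF GDERIV_mult[OF Ck_GDERIV[OF Suc.prems(1)] Ck_GDERIV[OF Suc.prems(2)]]])
      (use Suc fg in \<open>auto simp: inner_add_left intro!: Ck_add\<close>)
qed (auto intro!: continuous_intros)

lemma Ck_diff: "Ck k f \<Longrightarrow> Ck k g \<Longrightarrow> Ck k (\<lambda>x. f x - g x)"
  using Ck_add[of k f "\<lambda>x. (-1) * g x"] Ck_mult[OF Ck_const[of k "-1"], of g] by simp

lemma Ck_prod: "(\<And>i. i \<in> I \<Longrightarrow> Ck k (f i)) \<Longrightarrow> Ck k (\<lambda>x. \<Prod>i\<in>I. f i x)"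
  by (induction I rule: infinite_finite_induct) (auto intro: Ck_const Ck_mult)

text \<open>Smoothness of the outer function is encoded as membership in a family \<open>S\<close>
  closed under differentiation. The chain rule produces g'(f x) times the gradient of f, and since
  g' again lies in \<open>S\<close> the induction hypothesis applies to it.\<close>

lemma Ck_compose:
  assumes S: "\<And>g. g \<in> S \<Longrightarrow> \<exists>g'\<in>S. \<forall>t::real. (g has_real_derivative g' t) (at t)"
    and "g \<in> S" "Ck k f"
  shows "Ck k (\<lambda>x. g (f x))"
  using assms(2,3)
proof (induction k arbitrary: f g)
  case 0
  obtain g' where "\<forall>t. (g has_real_derivative g' t) (at t)" using S[OF 0(1)] by blast
  then have "continuous_on UNIV g"
    by (meson DERIV_isCont continuous_at_imp_continuous_on)
  then show ?case using 0 continuous_on_compose2 by fastforce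
next
  case (Suc k)
  obtain g' where g': "g' \<in> S" "\<And>t. (g has_real_derivative g' t) (at t)"
    using S[OF Suc.prems(1)] by blast
  have f: "Ck k f" using Suc.prems by (auto dest: Ck_SucD simp del: Ck.simps)
  show ?case
    by (rule Ck_SucI[OF GDERIV_DERIV_compose[OF Ck_GDERIV[OF Suc.prems(2)] g'(2)]])
      (use Suc f g' in \<open>auto intro!: Ck_mult\<close>)
qed

lemma GDERIV_scale:
  assumes "GDERIV f (c *\<^sub>R x) :> D"
  shows "GDERIV (\<lambda>x. f (c *\<^sub>R x)) x :> c *\<^sub>R D"
proof -
  have "((\<lambda>x. f (c *\<^sub>R x)) has_derivative (\<lambda>h. (c *\<^sub>R h) \<bullet> D)) (at x)"
    by (rule has_derivative_compose[of "\<lambda>x. c *\<^sub>R x" "\<lambda>h. c *\<^sub>R h" x UNIV f "\<lambda>h. h \<bullet> D"])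
      (use assms in \<open>auto simp: gderiv_def intro!: derivative_eq_intros\<close>)
  then show ?thesis unfolding gderiv_def by simp
qed

lemma Ck_scale: "Ck k f \<Longrightarrow> Ck k (\<lambda>x. f (c *\<^sub>R x))"
proof (induction k arbitrary: f)
  case 0
  then have "continuous_on UNIV f" by simp
  then show ?case
    by (auto intro!: continuous_intros continuous_on_compose2[of UNIV f])
next
  case (Suc k)
  show ?case
    by (rule Ck_SucI[OF GDERIV_scale[OF Ck_GDERIV[OF Suc.prems]]])
      (use Suc in \<open>auto intro!: Ck_mult Ck_const\<close>)
qed

section \<open>Smoothness of compositions with arctan\<close>

lemma Ck_arctan: "Ck k f \<Longrightarrow> Ck k (\<lambda>x. arctan (f x))"
proof (rule Ck_compose[where g = arctan and S = "insert arctan (range (\<lambda>(p, m) t. poly p t * inverse (1 + t\<^sup>2) ^ m))"])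
  fix g :: "real \<Rightarrow> real"
  let ?R = "\<lambda>(p, m) t. poly p t * inverse (1 + t\<^sup>2) ^ m :: real"
  assume "g \<in> insert arctan (range ?R)"
  then consider "g = arctan" | p m where "g = ?R (p, m)" by fast
  then show "\<exists>g'\<in>insert arctan (range ?R). \<forall>t. (g has_real_derivative g' t) (at t)"
  proof cases
    case 1
    have "(g has_real_derivative ?R (1, 1) t) (at t)" for t
      unfolding 1 by (auto intro!: derivative_eq_intros simp: field_simps)
    then show ?thesis by blast
  next
    case 2
    \<comment> \<open>Derivative of p(t) (1 + t^2)^(-m), brought to the exponent m + 1: the
      numerator is p' (1 + t^2) - 2 m t p. Together with arctan itself these functions form a family
      closed under differentiation.\<close>
    let ?q = "pderiv p * [:1, 0, 1:] - smult (of_nat m) (p * [:0, 2:])"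
    have "(g has_real_derivative ?R (?q, Suc m) t) (at t)" for t
    proof -
      have nz: "1 + t\<^sup>2 \<noteq> 0" by (metis add_pos_nonneg zero_less_one zero_le_power2 less_irrefl)
      have D: "((\<lambda>t. inverse (1 + t\<^sup>2)) has_real_derivative - (2 * t * (inverse (1 + t\<^sup>2))\<^sup>2)) (at t)"
        using nz by (auto intro!: derivative_eq_intros simp: power2_eq_square)
      define s where "s = inverse (1 + t\<^sup>2)"
      have s: "s * (1 + t\<^sup>2) = 1" using nz by (simp add: s_def)
      have eq: "poly (pderiv p) t * s ^ m = poly (pderiv p) t * (1 + t\<^sup>2) * s ^ Suc m"
        using s by (simp add: mult.commute mult.left_commute)
      \<comment> \<open>The truncated exponent m - 1 is harmless at m = 0 because of the factor
        m.\<close>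
      have eq2: "of_nat m * s ^ (m - 1) * s\<^sup>2 = of_nat m * s ^ Suc m"
        by (cases m) (simp_all add: power2_eq_square)
      have "(g has_real_derivative poly (pderiv p) t * s ^ m
          + of_nat m * s ^ (m - 1) * - (2 * t * s\<^sup>2) * poly p t) (at t)"
        unfolding 2 s_def by (rule derivative_eq_intros poly_DERIV D refl | simp)+
      also have "poly (pderiv p) t * s ^ m + of_nat m * s ^ (m - 1) * - (2 * t * s\<^sup>2) * poly p t
          = poly (pderiv p) t * s ^ m - (of_nat m * s ^ (m - 1) * s\<^sup>2) * (2 * t * poly p t)"
        by (simp add: algebra_simps)
      also have "\<dots> = ?R (?q, Suc m) t"
        unfolding eq eq2 prod.case s_def[symmetric]
        by (simp add: algebra_simps power2_eq_square del: power_Suc)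
      finally show ?thesis .
    qed
    then show ?thesis by blast
  qed
qed simp

section \<open>A smooth function that vanishes on a half-line\<close>

definition exp_bump :: "real \<Rightarrow> real"
  where "exp_bump t = (if t > 0 then exp (- (1 / t)) else 0)"

lemma poly_div_exp_tendsto_0: "((\<lambda>s::real. poly p s * exp (- s)) \<longlongrightarrow> 0) at_top"
proof -
  have "((\<lambda>s. \<Sum>i\<le>degree p. coeff p i * (s ^ i / exp s)) \<longlongrightarrow> (\<Sum>i\<le>degree p. coeff p i * 0)) at_top"
    by (intro tendsto_intros tendsto_power_div_exp_0)
  then show ?thesis
    by (simp add: poly_altdef sum_distrib_right exp_minus divide_inverse mult.assoc)
qed

lemma Ck_exp_bump: "Ck k f \<Longrightarrow> Ck k (\<lambda>x. exp_bump (f x))"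
proof (rule Ck_compose[where g = exp_bump and
      S = "range (\<lambda>p t. if t > 0 then poly p (1 / t) * exp (- (1 / t)) else 0)"])
  fix g :: "real \<Rightarrow> real"
  let ?B = "\<lambda>p t. if t > 0 then poly p (1 / t) * exp (- (1 / t)) else (0::real)"
  assume "g \<in> range ?B"
  then obtain p where g: "g = ?B p" by blast
  \<comment> \<open>With s = 1/t one has d/dt = - s^2 d/ds, so p(s) exp(-s) becomes s^2 (p - p')(s)
    exp(-s).\<close>
  let ?q = "[:0, 0, 1:] * (p - pderiv p)"
  have "(g has_real_derivative ?B ?q t) (at t)" for t
  proof -
    consider "t > 0" | "t < 0" | "t = 0" by linarith
    then show ?thesis
    proof cases
      case 1
      have "((\<lambda>t. poly p (1 / t) * exp (- (1 / t))) has_real_derivative ?B ?q t) (at t)"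
        using 1 by (auto intro!: derivative_eq_intros DERIV_chain2[OF poly_DERIV]
            simp: power2_eq_square field_simps)
      then show ?thesis
        by (rule has_field_derivative_transform_within_open[of _ _ _ "{0<..}"]) (use 1 g in auto)
    next
      case 2
      have "((\<lambda>t. 0) has_real_derivative ?B ?q t) (at t)" using 2 by simp
      then show ?thesis
        by (rule has_field_derivative_transform_within_open[of _ _ _ "{..<0}"]) (use 2 g in auto)
    next
      case 3
      \<comment> \<open>At the origin the difference quotient from the right is s p(s) exp(-s) with
        s = 1/h; the factor s is the polynomial \<open>[:0, 1:]\<close>, and the exponential beats
        every polynomial.\<close>
      have "((\<lambda>s. poly ([:0, 1:] * p) s * exp (- s)) \<longlongrightarrow> 0) at_top"
        by (rule poly_div_exp_tendsto_0)
      then have P: "((\<lambda>h. poly ([:0, 1:] * p) (inverse h) * exp (- inverse h)) \<longlongrightarrow> 0) (at_right 0)"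
        by (rule filterlim_compose) (rule filterlim_inverse_at_top_right)
      have E: "\<forall>\<^sub>F h in at_right 0. g h / h
          = poly ([:0, 1:] * p) (inverse h) * exp (- inverse h)"
        unfolding eventually_at_right_field by (intro exI[of _ 1]) (auto simp: g field_simps)
      have R: "((\<lambda>h. g h / h) \<longlongrightarrow> 0) (at_right 0)"
        using tendsto_cong[OF E] P by simp
      have "\<forall>\<^sub>F h in at_left 0. g h / h = 0"
        unfolding eventually_at_left_field by (intro exI[of _ "-1"]) (auto simp: g)
      then have L: "((\<lambda>h. g h / h) \<longlongrightarrow> 0) (at_left 0)"
        by (rule tendsto_eventually)
      from L R have "((\<lambda>h. g h / h) \<longlongrightarrow> 0) (at 0)"
        by (simp add: filterlim_at_split)
      moreover have "g 0 = 0" by (simp add: g)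
      ultimately show ?thesis using 3 by (simp add: DERIV_def)
    qed
  qed
  then show "\<exists>g'\<in>range ?B. \<forall>t. (g has_real_derivative g' t) (at t)" 
    by (intro bexI[of _ "?B ?q"] allI rangeI)
next
  show "exp_bump \<in> range (\<lambda>p t. if t > 0 then poly p (1 / t) * exp (- (1 / t)) else 0)"
    by (rule range_eqI[of _ _ 1]) (auto simp: exp_bump_def)
qed

lemma exp_bump_bounds: "0 \<le> exp_bump t" "exp_bump t \<le> 1"
  by (auto simp: exp_bump_def)

lemma exp_bump_tendsto:
  "(\<lambda>m. exp_bump (real (Suc m) * t)) \<longlonglongrightarrow> (if t > 0 then 1 else 0)"
proof (cases "t > 0")
  case True
  have "(\<lambda>m. exp (- (inverse (real (Suc m)) * (1 / t)))) \<longlonglongrightarrow> exp (- (0 * (1 / t)))"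
    by (intro tendsto_intros LIMSEQ_inverse_real_of_nat)
  moreover have "exp_bump (real (Suc m) * t) = exp (- (inverse (real (Suc m)) * (1 / t)))" for m
    unfolding exp_bump_def using True zero_less_mult_iff[of "real (Suc m)" t]
    by (simp add: divide_inverse)
  ultimately show ?thesis using True by simp
next
  case False
  then have "real (Suc m) * t \<le> 0" for m by (simp add: mult_nonneg_nonpos)
  then show ?thesis using False by (simp add: exp_bump_def leD)
qed

subsection \<open>Test functions\<close>

lemma test_functionI:
  assumes "\<And>k. Ck k \<phi>" and "\<And>x. \<phi> x \<noteq> 0 \<Longrightarrow> norm x \<le> R"
  shows "\<phi> \<in> test_functions"
proof -
  have "bounded {x. \<phi> x \<noteq> 0}"
    using assms(2) by (intro boundedI[of _ R]) auto
  then show ?thesis using assms(1) by (auto simp: test_functions_def)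
qed

lemma test_function_Ck: "\<phi> \<in> test_functions \<Longrightarrow> Ck k \<phi>"
  by (simp add: test_functions_def)

lemma test_function_support:
  assumes "\<phi> \<in> test_functions"
  obtains R where "R > 0" "\<And>x. \<phi> x \<noteq> 0 \<Longrightarrow> norm x \<le> R" "\<And>x. gradient \<phi> x \<noteq> 0 \<Longrightarrow> norm x \<le> R"
proof -
  have "bounded (closure {x. \<phi> x \<noteq> 0})"
    using assms by (auto simp: test_functions_def compact_imp_bounded)
  then obtain R where R: "R > 0" "\<And>x. x \<in> closure {x. \<phi> x \<noteq> 0} \<Longrightarrow> norm x \<le> R"
    unfolding bounded_pos by blast
  have "gradient \<phi> x = 0" if "norm x > R" for x
  proof -
    have out: "x \<in> - closure {x. \<phi> x \<noteq> 0}" using R that by fastforce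
    have "((\<lambda>x. 0) has_derivative (\<lambda>h. h \<bullet> 0)) (at x)" by simp
    then have "(\<phi> has_derivative (\<lambda>h. h \<bullet> 0)) (at x)"
      by (rule has_derivative_transform_within_open[of _ _ _ _ "- closure {x. \<phi> x \<noteq> 0}"])
        (use out closure_subset[of "{x. \<phi> x \<noteq> 0}"] in auto)
    then show ?thesis by (intro gradient_eqI) (simp add: gderiv_def)
  qed
  then show ?thesis
    using that[of R] R closure_subset[of "{x. \<phi> x \<noteq> 0}"] by (metis (mono_tags, lifting) mem_Collect_eq not_le subsetD)
qed

lemma test_function_GDERIV: "\<phi> \<in> test_functions \<Longrightarrow> GDERIV \<phi> x :> gradient \<phi> x"
  using Ck_GDERIV test_function_Ck by blast

lemma test_function_continuous: "\<phi> \<in> test_functions \<Longrightarrow> continuous_on UNIV \<phi>"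
  using test_function_Ck[of \<phi> 0] by simp

lemma continuous_gradient:
  assumes "Ck (Suc k) \<phi>"
  shows "continuous_on UNIV (gradient \<phi>)"
proof (rule continuous_on_componentwise[THEN iffD2], rule)
  fix i :: 'a assume "i \<in> Basis"
  then have "Ck k (\<lambda>x. gradient \<phi> x \<bullet> i)" using assms by simp
  then show "continuous_on UNIV (\<lambda>x. gradient \<phi> x \<bullet> i)" by (rule Ck_imp_continuous)
qed

lemma test_function_continuous_gradient:
  "\<phi> \<in> test_functions \<Longrightarrow> continuous_on UNIV (gradient \<phi>)"
  using continuous_gradient test_function_Ck by blast

lemma test_function_measurable:
  "\<phi> \<in> test_functions \<Longrightarrow> \<phi> \<in> borel_measurable borel"
  "\<phi> \<in> test_functions \<Longrightarrow> gradient \<phi> \<in> borel_measurable borel"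
  by (auto intro: borel_measurable_continuous_onI test_function_continuous
      test_function_continuous_gradient)

lemma compact_support_bounded:
  fixes f :: "'a::euclidean_space \<Rightarrow> 'b::real_normed_vector"
  assumes "continuous_on UNIV f" "\<And>x. f x \<noteq> 0 \<Longrightarrow> norm x \<le> R"
  obtains B where "B > 0" "\<And>x. norm (f x) \<le> B"
proof -
  have "compact (f ` cball 0 R)"
    by (intro compact_continuous_image continuous_on_subset[OF assms(1)]) auto
  then obtain B where B: "B > 0" "\<And>y. y \<in> f ` cball 0 R \<Longrightarrow> norm y \<le> B"
    using compact_imp_bounded bounded_pos by metis
  have "norm (f x) \<le> B" for x
  proof (cases "f x = 0")
    case False
    then have "x \<in> cball 0 R" using assms(2) by simp
    then show ?thesis using B by blast
  qed (use B in simp)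
  then show ?thesis using that B by blast
qed

lemma test_function_bounds:
  assumes "\<phi> \<in> test_functions"
  obtains B R where "B > 0" "R > 0" "\<And>x. \<bar>\<phi> x\<bar> \<le> B" "\<And>x. norm (gradient \<phi> x) \<le> B"
    "\<And>x. \<phi> x \<noteq> 0 \<Longrightarrow> norm x \<le> R" "\<And>x. gradient \<phi> x \<noteq> 0 \<Longrightarrow> norm x \<le> R"
proof -
  obtain R where R: "R > 0" "\<And>x. \<phi> x \<noteq> 0 \<Longrightarrow> norm x \<le> R" "\<And>x. gradient \<phi> x \<noteq> 0 \<Longrightarrow> norm x \<le> R"
    using test_function_support[OF assms] by metis
  obtain B1 where B1: "B1 > 0" "\<And>x. norm (\<phi> x) \<le> B1"
    using compact_support_bounded[OF test_function_continuous[OF assms] R(2)] by blast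
  obtain B2 where B2: "B2 > 0" "\<And>x. norm (gradient \<phi> x) \<le> B2"
    using compact_support_bounded[OF test_function_continuous_gradient[OF assms] R(3)] by blast
  show ?thesis
    using that[of "max B1 B2" R] R B1 B2 by (auto simp: le_max_iff_disj)
qed

lemma test_function_mult_left:
  assumes "\<And>k. Ck k f" "\<phi> \<in> test_functions"
  shows "(\<lambda>x. f x * \<phi> x) \<in> test_functions"
proof -
  obtain R where "\<And>x. \<phi> x \<noteq> 0 \<Longrightarrow> norm x \<le> R"
    using test_function_support[OF assms(2)] by metis
  then show ?thesis
    by (intro test_functionI[of _ R] Ck_mult assms(1) test_function_Ck[OF assms(2)]) auto
qed

lemma test_function_diff:
  assumes "\<phi> \<in> test_functions" "\<psi> \<in> test_functions"
  shows "(\<lambda>x. \<phi> x - \<psi> x) \<in> test_functions"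
proof -
  obtain R where R: "\<And>x. \<phi> x \<noteq> 0 \<Longrightarrow> norm x \<le> R"
    using test_function_support[OF assms(1)] by metis
  obtain S where S: "\<And>x. \<psi> x \<noteq> 0 \<Longrightarrow> norm x \<le> S"
    using test_function_support[OF assms(2)] by metis
  show ?thesis
  proof (rule test_functionI[of _ "max R S"])
    fix x assume "\<phi> x - \<psi> x \<noteq> 0"
    then have "\<phi> x \<noteq> 0 \<or> \<psi> x \<noteq> 0" by auto
    then show "norm x \<le> max R S" using R[of x] S[of x] by auto
  qed (intro Ck_diff test_function_Ck assms)
qed

lemma gradient_diff:
  assumes "\<phi> \<in> test_functions" "\<psi> \<in> test_functions"
  shows "gradient (\<lambda>x. \<phi> x - \<psi> x) x = gradient \<phi> x - gradient \<psi> x"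
  using assms by (intro gradient_eqI GDERIV_diff test_function_GDERIV)

lemma test_function_scale:
  assumes "\<phi> \<in> test_functions" "c > 0"
  shows "(\<lambda>x. \<phi> (c *\<^sub>R x)) \<in> test_functions"
proof -
  obtain R where R: "\<And>x. \<phi> x \<noteq> 0 \<Longrightarrow> norm x \<le> R"
    using test_function_support[OF assms(1)] by metis
  show ?thesis
  proof (rule test_functionI[of _ "R / c"])
    fix x assume "\<phi> (c *\<^sub>R x) \<noteq> 0"
    then have "norm (c *\<^sub>R x) \<le> R" by (rule R)
    then show "norm x \<le> R / c" using assms by (simp add: field_simps)
  qed (intro Ck_scale test_function_Ck assms)
qed

lemma gradient_scale:
  assumes "\<phi> \<in> test_functions"
  shows "gradient (\<lambda>x. \<phi> (c *\<^sub>R x)) x = c *\<^sub>R gradient \<phi> (c *\<^sub>R x)"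
  using assms by (intro gradient_eqI GDERIV_scale test_function_GDERIV)

text \<open>The parameter \<open>m\<close> steepens the sides: as it grows, the bumps tend pointwise
  to the indicator of the open box. Boxes suit a product of one-variable bumps and form an
  intersection-stable generator of the Borel sets.\<close>

definition box_bump :: "'a::euclidean_space \<Rightarrow> 'a \<Rightarrow> nat \<Rightarrow> 'a \<Rightarrow> real"
  where "box_bump l r m x =
    (\<Prod>i\<in>Basis. exp_bump (real (Suc m) * (x \<bullet> i - l \<bullet> i)) * exp_bump (real (Suc m) * (r \<bullet> i - x \<bullet> i)))"

lemma box_bump_bounds: "0 \<le> box_bump l r m x" "box_bump l r m x \<le> 1"
  unfolding box_bump_def
  by (auto intro!: prod_nonneg prod_le_1 mult_le_one mult_nonneg_nonneg exp_bump_bounds)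

lemma box_bump_zero:
  assumes "x \<notin> box l r" shows "box_bump l r m x = 0"
proof -
  obtain i where "i \<in> Basis" "x \<bullet> i \<le> l \<bullet> i \<or> r \<bullet> i \<le> x \<bullet> i"
    using assms by (auto simp: mem_box not_less)
  then show ?thesis
    unfolding box_bump_def
    by (intro prod_zero bexI[of _ i]) (auto simp: exp_bump_def zero_less_mult_iff)
qed

lemma box_bump_tendsto: "(\<lambda>m. box_bump l r m x) \<longlonglongrightarrow> indicator (box l r) x"
proof (cases "x \<in> box l r")
  case True
  have "(\<lambda>m. box_bump l r m x) \<longlonglongrightarrow> (\<Prod>i\<in>(Basis::'a set).
      (if x \<bullet> i - l \<bullet> i > 0 then 1 else 0) * (if r \<bullet> i - x \<bullet> i > 0 then 1 else 0))"
    unfolding box_bump_def by (intro tendsto_intros exp_bump_tendsto)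
  then show ?thesis using True by (simp add: mem_box)
qed (simp add: box_bump_zero)

lemma box_bump_test_function: "box_bump l r m \<in> test_functions"
proof -
  obtain R where R: "\<And>x. x \<in> box l r \<Longrightarrow> norm x \<le> R"
    using bounded_box bounded_iff by metis
  have "Ck k (box_bump l r m)" for k
    unfolding box_bump_def
    by (intro Ck_prod Ck_mult Ck_exp_bump Ck_const Ck_diff Ck_inner)
  then show ?thesis
    using R box_bump_zero[of _ l r m] by (intro test_functionI[of _ R]) blast+
qed

subsection \<open>Scaling of Lebesgue measure\<close>

lemma lborel_scale:
  assumes "c > 0"
  shows "(lborel :: 'a::euclidean_space measure) = density (distr lborel borel (\<lambda>x. c *\<^sub>R x)) (\<lambda>_. ennreal (c ^ DIM('a)))"
  using lborel_affine[of c 0] assms by (simp add: ennreal_power)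

lemma nn_integral_scale:
  fixes f :: "'a::euclidean_space \<Rightarrow> ennreal"
  assumes [measurable]: "f \<in> borel_measurable borel" and "c > 0"
  shows "(\<integral>\<^sup>+x. f x \<partial>lborel) = ennreal (c ^ DIM('a)) * (\<integral>\<^sup>+x. f (c *\<^sub>R x) \<partial>lborel)"
  by (subst lborel_scale[OF assms(2)]) (simp add: nn_integral_density nn_integral_distr nn_integral_cmult)

lemma integrable_scale:
  fixes f :: "'a::euclidean_space \<Rightarrow> 'b::{banach, second_countable_topology}"
  assumes f: "integrable lborel f" and c: "c > 0"
  shows "integrable lborel (\<lambda>x. f (c *\<^sub>R x))"
proof -
  have [measurable]: "f \<in> borel_measurable borel" using f by auto
  have "integrable (density (distr lborel borel (\<lambda>x::'a. c *\<^sub>R x)) (\<lambda>_. ennreal (c ^ DIM('a)))) f"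
    using f lborel_scale[OF c, where 'a='a] by metis
  then have "integrable lborel (\<lambda>x::'a. c ^ DIM('a) *\<^sub>R f (c *\<^sub>R x))"
    using c by (simp add: integrable_density integrable_distr_eq)
  from integrable_scaleR_right[OF this, of "inverse (c ^ DIM('a))"] show ?thesis
    using c by simp
qed

lemma integral_scale:
  fixes f :: "'a::euclidean_space \<Rightarrow> 'b::{banach, second_countable_topology}"
  assumes [measurable]: "f \<in> borel_measurable borel" and c: "c > 0"
  shows "(LINT x|lborel. f (c *\<^sub>R x)) = (1 / c ^ DIM('a)) *\<^sub>R (LINT x|lborel. f x)"
proof -
  have "(LINT x|lborel. f x) = c ^ DIM('a) *\<^sub>R (LINT x|lborel. f (c *\<^sub>R x))"
    by (subst lborel_scale[OF c]) (use c in \<open>simp add: integral_density integral_distr\<close>)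
  then show ?thesis using c by simp
qed

lemma AE_scale:
  assumes "AE x in lborel. P (x :: 'a::euclidean_space)" and c: "c > 0"
  shows "AE x in lborel. P (c *\<^sub>R x)"
proof -
  obtain N where N: "{x. \<not> P x} \<subseteq> N" "N \<in> sets borel" "emeasure lborel N = 0"
    using assms(1) by (auto elim!: AE_E)
  have "(\<integral>\<^sup>+x. indicator N x \<partial>lborel) = ennreal (c ^ DIM('a)) * (\<integral>\<^sup>+x. indicator N (c *\<^sub>R x) \<partial>lborel)"
    using N(2) by (intro nn_integral_scale c) auto
  then have "(\<integral>\<^sup>+x. indicator N (c *\<^sub>R x) \<partial>(lborel::'a measure)) = 0"
    using N(2,3) c by simp
  moreover have [measurable]: "(\<lambda>x::'a. c *\<^sub>R x) \<in> borel_measurable borel" by simp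
  moreover have "(\<lambda>x. indicator N (c *\<^sub>R x) :: ennreal) \<in> borel_measurable lborel"
    using N(2) by measurable
  ultimately have "AE x in lborel. indicator N (c *\<^sub>R x) = (0::ennreal)"
    using nn_integral_0_iff_AE by blast
  then show ?thesis
    by eventually_elim (use N(1) in \<open>auto simp: indicator_def split: if_splits\<close>)
qed

subsection \<open>Local integrability\<close>

lemma loc_integrable_cball:
  "loc_integrable f \<Longrightarrow> integrable lborel (\<lambda>x. indicator (cball 0 R) x *\<^sub>R f x)"
  unfolding loc_integrable_def set_integrable_def by auto

lemma loc_integrableI:
  fixes f :: "'a::euclidean_space \<Rightarrow> 'b::{banach, second_countable_topology}"
  assumes "\<And>R. R > 0 \<Longrightarrow> integrable lborel (\<lambda>x. indicator (cball 0 R) x *\<^sub>R f x)"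
  shows "loc_integrable f"
  unfolding loc_integrable_def
proof (intro allI impI)
  fix K :: "'a set" assume K: "compact K"
  obtain R where R: "R > 0" "K \<subseteq> cball 0 R"
    using compact_imp_bounded[OF K] bounded_pos by (metis mem_cball_0 subsetI)
  have "set_integrable lborel (cball 0 R) f"
    using assms[OF R(1)] by (simp add: set_integrable_def)
  then show "set_integrable lborel K f"
    by (rule set_integrable_subset) (use K R in \<open>auto simp: borel_compact\<close>)
qed

lemma loc_integrable_measurable:
  fixes f :: "'a::euclidean_space \<Rightarrow> 'b::{banach, second_countable_topology}"
  assumes "loc_integrable f"
  shows "f \<in> borel_measurable borel"
proof (rule borel_measurable_LIMSEQ_metric)
  show "(\<lambda>x. indicator (cball 0 (real i)) x *\<^sub>R f x) \<in> borel_measurable borel" for i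
    using borel_measurable_integrable[OF loc_integrable_cball[OF assms]] by simp
  show "(\<lambda>i. indicator (cball 0 (real i)) x *\<^sub>R f x) \<longlonglongrightarrow> f x" for x
  proof (rule tendsto_eventually)
    obtain N :: nat where "norm x \<le> N" using real_arch_simple by blast
    then show "\<forall>\<^sub>F i in sequentially. indicator (cball 0 (real i)) x *\<^sub>R f x = f x"
      by (intro eventually_sequentiallyI[of N]) (auto simp: indicator_def)
  qed
qed

lemma loc_integrable_imp_integrable:
  fixes F :: "'a::euclidean_space \<Rightarrow> 'b::{banach, second_countable_topology}"
    and h :: "'a \<Rightarrow> 'c::{banach, second_countable_topology}"
  assumes "loc_integrable F" "h \<in> borel_measurable borel"
    and "AE x in lborel. norm (h x) \<le> B * norm (F x)" "\<And>x. norm x > R \<Longrightarrow> h x = 0"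
  shows "integrable lborel h"
proof (rule Bochner_Integration.integrable_bound)
  show "integrable lborel (\<lambda>x. B *\<^sub>R (indicator (cball 0 R) x *\<^sub>R F x))"
    using loc_integrable_cball[OF assms(1)] by (rule integrable_scaleR_right)
  show "AE x in lborel. norm (h x) \<le> norm (B *\<^sub>R indicat_real (cball 0 R) x *\<^sub>R F x)"
    using assms(3)
  proof eventually_elim
    case (elim x)
    have "B * norm (F x) \<le> \<bar>B\<bar> * norm (F x)" by (simp add: mult_right_mono)
    then show ?case using assms(4)[of x] elim by (cases "norm x > R") auto
  qed
qed (use assms in simp)

lemma loc_integrable_bound:
  fixes F :: "'a::euclidean_space \<Rightarrow> 'b::{banach, second_countable_topology}"
    and h :: "'a \<Rightarrow> 'c::{banach, second_countable_topology}"
  assumes "loc_integrable F" and [measurable]: "h \<in> borel_measurable borel"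
    and "AE x in lborel. norm (h x) \<le> B * norm (F x)"
  shows "loc_integrable h"
proof (rule loc_integrableI)
  fix R :: real
  have [measurable]: "cball (0::'a) R \<in> sets borel" by simp
  have "AE x in lborel. norm (indicat_real (cball 0 R) x *\<^sub>R h x) \<le> \<bar>B\<bar> * norm (F x)"
    using assms(3)
  proof eventually_elim
    case (elim x)
    have "B * norm (F x) \<le> \<bar>B\<bar> * norm (F x)" by (simp add: mult_right_mono)
    then show ?case using elim by (auto simp: indicator_def)
  qed
  then show "integrable lborel (\<lambda>x. indicat_real (cball 0 R) x *\<^sub>R h x)"
    by (rule loc_integrable_imp_integrable[OF assms(1), where R = R, rotated]) auto
qed

lemma loc_integrable_cong_AE:
  assumes "loc_integrable f" "g \<in> borel_measurable borel" "AE x in lborel. f x = g x"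
  shows "loc_integrable g"
proof (rule loc_integrable_bound[OF assms(1,2)])
  show "AE x in lborel. norm (g x) \<le> 1 * norm (f x)"
    using assms(3) by eventually_elim simp
qed

lemma loc_integrable_diff:
  assumes "loc_integrable f" "loc_integrable g"
  shows "loc_integrable (\<lambda>x. f x - g x)"
proof (rule loc_integrableI)
  fix R :: real
  show "integrable lborel (\<lambda>x. indicat_real (cball 0 R) x *\<^sub>R (f x - g x))"
    using Bochner_Integration.integrable_diff[OF loc_integrable_cball[OF assms(1)] loc_integrable_cball[OF assms(2)]]
    by (simp add: scaleR_diff_right)
qed

lemma loc_integrable_scale:
  fixes f :: "'a::euclidean_space \<Rightarrow> 'b::{banach, second_countable_topology}"
  assumes "loc_integrable f" and c: "c > 0"
  shows "loc_integrable (\<lambda>x. k *\<^sub>R f (c *\<^sub>R x))"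
proof (rule loc_integrableI)
  fix R :: real
  have "integrable lborel (\<lambda>x. k *\<^sub>R (indicat_real (cball 0 (c * R)) (c *\<^sub>R x) *\<^sub>R f (c *\<^sub>R x)))"
    by (intro integrable_scaleR_right integrable_scale[OF loc_integrable_cball[OF assms(1)] c])
  moreover have "indicat_real (cball 0 (c * R)) (c *\<^sub>R x) = indicator (cball 0 R) x" for x :: 'a
    using c by (auto simp: indicator_def)
  ultimately show "integrable lborel (\<lambda>x. indicat_real (cball 0 R) x *\<^sub>R k *\<^sub>R f (c *\<^sub>R x))"
    by (simp add: mult.commute)
qed

lemma loc_integrable_continuous:
  fixes f :: "'a::euclidean_space \<Rightarrow> 'b::{banach, second_countable_topology}"
  assumes "continuous_on UNIV f"
  shows "loc_integrable f"
  unfolding loc_integrable_def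
  using borel_integrable_compact continuous_on_subset[OF assms]
  by (auto simp: set_integrable_def indicator_scaleR_eq_if)

lemma integrable_test_scaleR:
  assumes "\<phi> \<in> test_functions" "loc_integrable F"
  shows "integrable lborel (\<lambda>x. \<phi> x *\<^sub>R F x)"
proof -
  obtain B R where B: "\<And>x. \<bar>\<phi> x\<bar> \<le> B" and R: "\<And>x. \<phi> x \<noteq> 0 \<Longrightarrow> norm x \<le> R"
    using test_function_bounds[OF assms(1)] by metis
  have [measurable]: "\<phi> \<in> borel_measurable borel" "F \<in> borel_measurable borel"
    using assms test_function_measurable loc_integrable_measurable by auto
  show ?thesis
  proof (rule loc_integrable_imp_integrable[OF assms(2)])
    show "AE x in lborel. norm (\<phi> x *\<^sub>R F x) \<le> B * norm (F x)"
      using B by (auto intro!: mult_right_mono)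
    show "\<phi> x *\<^sub>R F x = 0" if "norm x > R" for x using R[of x] that by auto
  qed measurable
qed

lemma integrable_gradient_inner:
  assumes "\<phi> \<in> test_functions" "loc_integrable F"
  shows "integrable lborel (\<lambda>x. F x \<bullet> gradient \<phi> x)"
proof -
  obtain B R where B: "\<And>x. norm (gradient \<phi> x) \<le> B" and R: "\<And>x. gradient \<phi> x \<noteq> 0 \<Longrightarrow> norm x \<le> R"
    using test_function_bounds[OF assms(1)] by metis
  have [measurable]: "gradient \<phi> \<in> borel_measurable borel" "F \<in> borel_measurable borel"
    using assms test_function_measurable loc_integrable_measurable by auto
  show ?thesis
  proof (rule loc_integrable_imp_integrable[OF assms(2)])
    show "AE x in lborel. norm (F x \<bullet> gradient \<phi> x) \<le> B * norm (F x)"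
    proof (rule AE_I2)
      fix x
      have "norm (F x \<bullet> gradient \<phi> x) \<le> norm (F x) * norm (gradient \<phi> x)"
        using Cauchy_Schwarz_ineq2 by simp
      also have "\<dots> \<le> norm (F x) * B" by (intro mult_left_mono B) simp
      finally show "norm (F x \<bullet> gradient \<phi> x) \<le> B * norm (F x)" by (simp add: mult.commute)
    qed
    show "F x \<bullet> gradient \<phi> x = 0" if "norm x > R" for x
      using R[of x] that by (cases "gradient \<phi> x = 0") auto
  qed measurable
qed

subsection \<open>The fundamental lemma of the calculus of variations\<close>

lemma integral_box_zero:
  fixes G :: "'a::euclidean_space \<Rightarrow> 'b::{banach, second_countable_topology}"
  assumes G: "loc_integrable G" and 0: "\<And>\<phi>. \<phi> \<in> test_functions \<Longrightarrow> (LINT x|lborel. \<phi> x *\<^sub>R G x) = 0"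
  shows "(LINT x:box l r|lborel. G x) = 0"
proof -
  have [measurable]: "G \<in> borel_measurable borel" using G by (rule loc_integrable_measurable)
  have [measurable]: "box_bump l r m \<in> borel_measurable borel" for m
    by (intro test_function_measurable box_bump_test_function)
  obtain R where R: "box l r \<subseteq> cball 0 R"
    using bounded_box bounded_iff by (metis mem_cball_0 subsetI)
  have "(\<lambda>m. LINT x|lborel. box_bump l r m x *\<^sub>R G x) \<longlonglongrightarrow> (LINT x|lborel. indicat_real (box l r) x *\<^sub>R G x)"
  proof (rule integral_dominated_convergence)
    show "integrable lborel (\<lambda>x. norm (indicat_real (cball 0 R) x *\<^sub>R G x))"
      by (intro integrable_norm loc_integrable_cball G)
    show "AE x in lborel. (\<lambda>m. box_bump l r m x *\<^sub>R G x) \<longlonglongrightarrow> indicat_real (box l r) x *\<^sub>R G x"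
      by (auto intro!: tendsto_intros box_bump_tendsto)
    show "AE x in lborel. norm (box_bump l r m x *\<^sub>R G x) \<le> norm (indicat_real (cball 0 R) x *\<^sub>R G x)" for m
    proof (rule AE_I2)
      fix x
      show "norm (box_bump l r m x *\<^sub>R G x) \<le> norm (indicat_real (cball 0 R) x *\<^sub>R G x)"
        using R box_bump_zero[of x l r m] box_bump_bounds[of l r m x]
        by (cases "x \<in> box l r") (auto simp: indicator_def mult_left_le_one_le)
    qed
  qed measurable
  then show ?thesis
    using 0[OF box_bump_test_function] by (simp add: set_lebesgue_integral_def LIMSEQ_const_iff)
qed

text \<open>Testing with smooth bumps shows that the integrals of G over boxes vanish; a Dynkin
  argument then reaches all Borel sets. Truncating G to a fixed box first gives an integrable
  function, as the complements and countable unions in that argument require.\<close>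

lemma fundamental_lemma:
  fixes G :: "'a::euclidean_space \<Rightarrow> 'b::{banach, second_countable_topology}"
  assumes G: "loc_integrable G" and 0: "\<And>\<phi>. \<phi> \<in> test_functions \<Longrightarrow> (LINT x|lborel. \<phi> x *\<^sub>R G x) = 0"
  shows "AE x in lborel. G x = 0"
proof -
  have AE_box: "AE x in lborel. indicat_real (box l r) x *\<^sub>R G x = 0" for l r :: 'a
  proof -
    define H where "H = (\<lambda>x. indicat_real (box l r) x *\<^sub>R G x)"
    obtain R where R: "box l r \<subseteq> cball 0 R"
      using bounded_box bounded_iff by (metis mem_cball_0 subsetI)
    have "set_integrable lborel (cball 0 R) G"
      using loc_integrable_cball[OF G] by (simp add: set_integrable_def)
    then have "set_integrable lborel (box l r) G"
      by (rule set_integrable_subset) (use R in auto)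
    then have H: "integrable lborel H" by (simp add: set_integrable_def H_def)
    have HA: "set_integrable lborel A H" if "A \<in> sets lborel" for A
      using that H integrable_mult_indicator unfolding set_integrable_def by blast
    have "set_lebesgue_integral lborel A H = 0" if "A \<in> sets lborel" for A
    proof -
      have "Int_stable (range (\<lambda>(a, b). box a b :: 'a set))"
        by (auto simp: Int_stable_def Int_interval box_Int_box)
      moreover have "range (\<lambda>(a, b). box a b :: 'a set) \<subseteq> Pow UNIV" by simp
      moreover have "A \<in> sigma_sets UNIV (range (\<lambda>(a, b). box a b))"
        using that by (simp add: borel_eq_box)
      ultimately show ?thesis
      proof (induction rule: sigma_sets_induct_disjoint)
        case (basic A)
        then obtain a b where A: "A = box a b" by auto
        \<comment> \<open>Boxes meet in boxes, so the integral of the truncated function over a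
          generator is again the integral of G over a box.\<close>
        have "\<exists>c d. box a b \<inter> box l r = box c d" unfolding box_Int_box by (intro exI) (rule refl)
        then obtain c d where cd: "box a b \<inter> box l r = box c d" by (elim exE)
        have "(\<lambda>x. indicat_real A x *\<^sub>R H x) = (\<lambda>x. indicat_real (box c d) x *\<^sub>R G x)"
          unfolding H_def A cd[symmetric] by (intro ext) (simp add: indicator_def)
        then show ?case
          using integral_box_zero[OF G 0, of c d] by (simp add: set_lebesgue_integral_def)
      next
        case empty
        show ?case by (simp add: set_lebesgue_integral_def)
      next
        case (compl A)
        then have A: "A \<in> sets lborel" by (simp add: borel_eq_box)
        have "UNIV - A \<union> A = UNIV" by auto
        moreover have "set_lebesgue_integral lborel (UNIV - A \<union> A) H
            = set_lebesgue_integral lborel (UNIV - A) H + set_lebesgue_integral lborel A H"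
          by (rule set_integral_Un) (use A HA in auto)
        moreover have "set_lebesgue_integral lborel UNIV H = 0"
          using integral_box_zero[OF G 0, of l r] by (simp add: set_lebesgue_integral_def H_def)
        ultimately show ?case using compl by simp
      next
        case (union A)
        then have A: "A i \<in> sets lborel" for i by (auto simp: borel_eq_box)
        have "set_lebesgue_integral lborel (\<Union>i. A i) H = (\<Sum>i. set_lebesgue_integral lborel (A i) H)"
          by (rule lebesgue_integral_countable_add)
            (use A union HA in \<open>auto simp: disjoint_family_on_def\<close>)
        then show ?case using union by simp
      qed
    qed
    then have "AE x in lborel. H x = 0" using sigma_finite_measure.density_zero[OF sigma_finite_lborel H] by blast
    then show ?thesis by (simp add: H_def)
  qed
  have "AE x in lborel. \<forall>n. indicat_real (box (- real n *\<^sub>R One) (real n *\<^sub>R One)) x *\<^sub>R G x = 0"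
    unfolding AE_all_countable using AE_box by blast
  then show ?thesis
  proof eventually_elim
    case (elim x)
    obtain n :: nat where n: "norm x < n" using reals_Archimedean2 by blast
    have "x \<in> box (- real n *\<^sub>R One) (real n *\<^sub>R One)"
      unfolding mem_box
    proof
      fix i :: 'a assume "i \<in> Basis"
      then show "(- real n *\<^sub>R One) \<bullet> i < x \<bullet> i \<and> x \<bullet> i < (real n *\<^sub>R One) \<bullet> i"
        using Basis_le_norm[of i x] n by (auto simp: inner_sum_left_Basis)
    qed
    then show ?case using elim[rule_format, of n] by simp
  qed
qed

subsection \<open>Integration by parts\<close>

lemma test_function_lipschitz:
  assumes "\<phi> \<in> test_functions" "\<And>x. norm (gradient \<phi> x) \<le> B"
  shows "\<bar>\<phi> x - \<phi> y\<bar> \<le> B * norm (x - y)"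
proof -
  have "norm (\<phi> x - \<phi> y) \<le> B * norm (x - y)"
  proof (rule differentiable_bound[of UNIV \<phi> "\<lambda>x h. h \<bullet> gradient \<phi> x"])
    show "onorm (\<lambda>h. h \<bullet> gradient \<phi> x) \<le> B" for x
    proof (rule onorm_bound)
      show "0 \<le> B" using assms(2)[of x] norm_ge_zero order_trans by blast
      fix h
      have "norm (h \<bullet> gradient \<phi> x) \<le> norm h * norm (gradient \<phi> x)"
        using Cauchy_Schwarz_ineq2 by simp
      also have "\<dots> \<le> norm h * B" by (intro mult_left_mono assms) simp
      finally show "norm (h \<bullet> gradient \<phi> x) \<le> B * norm h" by (simp add: mult.commute)
    qed
  qed (use test_function_GDERIV[OF assms(1)] in \<open>auto simp: gderiv_def\<close>)
  then show ?thesis by simp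
qed

text \<open>The difference quotients of \<open>\<phi>\<close> have integral zero by translation invariance.\<close>

lemma integral_gradient_zero:
  fixes \<phi> :: "'a::euclidean_space \<Rightarrow> real"
  assumes \<phi>: "\<phi> \<in> test_functions"
  shows "(LINT x|lborel. gradient \<phi> x) = 0"
proof (rule euclidean_eqI)
  fix i :: 'a assume i: "i \<in> Basis"
  obtain B R where B: "B > 0" "\<And>x. norm (gradient \<phi> x) \<le> B" and R: "\<And>x. \<phi> x \<noteq> 0 \<Longrightarrow> norm x \<le> R"
    using test_function_bounds[OF \<phi>] by metis
  have [measurable]: "\<phi> \<in> borel_measurable borel" "gradient \<phi> \<in> borel_measurable borel"
    using \<phi> by (auto intro: test_function_measurable)
  have int\<phi>: "integrable lborel \<phi>"
    using integrable_test_scaleR[OF \<phi> loc_integrable_continuous[of "\<lambda>_. 1::real"]] by simp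
  have intg: "integrable lborel (gradient \<phi>)"
  proof -
    obtain R where "\<And>x. gradient \<phi> x \<noteq> 0 \<Longrightarrow> norm x \<le> R" using test_function_bounds[OF \<phi>] by metis
    then show ?thesis
      using loc_integrable_continuous[OF test_function_continuous_gradient[OF \<phi>]]
      by (intro loc_integrable_imp_integrable[of "gradient \<phi>" _ 1 R]) fastforce+
  qed
  define D where "D m x = (\<phi> (inverse (real (Suc m)) *\<^sub>R i + x) - \<phi> x) / inverse (real (Suc m))" for m x
  have trans: "integrable lborel (\<lambda>x. \<phi> (a + x))" "(LINT x|lborel. \<phi> (a + x)) = (LINT x|lborel. \<phi> x)" for a
  proof -
    have "integrable (distr lborel borel ((+) a)) \<phi>" using int\<phi> by (simp add: lborel_distr_plus)
    then show "integrable lborel (\<lambda>x. \<phi> (a + x))" by (subst (asm) integrable_distr_eq) auto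
    have "(LINT x|lborel. \<phi> x) = (LINT x|distr lborel borel ((+) a). \<phi> x)" by (simp add: lborel_distr_plus)
    also have "\<dots> = (LINT x|lborel. \<phi> (a + x))" by (subst integral_distr) auto
    finally show "(LINT x|lborel. \<phi> (a + x)) = (LINT x|lborel. \<phi> x)" by simp
  qed
  have D0: "(LINT x|lborel. D m x) = 0" for m
    unfolding D_def using trans int\<phi> by simp
  have "(\<lambda>m. LINT x|lborel. D m x) \<longlonglongrightarrow> (LINT x|lborel. gradient \<phi> x \<bullet> i)"
  proof (rule integral_dominated_convergence)
    \<comment> \<open>All steps of the difference quotients are at most 1, so their supports stay
      within distance 1 of the ball of radius R.\<close>
    show "integrable lborel (\<lambda>x. B *\<^sub>R (indicat_real (cball 0 (R + 1)) x *\<^sub>R (1::real)))"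
      by (intro integrable_scaleR_right loc_integrable_cball loc_integrable_continuous) simp
    show "D m \<in> borel_measurable lborel" for m unfolding D_def by measurable
    show "AE x in lborel. norm (D m x) \<le> B *\<^sub>R (indicat_real (cball 0 (R + 1)) x *\<^sub>R (1::real))" for m
    proof (rule AE_I2)
      fix x
      let ?h = "inverse (real (Suc m))"
      have h: "?h > 0" "?h \<le> 1" by (auto simp: field_simps)
      have "\<bar>\<phi> (?h *\<^sub>R i + x) - \<phi> x\<bar> \<le> B * norm (?h *\<^sub>R i + x - x)"
        by (rule test_function_lipschitz[OF \<phi> B(2)])
      then have "\<bar>\<phi> (?h *\<^sub>R i + x) - \<phi> x\<bar> \<le> B * ?h" using i h by simp
      then have 1: "norm (D m x) \<le> B"
        unfolding D_def using h by (simp add: abs_divide pos_divide_le_eq del: of_nat_Suc)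
      have 2: "D m x = 0" if "norm x > R + 1"
      proof -
        have "norm x \<le> norm (?h *\<^sub>R i + x) + norm (?h *\<^sub>R i)"
          using norm_triangle_ineq4[of "?h *\<^sub>R i + x" "?h *\<^sub>R i"] by simp
        then have "norm (?h *\<^sub>R i + x) > R" using i h that by simp
        then show ?thesis unfolding D_def using R[of "?h *\<^sub>R i + x"] R[of x] that by force
      qed
      show "norm (D m x) \<le> B *\<^sub>R (indicat_real (cball 0 (R + 1)) x *\<^sub>R (1::real))"
        using 1 2 by (cases "norm x > R + 1") auto
    qed
    show "AE x in lborel. (\<lambda>m. D m x) \<longlonglongrightarrow> gradient \<phi> x \<bullet> i"
    proof (rule AE_I2)
      fix x
      have "(\<phi> has_derivative (\<lambda>h. h \<bullet> gradient \<phi> x)) (at (0 *\<^sub>R i + x))"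
        using test_function_GDERIV[OF \<phi>] by (simp add: gderiv_def)
      then have "((\<lambda>t. \<phi> (t *\<^sub>R i + x)) has_derivative (\<lambda>t. (t *\<^sub>R i) \<bullet> gradient \<phi> x)) (at 0)"
        by (rule has_derivative_compose[rotated]) (auto intro!: derivative_eq_intros)
      then have "((\<lambda>t. \<phi> (t *\<^sub>R i + x)) has_real_derivative i \<bullet> gradient \<phi> x) (at 0)"
        by (simp add: has_field_derivative_def mult_commute_abs)
      then have lim: "((\<lambda>h. (\<phi> (h *\<^sub>R i + x) - \<phi> x) / h) \<longlongrightarrow> i \<bullet> gradient \<phi> x) (at 0)"
        by (simp add: DERIV_def)
      have "filterlim (\<lambda>m. inverse (real (Suc m))) (at 0) sequentially"
        unfolding filterlim_at using LIMSEQ_inverse_real_of_nat by (auto simp del: of_nat_Suc)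
      from filterlim_compose[OF lim this] show "(\<lambda>m. D m x) \<longlonglongrightarrow> gradient \<phi> x \<bullet> i"
        unfolding D_def by (simp add: inner_commute)
    qed
  qed measurable
  then have "(LINT x|lborel. gradient \<phi> x \<bullet> i) = 0"
    using D0 by (simp add: LIMSEQ_const_iff)
  then show "(LINT x|lborel. gradient \<phi> x) \<bullet> i = 0 \<bullet> i"
    using intg by simp
qed

lemma integration_by_parts:
  assumes \<phi>: "\<phi> \<in> test_functions" and \<psi>: "\<psi> \<in> test_functions"
  shows "(LINT x|lborel. \<phi> x *\<^sub>R gradient \<psi> x) = - (LINT x|lborel. \<psi> x *\<^sub>R gradient \<phi> x)"
proof -
  have "gradient (\<lambda>x. \<phi> x * \<psi> x) = (\<lambda>x. \<phi> x *\<^sub>R gradient \<psi> x + \<psi> x *\<^sub>R gradient \<phi> x)"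
    by (intro ext gradient_eqI GDERIV_mult test_function_GDERIV assms)
  moreover have "(\<lambda>x. \<phi> x * \<psi> x) \<in> test_functions"
    by (intro test_function_mult_left test_function_Ck[OF \<phi>] \<psi>)
  ultimately have "(LINT x|lborel. \<phi> x *\<^sub>R gradient \<psi> x + \<psi> x *\<^sub>R gradient \<phi> x) = 0"
    using integral_gradient_zero by metis
  moreover have "integrable lborel (\<lambda>x. \<phi> x *\<^sub>R gradient \<psi> x)" "integrable lborel (\<lambda>x. \<psi> x *\<^sub>R gradient \<phi> x)"
    using assms by (auto intro!: integrable_test_scaleR loc_integrable_continuous test_function_continuous_gradient)
  ultimately show ?thesis by (simp add: eq_neg_iff_add_eq_0)
qed

subsection \<open>Weak gradients and weak solutions\<close>

lemma weak_gradient_cong: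
  assumes "weak_gradient u U" and [measurable]: "u' \<in> borel_measurable borel" and "AE x in lborel. u x = u' x"
  shows "weak_gradient u' U"
  unfolding weak_gradient_def
proof (intro conjI ballI)
  show "loc_integrable u'"
    using assms loc_integrable_cong_AE unfolding weak_gradient_def by blast
  show "loc_integrable U" using assms(1) by (simp add: weak_gradient_def)
  fix \<phi> :: "'a \<Rightarrow> real" assume \<phi>: "\<phi> \<in> test_functions"
  have [measurable]: "gradient \<phi> \<in> borel_measurable borel" "u \<in> borel_measurable borel"
    using \<phi> assms(1) by (auto simp: weak_gradient_def intro: test_function_measurable loc_integrable_measurable)
  have "(LINT x|lborel. u' x *\<^sub>R gradient \<phi> x) = (LINT x|lborel. u x *\<^sub>R gradient \<phi> x)"
    by (rule integral_cong_AE) (use assms(3) in auto)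
  then show "(LINT x|lborel. u' x *\<^sub>R gradient \<phi> x) = - (LINT x|lborel. \<phi> x *\<^sub>R U x)"
    using assms(1) \<phi> by (simp add: weak_gradient_def)
qed

text \<open>\<open>weak_eq\<close> hides its gradient behind an existential quantifier. This lemma
  lets two such witnesses, or a witness and a limit of gradients, be identified.\<close>

lemma weak_gradient_unique:
  assumes "weak_gradient u U" "weak_gradient u V"
  shows "AE x in lborel. U x = V x"
proof -
  have loc: "loc_integrable U" "loc_integrable V" using assms by (auto simp: weak_gradient_def)
  have "AE x in lborel. U x - V x = 0"
  proof (rule fundamental_lemma)
    show "loc_integrable (\<lambda>x. U x - V x)" using loc by (rule loc_integrable_diff)
    fix \<phi> :: "'a \<Rightarrow> real" assume \<phi>: "\<phi> \<in> test_functions"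
    have "(LINT x|lborel. u x *\<^sub>R gradient \<phi> x) = - (LINT x|lborel. \<phi> x *\<^sub>R U x)"
      using assms(1) \<phi> unfolding weak_gradient_def by blast
    moreover have "(LINT x|lborel. u x *\<^sub>R gradient \<phi> x) = - (LINT x|lborel. \<phi> x *\<^sub>R V x)"
      using assms(2) \<phi> unfolding weak_gradient_def by blast
    ultimately have "(LINT x|lborel. \<phi> x *\<^sub>R U x) = (LINT x|lborel. \<phi> x *\<^sub>R V x)" by simp
    then show "(LINT x|lborel. \<phi> x *\<^sub>R (U x - V x)) = 0"
      using integrable_test_scaleR[OF \<phi> loc(1)] integrable_test_scaleR[OF \<phi> loc(2)]
      by (simp add: scaleR_diff_right)
  qed
  then show ?thesis by simp
qed

lemma flux_measurable [measurable]:
  "U \<in> borel_measurable borel \<Longrightarrow> flux a p U \<in> borel_measurable borel"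
  unfolding flux_def by measurable

lemma weak_eq_imp_loc_integrable:
  assumes "weak_eq a p u f"
  shows "loc_integrable u" "loc_integrable f"
  using assms by (auto simp: weak_eq_def weak_gradient_def)

text \<open>Rescaled right-hand sides have the expected form only where the solution is positive,
  and u and v agree only almost everywhere in the reduction; both exchanges go through this
  rule.\<close>

lemma weak_eq_cong:
  assumes "weak_eq a p u f"
    and "u' \<in> borel_measurable borel" "AE x in lborel. u x = u' x"
    and [measurable]: "f' \<in> borel_measurable borel" and ff': "AE x in lborel. f x = f' x"
  shows "weak_eq a p u' f'"
proof -
  obtain U where U: "weak_gradient u U" "loc_integrable (flux a p U)" and f: "loc_integrable f"
    and eq: "\<And>\<phi>. \<phi> \<in> test_functions \<Longrightarrow>
      (LINT x|lborel. flux a p U x \<bullet> gradient \<phi> x) = (LINT x|lborel. f x * \<phi> x)"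
    using assms(1) by (auto simp: weak_eq_def)
  have "(LINT x|lborel. f x * \<phi> x) = (LINT x|lborel. f' x * \<phi> x)" if \<phi>: "\<phi> \<in> test_functions" for \<phi>
  proof -
    have [measurable]: "\<phi> \<in> borel_measurable borel" "f \<in> borel_measurable borel"
      using \<phi> f by (auto intro: test_function_measurable loc_integrable_measurable)
    show ?thesis by (rule integral_cong_AE) (use ff' in auto)
  qed
  then show ?thesis
    unfolding weak_eq_def
    using U eq weak_gradient_cong[OF U(1) assms(2,3)] loc_integrable_cong_AE[OF f assms(4,5)]
    by (intro exI[of _ U]) auto
qed

text \<open>The two hidden gradients agree almost everywhere, hence so do the fluxes, and both
  right-hand sides have the same integral against every test function. This turns invariance of an
  equation into an identity of functions.\<close>

lemma weak_eq_rhs_unique: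
  fixes u :: "'a::euclidean_space \<Rightarrow> real"
  assumes "weak_eq a p u f" "weak_eq a p u g"
  shows "AE x in lborel. f x = g x"
proof -
  obtain U where U: "weak_gradient u U" "loc_integrable (flux a p U)" and f: "loc_integrable f"
    and eqU: "\<And>\<phi>. \<phi> \<in> test_functions \<Longrightarrow>
      (LINT x|lborel. flux a p U x \<bullet> gradient \<phi> x) = (LINT x|lborel. f x * \<phi> x)"
    using assms(1) by (auto simp: weak_eq_def)
  obtain V where V: "weak_gradient u V" "loc_integrable (flux a p V)" and g: "loc_integrable g"
    and eqV: "\<And>\<phi>. \<phi> \<in> test_functions \<Longrightarrow>
      (LINT x|lborel. flux a p V x \<bullet> gradient \<phi> x) = (LINT x|lborel. g x * \<phi> x)"
    using assms(2) by (auto simp: weak_eq_def)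
  have UV: "AE x in lborel. U x = V x" using weak_gradient_unique[OF U(1) V(1)] .
  have [measurable]: "flux a p U \<in> borel_measurable borel" "flux a p V \<in> borel_measurable borel"
    using U V loc_integrable_measurable by auto
  have "AE x in lborel. f x - g x = 0"
  proof (rule fundamental_lemma)
    show "loc_integrable (\<lambda>x. f x - g x)" using f g by (rule loc_integrable_diff)
    fix \<phi> :: "'a \<Rightarrow> real" assume \<phi>: "\<phi> \<in> test_functions"
    have [measurable]: "gradient \<phi> \<in> borel_measurable borel" using \<phi> by (rule test_function_measurable)
    have "(LINT x|lborel. flux a p U x \<bullet> gradient \<phi> x) = (LINT x|lborel. flux a p V x \<bullet> gradient \<phi> x)"
    proof (rule integral_cong_AE)
      show "AE x in lborel. flux a p U x \<bullet> gradient \<phi> x = flux a p V x \<bullet> gradient \<phi> x"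
        using UV by eventually_elim (simp add: flux_def)
    qed measurable
    then have "(LINT x|lborel. f x * \<phi> x) = (LINT x|lborel. g x * \<phi> x)"
      using eqU eqV \<phi> by simp
    then show "(LINT x|lborel. \<phi> x *\<^sub>R (f x - g x)) = 0"
      using integrable_test_scaleR[OF \<phi> f] integrable_test_scaleR[OF \<phi> g]
      by (simp add: right_diff_distrib mult.commute)
  qed
  then show ?thesis by simp
qed

subsection \<open>Rescaling\<close>

text \<open>Writing a test function as a dilation makes every integrand in the rescaled weak
  formulation a function of \<mu> x, ready for the change of variables.\<close>

lemma test_function_unscale:
  assumes "\<phi> \<in> test_functions" "\<mu> > 0"
  obtains \<psi> where "\<psi> \<in> test_functions" "\<And>x. \<phi> x = \<psi> (\<mu> *\<^sub>R x)"
    "\<And>x. gradient \<phi> x = \<mu> *\<^sub>R gradient \<psi> (\<mu> *\<^sub>R x)"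
proof -
  define \<psi> where "\<psi> = (\<lambda>x. \<phi> (inverse \<mu> *\<^sub>R x))"
  have \<psi>: "\<psi> \<in> test_functions"
    unfolding \<psi>_def using assms by (intro test_function_scale) auto
  have \<phi>: "\<phi> = (\<lambda>x. \<psi> (\<mu> *\<^sub>R x))" using assms by (auto simp: \<psi>_def)
  show ?thesis
  proof (rule that[OF \<psi>])
    show "\<phi> x = \<psi> (\<mu> *\<^sub>R x)" for x using \<phi> by meson
    show "gradient \<phi> x = \<mu> *\<^sub>R gradient \<psi> (\<mu> *\<^sub>R x)" for x
      by (subst \<phi>) (rule gradient_scale[OF \<psi>])
  qed
qed

lemma weak_gradient_rescale:
  fixes u :: "'a::euclidean_space \<Rightarrow> real"
  assumes "weak_gradient u U" "\<mu> > 0"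
  shows "weak_gradient (rescale \<sigma> \<mu> u) (\<lambda>x. \<mu> powr (\<sigma> + 1) *\<^sub>R U (\<mu> *\<^sub>R x))"
  unfolding weak_gradient_def
proof (intro conjI ballI)
  have u: "loc_integrable u" and U: "loc_integrable U" using assms(1) by (auto simp: weak_gradient_def)
  have [measurable]: "u \<in> borel_measurable borel" "U \<in> borel_measurable borel"
    using u U by (auto intro: loc_integrable_measurable)
  show "loc_integrable (rescale \<sigma> \<mu> u)"
    using loc_integrable_scale[OF u assms(2), of "\<mu> powr \<sigma>"] by (simp add: rescale_def[abs_def])
  show "loc_integrable (\<lambda>x. \<mu> powr (\<sigma> + 1) *\<^sub>R U (\<mu> *\<^sub>R x))"
    using loc_integrable_scale[OF U assms(2)] .
  fix \<phi> :: "'a \<Rightarrow> real" assume "\<phi> \<in> test_functions"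
  then obtain \<psi> where \<psi>: "\<psi> \<in> test_functions" "\<And>x. \<phi> x = \<psi> (\<mu> *\<^sub>R x)"
    "\<And>x. gradient \<phi> x = \<mu> *\<^sub>R gradient \<psi> (\<mu> *\<^sub>R x)"
    using test_function_unscale[OF _ assms(2)] by metis
  have [measurable]: "\<psi> \<in> borel_measurable borel" "gradient \<psi> \<in> borel_measurable borel"
    using \<psi>(1) by (auto intro: test_function_measurable)
  have "(LINT x|lborel. rescale \<sigma> \<mu> u x *\<^sub>R gradient \<phi> x)
      = \<mu> powr (\<sigma> + 1) *\<^sub>R (LINT x|lborel. u (\<mu> *\<^sub>R x) *\<^sub>R gradient \<psi> (\<mu> *\<^sub>R x))"
    using assms(2)
    by (simp add: rescale_def \<psi>(3) powr_add mult_ac flip: integral_scaleR_right)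
  also have "\<dots> = \<mu> powr (\<sigma> + 1) *\<^sub>R (1 / \<mu> ^ DIM('a)) *\<^sub>R (LINT x|lborel. u x *\<^sub>R gradient \<psi> x)"
    by (subst integral_scale[OF _ assms(2)]) auto
  also have "(LINT x|lborel. u x *\<^sub>R gradient \<psi> x) = - (LINT x|lborel. \<psi> x *\<^sub>R U x)"
    using assms(1) \<psi>(1) by (simp add: weak_gradient_def)
  also have "\<mu> powr (\<sigma> + 1) *\<^sub>R (1 / \<mu> ^ DIM('a)) *\<^sub>R - (LINT x|lborel. \<psi> x *\<^sub>R U x)
      = - (\<mu> powr (\<sigma> + 1) *\<^sub>R (LINT x|lborel. \<psi> (\<mu> *\<^sub>R x) *\<^sub>R U (\<mu> *\<^sub>R x)))"
    by (subst integral_scale[OF _ assms(2), of "\<lambda>x. \<psi> x *\<^sub>R U x"]) auto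
  also have "\<dots> = - (LINT x|lborel. \<phi> x *\<^sub>R \<mu> powr (\<sigma> + 1) *\<^sub>R U (\<mu> *\<^sub>R x))"
    by (simp add: \<psi>(2) mult.commute flip: integral_scaleR_right)
  finally show "(LINT x|lborel. rescale \<sigma> \<mu> u x *\<^sub>R gradient \<phi> x)
      = - (LINT x|lborel. \<phi> x *\<^sub>R \<mu> powr (\<sigma> + 1) *\<^sub>R U (\<mu> *\<^sub>R x))" .
qed

text \<open>The weight contributes \<mu>^(a p), and the flux is homogeneous of degree p - 1 in the
  gradient.\<close>

lemma flux_rescale:
  assumes "\<mu> > 0"
  shows "flux a p (\<lambda>x. \<mu> powr s *\<^sub>R U (\<mu> *\<^sub>R x)) x = \<mu> powr (a * p + s * (p - 1)) *\<^sub>R flux a p U (\<mu> *\<^sub>R x)"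
proof -
  have 1: "norm x powr (- a * p) = \<mu> powr (a * p) * norm (\<mu> *\<^sub>R x) powr (- a * p)"
    using assms by (simp add: powr_mult mult.assoc[symmetric] flip: powr_add)
  have 2: "norm (\<mu> powr s *\<^sub>R U (\<mu> *\<^sub>R x)) powr (p - 2) = \<mu> powr (s * (p - 2)) * norm (U (\<mu> *\<^sub>R x)) powr (p - 2)"
    by (simp add: powr_mult powr_powr)
  have 3: "\<mu> powr (a * p + s * (p - 1)) = \<mu> powr (a * p) * \<mu> powr (s * (p - 2)) * \<mu> powr s"
    by (simp add: algebra_simps flip: powr_add)
  show ?thesis
    unfolding flux_def 1 2 3 by (simp add: mult_ac)
qed

text \<open>This is \<open>flux_rescale\<close> with s = \<sigma> + 1; the final + 1 in the exponent
  comes from the gradient of the dilated test function. The Jacobian appears on both sides and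
  cancels.\<close>

lemma weak_eq_rescale:
  fixes u :: "'a::euclidean_space \<Rightarrow> real"
  assumes "weak_eq a p u f" "\<mu> > 0"
  shows "weak_eq a p (rescale \<sigma> \<mu> u) (\<lambda>x. \<mu> powr (a * p + (\<sigma> + 1) * (p - 1) + 1) * f (\<mu> *\<^sub>R x))"
proof -
  obtain U where U: "weak_gradient u U" "loc_integrable (flux a p U)" and f: "loc_integrable f"
    and eq: "\<And>\<phi>. \<phi> \<in> test_functions \<Longrightarrow>
      (LINT x|lborel. flux a p U x \<bullet> gradient \<phi> x) = (LINT x|lborel. f x * \<phi> x)"
    using assms(1) by (auto simp: weak_eq_def)
  let ?U = "\<lambda>x. \<mu> powr (\<sigma> + 1) *\<^sub>R U (\<mu> *\<^sub>R x)"
  let ?k = "\<mu> powr (a * p + (\<sigma> + 1) * (p - 1))"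
  have [measurable]: "flux a p U \<in> borel_measurable borel" "f \<in> borel_measurable borel"
    using U f by (auto intro: loc_integrable_measurable)
  show ?thesis
    unfolding weak_eq_def
  proof (intro exI[of _ ?U] conjI ballI)
    show "weak_gradient (rescale \<sigma> \<mu> u) ?U" by (rule weak_gradient_rescale[OF U(1) assms(2)])
    show "loc_integrable (flux a p ?U)"
    proof -
      have "flux a p ?U = (\<lambda>x. ?k *\<^sub>R flux a p U (\<mu> *\<^sub>R x))"
        by (intro ext flux_rescale assms(2))
      then show ?thesis using loc_integrable_scale[OF U(2) assms(2), of ?k] by simp
    qed
    show "loc_integrable (\<lambda>x. \<mu> powr (a * p + (\<sigma> + 1) * (p - 1) + 1) * f (\<mu> *\<^sub>R x))"
      using loc_integrable_scale[OF f assms(2)] by simp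
    fix \<phi> :: "'a \<Rightarrow> real" assume "\<phi> \<in> test_functions"
    then obtain \<psi> where \<psi>: "\<psi> \<in> test_functions" "\<And>x. \<phi> x = \<psi> (\<mu> *\<^sub>R x)"
      "\<And>x. gradient \<phi> x = \<mu> *\<^sub>R gradient \<psi> (\<mu> *\<^sub>R x)"
      using test_function_unscale[OF _ assms(2)] by metis
    have [measurable]: "\<psi> \<in> borel_measurable borel" "gradient \<psi> \<in> borel_measurable borel"
      using \<psi>(1) by (auto intro: test_function_measurable)
    have "(LINT x|lborel. flux a p ?U x \<bullet> gradient \<phi> x)
        = (LINT x|lborel. (?k * \<mu>) * (flux a p U (\<mu> *\<^sub>R x) \<bullet> gradient \<psi> (\<mu> *\<^sub>R x)))"
      by (simp add: flux_rescale[OF assms(2)] \<psi>(3) mult_ac)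
    also have "\<dots> = (?k * \<mu>) * (LINT x|lborel. flux a p U (\<mu> *\<^sub>R x) \<bullet> gradient \<psi> (\<mu> *\<^sub>R x))" by simp
    also have "\<dots> = (?k * \<mu>) * ((1 / \<mu> ^ DIM('a)) *\<^sub>R (LINT x|lborel. flux a p U x \<bullet> gradient \<psi> x))"
      by (subst integral_scale[OF _ assms(2)]) auto
    also have "\<dots> = (?k * \<mu>) * ((1 / \<mu> ^ DIM('a)) *\<^sub>R (LINT x|lborel. f x * \<psi> x))"
      using eq[OF \<psi>(1)] by simp
    also have "\<dots> = (?k * \<mu>) * (LINT x|lborel. f (\<mu> *\<^sub>R x) * \<psi> (\<mu> *\<^sub>R x))"
      by (subst integral_scale[OF _ assms(2), of "\<lambda>x. f x * \<psi> x"]) auto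
    also have "?k * \<mu> = \<mu> powr (a * p + (\<sigma> + 1) * (p - 1) + 1)"
      using assms(2) by (simp add: powr_add)
    also have "\<dots> * (LINT x|lborel. f (\<mu> *\<^sub>R x) * \<psi> (\<mu> *\<^sub>R x))
        = (LINT x|lborel. \<mu> powr (a * p + (\<sigma> + 1) * (p - 1) + 1) * f (\<mu> *\<^sub>R x) * \<phi> x)"
      by (simp add: \<psi>(2) mult.assoc)
    finally show "(LINT x|lborel. flux a p ?U x \<bullet> gradient \<phi> x)
        = (LINT x|lborel. \<mu> powr (a * p + (\<sigma> + 1) * (p - 1) + 1) * f (\<mu> *\<^sub>R x) * \<phi> x)" .
  qed
qed

text \<open>Lebesgue measure is not zero. This extracts an identity of numbers from an almost
  everywhere statement whose two sides do not depend on x.\<close>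

lemma AE_lborel_ex: "AE x in (lborel :: 'a::euclidean_space measure). P x \<Longrightarrow> \<exists>x. P x"
proof (rule ccontr)
  assume "AE x in (lborel :: 'a measure). P x" "\<nexists>x. P x"
  then have "AE x in (lborel :: 'a measure). False" by simp
  then show False by (simp add: AE_iff_measurable[OF _ refl])
qed

lemma AE_lborel_nonzero: "AE x in (lborel :: 'a::euclidean_space measure). x \<noteq> 0"
  by (rule AE_lborel_singleton)

section \<open>Exponents for which the energies and the equations are invariant\<close>

lemma energy_rescale:
  fixes u :: "'a::euclidean_space \<Rightarrow> real"
  assumes [measurable]: "u \<in> borel_measurable borel" and pos: "AE x in lborel. u x > 0" and \<mu>: "\<mu> > 0"
  shows "energy b q (rescale \<sigma> \<mu> u) = ennreal (\<mu> powr ((\<sigma> + b) * (q + 1) - real DIM('a))) * energy b q u"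
proof -
  let ?g = "\<lambda>x. ennreal (u x powr (q + 1) / norm x powr (b * (q + 1)))"
  \<comment> \<open>The power of u contributes \<sigma> (q + 1) and the weight b (q + 1); the
    dimension is subtracted later by the change of variables.\<close>
  let ?k = "\<mu> powr ((\<sigma> + b) * (q + 1))"
  have "energy b q (rescale \<sigma> \<mu> u) = (\<integral>\<^sup>+x. ennreal ?k * ?g (\<mu> *\<^sub>R x) \<partial>lborel)"
    unfolding energy_def
  proof (rule nn_integral_cong_AE)
    show "AE x in lborel. ennreal (rescale \<sigma> \<mu> u x powr (q + 1) / norm x powr (b * (q + 1)))
        = ennreal ?k * ?g (\<mu> *\<^sub>R x)"
      using AE_scale[OF pos \<mu>]
    proof eventually_elim
      case (elim x)
      have "rescale \<sigma> \<mu> u x powr (q + 1) / norm x powr (b * (q + 1))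
          = \<mu> powr (\<sigma> * (q + 1)) * u (\<mu> *\<^sub>R x) powr (q + 1) / norm x powr (b * (q + 1))"
        using elim by (simp add: rescale_def powr_mult powr_powr)
      also have "\<dots> = ?k * (u (\<mu> *\<^sub>R x) powr (q + 1) / norm (\<mu> *\<^sub>R x) powr (b * (q + 1)))"
        using \<mu> by (simp add: powr_mult distrib_right powr_add)
      finally show ?case by (simp only: ennreal_mult'[OF powr_ge_zero])
    qed
  qed
  also have "\<dots> = ennreal ?k * (\<integral>\<^sup>+x. ?g (\<mu> *\<^sub>R x) \<partial>lborel)"
    by (rule nn_integral_cmult) measurable
  also have "?k = \<mu> powr ((\<sigma> + b) * (q + 1) - real DIM('a)) * \<mu> ^ DIM('a)"
    using \<mu> by (simp add: powr_diff powr_realpow)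
  also have "ennreal \<dots> * (\<integral>\<^sup>+x. ?g (\<mu> *\<^sub>R x) \<partial>lborel)
      = ennreal (\<mu> powr ((\<sigma> + b) * (q + 1) - real DIM('a))) *
        (ennreal (\<mu> ^ DIM('a)) * (\<integral>\<^sup>+x. ?g (\<mu> *\<^sub>R x) \<partial>lborel))"
    using \<mu> by (simp add: ennreal_mult'' mult.assoc)
  also have "ennreal (\<mu> ^ DIM('a)) * (\<integral>\<^sup>+x. ?g (\<mu> *\<^sub>R x) \<partial>lborel) = energy b q u"
    unfolding energy_def by (rule nn_integral_scale[OF _ \<mu>, symmetric]) measurable
  finally show ?thesis .
qed

lemma energy_pos:
  fixes u :: "'a::euclidean_space \<Rightarrow> real"
  assumes [measurable]: "u \<in> borel_measurable borel" and pos: "AE x in lborel. u x > 0"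
  shows "energy b q u \<noteq> 0"
proof
  assume "energy b q u = 0"
  then have "AE x in lborel. ennreal (u x powr (q + 1) / norm x powr (b * (q + 1))) = 0"
    unfolding energy_def by (subst (asm) nn_integral_0_iff_AE) auto
  with pos AE_lborel_nonzero have "AE x in (lborel::'a measure). False"
  proof eventually_elim
    case (elim x)
    then have "u x powr (q + 1) / norm x powr (b * (q + 1)) > 0" by simp
    then show ?case using elim(3) by (simp only: ennreal_eq_0_iff not_le[symmetric])
  qed
  then show False using AE_lborel_ex by blast
qed

text \<open>A finite positive energy can be cancelled, which leaves a power of \<mu> equal to 1. A
  single value of \<mu> other than 1 then forces the exponent to vanish.\<close>

lemma energy_rescale_invariant_iff:
  fixes u :: "'a::euclidean_space \<Rightarrow> real"
  assumes "u \<in> borel_measurable borel" "AE x in lborel. u x > 0" "energy b q u < \<infinity>" "\<mu> > 0" "\<mu> \<noteq> 1"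
  shows "energy b q (rescale \<sigma> \<mu> u) = energy b q u \<longleftrightarrow> (\<sigma> + b) * (q + 1) = real DIM('a)"
proof -
  obtain r where r: "r \<ge> 0" "energy b q u = ennreal r"
    using assms(3) by (cases "energy b q u") auto
  have "r \<noteq> 0" using energy_pos[OF assms(1,2), of b q] r by auto
  let ?e = "(\<sigma> + b) * (q + 1) - real DIM('a)"
  have "energy b q (rescale \<sigma> \<mu> u) = ennreal (\<mu> powr ?e * r)"
    unfolding energy_rescale[OF assms(1,2,4)] r(2) by (simp only: ennreal_mult'[OF powr_ge_zero])
  then have "energy b q (rescale \<sigma> \<mu> u) = energy b q u \<longleftrightarrow> \<mu> powr ?e * r = r"
    using r by simp
  also have "\<dots> \<longleftrightarrow> \<mu> powr ?e = 1" using \<open>r \<noteq> 0\<close> by simp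
  also have "\<dots> \<longleftrightarrow> ?e = 0" using assms(4,5) by (simp add: powr_def)
  finally show ?thesis by simp
qed

lemma rhs_rescale:
  assumes "v (\<mu> *\<^sub>R x) > 0" "\<mu> > 0"
  shows "norm x powr (- b * (q + 1)) * rescale \<sigma> \<mu> v x powr q
    = \<mu> powr (\<sigma> * q + b * (q + 1)) * (norm (\<mu> *\<^sub>R x) powr (- b * (q + 1)) * v (\<mu> *\<^sub>R x) powr q)"
proof -
  have "norm x powr (- b * (q + 1)) = \<mu> powr (b * (q + 1)) * norm (\<mu> *\<^sub>R x) powr (- b * (q + 1))"
    using assms by (simp add: powr_mult mult.assoc[symmetric] flip: powr_add)
  moreover have "rescale \<sigma> \<mu> v x powr q = \<mu> powr (\<sigma> * q) * v (\<mu> *\<^sub>R x) powr q"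
    using assms by (simp add: rescale_def powr_mult powr_powr)
  ultimately show ?thesis by (simp add: powr_add mult_ac)
qed

text \<open>The rescaled u solves an equation whose right-hand side is a power of \<mu> times
  f(\<mu> x), and the rescaled right-hand side is another power of \<mu> times the same function.
  Uniqueness of right-hand sides and f > 0 almost everywhere make the two powers equal, and \<mu>
  other than 1 makes their exponents equal.\<close>

lemma weak_eq_rescale_invariant_iff:
  fixes u v :: "'a::euclidean_space \<Rightarrow> real"
  assumes eq: "weak_eq a p u (\<lambda>x. norm x powr (- b * (q + 1)) * v x powr q)"
    and [measurable]: "v \<in> borel_measurable borel" and pos: "AE x in lborel. v x > 0"
    and \<mu>: "\<mu> > 0" "\<mu> \<noteq> 1"
  shows "weak_eq a p (rescale \<sigma> \<mu> u) (\<lambda>x. norm x powr (- b * (q + 1)) * rescale \<tau> \<mu> v x powr q)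
    \<longleftrightarrow> \<tau> * q + b * (q + 1) = a * p + (\<sigma> + 1) * (p - 1) + 1"
proof -
  let ?f = "\<lambda>x. norm x powr (- b * (q + 1)) * v x powr q"
  let ?e = "a * p + (\<sigma> + 1) * (p - 1) + 1" and ?d = "\<tau> * q + b * (q + 1)"
  let ?g = "\<lambda>x. norm x powr (- b * (q + 1)) * rescale \<tau> \<mu> v x powr q"
  have R: "weak_eq a p (rescale \<sigma> \<mu> u) (\<lambda>x. \<mu> powr ?e * ?f (\<mu> *\<^sub>R x))"
    by (rule weak_eq_rescale[OF eq \<mu>(1)])
  have g_meas: "?g \<in> borel_measurable borel" unfolding rescale_def by measurable
  have g: "AE x in lborel. ?g x = \<mu> powr ?d * ?f (\<mu> *\<^sub>R x)"
    using AE_scale[OF pos \<mu>(1)]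
  proof eventually_elim
    case (elim x)
    then show ?case using rhs_rescale \<mu>(1) by blast
  qed
  show ?thesis
  proof
    assume "weak_eq a p (rescale \<sigma> \<mu> u) ?g"
    then have "AE x in lborel. ?g x = \<mu> powr ?e * ?f (\<mu> *\<^sub>R x)"
      using weak_eq_rhs_unique R by blast
    with g AE_scale[OF pos \<mu>(1)] AE_lborel_nonzero
    have "AE x in (lborel :: 'a measure). \<mu> powr ?d = \<mu> powr ?e"
    proof eventually_elim
      case (elim x)
      then have "?f (\<mu> *\<^sub>R x) \<noteq> 0" using \<mu> by simp
      with elim show ?case by (metis mult_right_cancel)
    qed
    then have "\<mu> powr ?d = \<mu> powr ?e" using AE_lborel_ex by blast
    then show "?d = ?e" using \<mu> powr_inj by simp
  next
    assume "?d = ?e"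
    with g have "AE x in lborel. \<mu> powr ?e * ?f (\<mu> *\<^sub>R x) = ?g x" by (simp only: eq_commute)
    moreover have "rescale \<sigma> \<mu> u \<in> borel_measurable borel"
      using weak_eq_imp_loc_integrable(1)[OF R] by (rule loc_integrable_measurable)
    ultimately show "weak_eq a p (rescale \<sigma> \<mu> u) ?g"
      by (intro weak_eq_cong[OF R] g_meas) simp_all
  qed
qed

lemma rescale_1: "rescale \<sigma> 1 u = u"
  by (simp add: rescale_def fun_eq_iff)

lemma rescale_pos:
  assumes "AE x in lborel. u x > 0" "\<mu> > 0"
  shows "AE x in lborel. rescale \<sigma> \<mu> u x > 0"
  using AE_scale[OF assms] by eventually_elim (use assms(2) in \<open>simp add: rescale_def\<close>)

lemma scaling_invariant_iff:
  fixes u v :: "'a::euclidean_space \<Rightarrow> real"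
  assumes sol: "solves_system a b p q1 q2 u v" and E: "energy b q1 u < \<infinity>" "energy b q2 v < \<infinity>"
  shows "scaling_invariant a b p q1 q2 \<sigma>1 \<sigma>2 u v \<longleftrightarrow>
    (\<sigma>1 + b) * (q1 + 1) = real DIM('a) \<and> (\<sigma>2 + b) * (q2 + 1) = real DIM('a) \<and>
    \<sigma>2 * q2 + b * (q2 + 1) = a * p + (\<sigma>1 + 1) * (p - 1) + 1 \<and>
    \<sigma>1 * q1 + b * (q1 + 1) = a * p + (\<sigma>2 + 1) * (p - 1) + 1" (is "_ \<longleftrightarrow> ?R")
proof -
  have pos: "AE x in lborel. u x > 0" "AE x in lborel. v x > 0"
    and eq: "weak_eq a p u (\<lambda>x. norm x powr (- b * (q2 + 1)) * v x powr q2)"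
      "weak_eq a p v (\<lambda>x. norm x powr (- b * (q1 + 1)) * u x powr q1)"
    using sol by (auto simp: solves_system_def)
  have meas: "u \<in> borel_measurable borel" "v \<in> borel_measurable borel"
    using weak_eq_imp_loc_integrable(1)[OF eq(1)] weak_eq_imp_loc_integrable(1)[OF eq(2)]
    by (auto intro: loc_integrable_measurable)
  have inv: "solves_system a b p q1 q2 (rescale \<sigma>1 \<mu> u) (rescale \<sigma>2 \<mu> v) \<and>
      energy b q1 (rescale \<sigma>1 \<mu> u) = energy b q1 u \<and>
      energy b q2 (rescale \<sigma>2 \<mu> v) = energy b q2 v \<longleftrightarrow> ?R" if "\<mu> > 0" "\<mu> \<noteq> 1" for \<mu>
    unfolding solves_system_def
    using rescale_pos[OF pos(1) that(1), of \<sigma>1] rescale_pos[OF pos(2) that(1), of \<sigma>2]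
      weak_eq_rescale_invariant_iff[OF eq(1) meas(2) pos(2) that, of \<sigma>1 \<sigma>2]
      weak_eq_rescale_invariant_iff[OF eq(2) meas(1) pos(1) that, of \<sigma>2 \<sigma>1]
      energy_rescale_invariant_iff[OF meas(1) pos(1) E(1) that, of \<sigma>1]
      energy_rescale_invariant_iff[OF meas(2) pos(2) E(2) that, of \<sigma>2]
    by blast
  show ?thesis
  proof
    assume "scaling_invariant a b p q1 q2 \<sigma>1 \<sigma>2 u v"
    \<comment> \<open>One value of \<mu> other than 1 already yields all four relations; \<mu> = 1,
      where rescaling is the identity, is treated separately in the converse.\<close>
    then show ?R using inv[of 2] unfolding scaling_invariant_def by simp
  next
    assume R: ?R
    show "scaling_invariant a b p q1 q2 \<sigma>1 \<sigma>2 u v"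
      unfolding scaling_invariant_def
    proof (intro allI impI)
      fix \<mu> :: real assume "\<mu> > 0"
      show "solves_system a b p q1 q2 (rescale \<sigma>1 \<mu> u) (rescale \<sigma>2 \<mu> v) \<and>
        energy b q1 (rescale \<sigma>1 \<mu> u) = energy b q1 u \<and> energy b q2 (rescale \<sigma>2 \<mu> v) = energy b q2 v"
      proof (cases "\<mu> = 1")
        case True
        then show ?thesis using sol by (simp add: rescale_1)
      next
        case False
        then show ?thesis using inv[OF \<open>\<mu> > 0\<close>] R by blast
      qed
    qed
  qed
qed

section \<open>Algebra of the critical exponents\<close>

lemma ex_scaling_invariant_iff:
  fixes u v :: "'a::euclidean_space \<Rightarrow> real"
  defines "n \<equiv> real DIM('a)"
  assumes "solves_system a b p q1 q2 u v" "energy b q1 u < \<infinity>" "energy b q2 v < \<infinity>" "q1 > 1" "q2 > 1"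
  shows "(\<exists>\<sigma>1 \<sigma>2. scaling_invariant a b p q1 q2 \<sigma>1 \<sigma>2 u v) \<longleftrightarrow>
    (p - 1) * (n / (q1 + 1)) + n / (q2 + 1) = n + p * (b - a - 1) \<and>
    (p - 1) * (n / (q2 + 1)) + n / (q1 + 1) = n + p * (b - a - 1)"
proof -
  define s1 where "s1 = n / (q1 + 1)"
  define s2 where "s2 = n / (q2 + 1)"
  \<comment> \<open>These identities remove the products of unknowns, so that the equations become
    linear in s1 and s2.\<close>
  have s: "s1 * q1 = n - s1" "s2 * q2 = n - s2"
    using assms(5,6) by (simp_all add: s1_def s2_def field_simps)
  have 1: "(\<sigma> + b) * (q1 + 1) = n \<longleftrightarrow> \<sigma> = s1 - b" for \<sigma>
    using assms(5) by (auto simp: s1_def field_simps)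
  have 2: "(\<sigma> + b) * (q2 + 1) = n \<longleftrightarrow> \<sigma> = s2 - b" for \<sigma>
    using assms(6) by (auto simp: s2_def field_simps)
  have "(\<exists>\<sigma>1 \<sigma>2. scaling_invariant a b p q1 q2 \<sigma>1 \<sigma>2 u v) \<longleftrightarrow>
    (s2 - b) * q2 + b * (q2 + 1) = a * p + (s1 - b + 1) * (p - 1) + 1 \<and>
    (s1 - b) * q1 + b * (q1 + 1) = a * p + (s2 - b + 1) * (p - 1) + 1"
    unfolding scaling_invariant_iff[OF assms(2-4)] n_def[symmetric] 1 2 by auto
  also have "\<dots> \<longleftrightarrow> (p - 1) * s1 + s2 = n + p * (b - a - 1) \<and> (p - 1) * s2 + s1 = n + p * (b - a - 1)"
    using s by (auto simp: algebra_simps)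
  finally show ?thesis unfolding s1_def s2_def .
qed

text \<open>In each degenerate case \<open>A\<close> and \<open>B\<close> become one equation. For p
  = 2 they agree by symmetry; for q1 = q2 both read n p / (q1 + 1) = n - p + p (b - a), which is
  solved for q1 by dividing by the positive right-hand side.\<close>

lemma critical_condition_iff:
  fixes n a b p q1 q2 :: real
  defines "A \<equiv> (p - 1) * (n / (q1 + 1)) + n / (q2 + 1) = n + p * (b - a - 1)"
    and "B \<equiv> (p - 1) * (n / (q2 + 1)) + n / (q1 + 1) = n + p * (b - a - 1)"
  assumes pos: "n > 0" "n - p + p * (b - a) > 0" "q1 > 1" "q2 > 1"
  shows "A \<and> B \<longleftrightarrow>
      (p = 2 \<and> 1 / (q1 + 1) + 1 / (q2 + 1) = (n + 2 * (b - a - 1)) / n) \<or>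
      (q1 = q2 \<and> q1 = n * p / (n - p + p * (b - a)) - 1)"
    and "p = 2 \<Longrightarrow> A \<and> B \<longleftrightarrow> 1 / (q1 + 1) + 1 / (q2 + 1) = (n + 2 * (b - a - 1)) / n"
    and "q1 = q2 \<Longrightarrow> A \<and> B \<longleftrightarrow> q1 = n * p / (n - p + p * (b - a)) - 1"
proof -
  have diff: "p = 2 \<or> q1 = q2" if A B
  proof -
    have "(p - 2) * (n / (q1 + 1) - n / (q2 + 1)) = 0" using that unfolding A_def B_def by algebra
    then have "p = 2 \<or> n / (q1 + 1) = n / (q2 + 1)" by simp
    then show ?thesis using pos by (auto simp: field_simps)
  qed
  show c2: "A \<and> B \<longleftrightarrow> 1 / (q1 + 1) + 1 / (q2 + 1) = (n + 2 * (b - a - 1)) / n" if "p = 2"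
  proof -
    have "1 / (q1 + 1) + 1 / (q2 + 1) = (n + 2 * (b - a - 1)) / n
        \<longleftrightarrow> n / (q1 + 1) + n / (q2 + 1) = n + 2 * (b - a - 1)"
      using pos(1) by (simp add: eq_divide_eq distrib_right)
    then show ?thesis using that by (auto simp: A_def B_def add.commute)
  qed
  show cq: "A \<and> B \<longleftrightarrow> q1 = n * p / (n - p + p * (b - a)) - 1" if "q1 = q2"
  proof -
    have "(p - 1) * (n / (q1 + 1)) + n / (q1 + 1) = n * p / (q1 + 1)"
      by (simp add: algebra_simps add_divide_distrib diff_divide_distrib)
    then have "A \<and> B \<longleftrightarrow> n * p / (q1 + 1) = n - p + p * (b - a)"
      using that by (simp add: A_def B_def algebra_simps)
    also have "\<dots> \<longleftrightarrow> n * p / (n - p + p * (b - a)) = q1 + 1"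
      using pos(2,3) by (auto simp: divide_eq_eq eq_divide_eq mult.commute)
    finally show ?thesis by auto
  qed
  show "A \<and> B \<longleftrightarrow>
      (p = 2 \<and> 1 / (q1 + 1) + 1 / (q2 + 1) = (n + 2 * (b - a - 1)) / n) \<or>
      (q1 = q2 \<and> q1 = n * p / (n - p + p * (b - a)) - 1)" using diff c2 cq by blast
qed

subsection \<open>Weighted Lebesgue norms\<close>

text \<open>This is the \<open>p\<close>-th power of the norm of \<open>|x|\<^sup>-\<^sup>a h\<close> in \<open>L\<^sup>p\<close>.\<close>

definition weighted_Lp :: "real \<Rightarrow> real \<Rightarrow> ('a::euclidean_space \<Rightarrow> 'b::real_normed_vector) \<Rightarrow> ennreal"
  where "weighted_Lp a p h = (\<integral>\<^sup>+x. ennreal ((norm x powr (- a) * norm (h x)) powr p) \<partial>lborel)"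

text \<open>A weak form of Young's inequality; optimising in \<open>d\<close> makes it a substitute for Hoelder's.\<close>

lemma weak_Young:
  fixes A y d p :: real
  assumes "p > 1" "A \<ge> 0" "y \<ge> 0" "d > 0"
  shows "A powr (p - 1) * y \<le> d * A powr p + d powr (1 - p) * y powr p"
proof (cases "y \<le> d * A")
  case True
  have "A powr (p - 1) * y \<le> A powr (p - 1) * (d * A)"
    using True by (intro mult_left_mono) auto
  also have "\<dots> = d * A powr p"
    using assms by (cases "A = 0") (auto simp: powr_diff field_simps)
  also have "\<dots> \<le> d * A powr p + d powr (1 - p) * y powr p" by simp
  finally show ?thesis .
next
  case False
  then have y: "y > 0" "A \<le> y / d" using assms by (auto simp: field_simps intro: le_less_trans[of 0 "d * A"])
  have "A powr (p - 1) * y \<le> (y / d) powr (p - 1) * y"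
    using assms y by (intro mult_right_mono powr_mono2) auto
  also have "\<dots> = d powr (1 - p) * y powr p"
    using assms y by (simp add: powr_divide powr_diff field_simps)
  also have "\<dots> \<le> d * A powr p + d powr (1 - p) * y powr p" using assms by simp
  finally show ?thesis .
qed

section \<open>Integrals of powers and finiteness of weighted norms of test functions\<close>

lemma nn_integral_powr_atLeast_1:
  fixes \<gamma> :: real
  assumes "\<gamma> > 1"
  shows "(\<integral>\<^sup>+t. ennreal (t powr (- \<gamma>)) * indicator {1..} t \<partial>lborel) = ennreal (1 / (\<gamma> - 1))"
proof -
  have "(\<integral>\<^sup>+t. ennreal (t powr (- \<gamma>)) * indicator {1..} t \<partial>lborel)
      = ennreal (0 - (- (1 powr (1 - \<gamma>) / (\<gamma> - 1))))"
  proof (rule nn_integral_FTC_atLeast[where F = "\<lambda>t. - (t powr (1 - \<gamma>) / (\<gamma> - 1))"])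
    show "DERIV (\<lambda>t. - (t powr (1 - \<gamma>) / (\<gamma> - 1))) t :> t powr (- \<gamma>)" if "1 \<le> t" for t
    proof -
      have "((\<lambda>t. t powr (1 - \<gamma>)) has_real_derivative (1 - \<gamma>) * t powr (1 - \<gamma> - 1)) (at t)"
        by (rule has_real_derivative_powr) (use that in simp)
      note D = DERIV_minus[OF DERIV_cdivide[OF this, of "\<gamma> - 1"]]
      have "(1 - \<gamma>) * y / (\<gamma> - 1) = - y" for y using assms by (simp add: divide_eq_eq algebra_simps)
      then show ?thesis using D by simp
    qed
    have "((\<lambda>t. - (t powr (1 - \<gamma>) / (\<gamma> - 1))) \<longlongrightarrow> - (0 / (\<gamma> - 1))) at_top"
      using assms by (intro tendsto_intros tendsto_neg_powr filterlim_ident) auto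
    then show "((\<lambda>t. - (t powr (1 - \<gamma>) / (\<gamma> - 1))) \<longlongrightarrow> 0) at_top" by simp
  qed auto
  then show ?thesis by simp
qed

text \<open>On the punctured unit ball |x|^(-s) is 1 plus the integral of s t^(s-1) over 1 <= t <=
  1/|x|, and t <= 1/|x| says that t x lies in the unit ball. After Tonelli, dilation turns the inner
  integral into t^(-n) times the volume of the ball, and t^(s-1-n) is integrable on t >= 1 because s
  < n.\<close>

lemma nn_integral_norm_powr_cball:
  assumes "0 \<le> s" "s < real DIM('a::euclidean_space)"
  shows "(\<integral>\<^sup>+x. ennreal (norm x powr (- s)) * indicator (cball 0 1) x \<partial>(lborel :: 'a measure)) < \<infinity>"
proof -
  let ?n = "real DIM('a)"
  let ?B = "indicator (cball (0::'a) 1) :: 'a \<Rightarrow> ennreal"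
  let ?g = "\<lambda>t. ennreal (s * t powr (s - 1)) * indicator {1..} (t::real)"
  have [measurable]: "cball (0::'a) 1 \<in> sets borel" by simp
  have pw: "ennreal (norm x powr (- s)) * ?B x \<le> ?B x + (\<integral>\<^sup>+t. ?g t * ?B (t *\<^sub>R x) \<partial>lborel)" for x
  proof (cases "x \<noteq> 0 \<and> norm x \<le> 1")
    case True
    let ?T = "1 / norm x"
    have T: "?T \<ge> 1" using True by simp
    have "(\<integral>\<^sup>+t. ennreal (s * t powr (s - 1)) * indicator {1..?T} t \<partial>lborel) = ennreal (?T powr s - 1 powr s)"
    proof (rule nn_integral_FTC_Icc)
      show "DERIV (\<lambda>t. t powr s) t :> s * t powr (s - 1)" if "t \<in> {1..?T}" for t
        using that by (auto intro!: derivative_eq_intros simp: powr_diff)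
    qed (use assms T in auto)
    also have "(\<integral>\<^sup>+t. ennreal (s * t powr (s - 1)) * indicator {1..?T} t \<partial>lborel)
        = (\<integral>\<^sup>+t. ?g t * ?B (t *\<^sub>R x) \<partial>lborel)"
      using True by (intro nn_integral_cong) (auto simp: indicator_def field_simps)
    finally have "?B x + (\<integral>\<^sup>+t. ?g t * ?B (t *\<^sub>R x) \<partial>lborel) = ennreal (1 + (?T powr s - 1))"
      using True T assms by (simp add: ennreal_plus[symmetric] ge_one_powr_ge_zero del: ennreal_plus flip: ennreal_1)
    also have "1 + (?T powr s - 1) = norm x powr (- s)"
      using True by (simp add: powr_divide powr_minus_divide)
    finally show ?thesis using True by simp
  next
    case False
    \<comment> \<open>The origin lands here as well, since \<open>0 powr (- s) = 0\<close>.\<close>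
    then have *: "ennreal (norm x powr (- s)) * ?B x = 0" by (auto simp: indicator_def)
    show ?thesis unfolding * by simp
  qed
  have vol: "(\<integral>\<^sup>+x. ?B x \<partial>lborel) < \<infinity>"
    using emeasure_lborel_cball_finite by simp
  have inner: "?g t * (\<integral>\<^sup>+x. ?B (t *\<^sub>R x) \<partial>lborel)
      = ennreal s * (\<integral>\<^sup>+x. ?B x \<partial>lborel) * (ennreal (t powr (- (?n - s + 1))) * indicator {1..} t)" for t
  proof (cases "t \<ge> 1")
    case True
    have eq1: "(\<integral>\<^sup>+x. ?B x \<partial>lborel) = ennreal (t ^ DIM('a)) * (\<integral>\<^sup>+x. ?B (t *\<^sub>R x) \<partial>lborel)"
      by (rule nn_integral_scale) (use True in \<open>measurable, simp\<close>)
    have eq2: "s * t powr (s - 1) = s * t powr (- (?n - s + 1)) * t ^ DIM('a)"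
      using True by (simp add: powr_realpow[symmetric] algebra_simps flip: powr_add)
    show ?thesis
      unfolding eq1 eq2 using True assms by (simp add: ennreal_mult mult_ac)
  qed simp
  have "(\<integral>\<^sup>+x. ennreal (norm x powr (- s)) * ?B x \<partial>lborel)
      \<le> (\<integral>\<^sup>+x. ?B x + (\<integral>\<^sup>+t. ?g t * ?B (t *\<^sub>R x) \<partial>lborel) \<partial>lborel)"
    by (intro nn_integral_mono pw)
  also have "\<dots> = (\<integral>\<^sup>+x. ?B x \<partial>lborel) + (\<integral>\<^sup>+x. (\<integral>\<^sup>+t. ?g t * ?B (t *\<^sub>R x) \<partial>lborel) \<partial>lborel)"
    by (rule nn_integral_add) measurable
  also have "(\<integral>\<^sup>+x. (\<integral>\<^sup>+t. ?g t * ?B (t *\<^sub>R x) \<partial>lborel) \<partial>lborel)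
      = (\<integral>\<^sup>+t. (\<integral>\<^sup>+x. ?g t * ?B (t *\<^sub>R x) \<partial>lborel) \<partial>lborel)"
    by (rule lborel_pair.Fubini') measurable
  also have "\<dots> = (\<integral>\<^sup>+t. ?g t * (\<integral>\<^sup>+x. ?B (t *\<^sub>R x) \<partial>lborel) \<partial>lborel)"
    by (intro nn_integral_cong nn_integral_cmult) measurable
  also have "\<dots> = ennreal s * (\<integral>\<^sup>+x. ?B x \<partial>lborel) * ennreal (1 / (?n - s + 1 - 1))"
    unfolding inner by (subst nn_integral_cmult, measurable, subst nn_integral_powr_atLeast_1) (use assms in auto)
  also have "(\<integral>\<^sup>+x. ?B x \<partial>lborel) + \<dots> < \<infinity>"
    using vol by (auto simp: ennreal_mult_less_top)
  finally show ?thesis .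
qed

text \<open>Inside the unit ball the weight is integrable because a p < n; outside it the weight is
  at most 1 because a >= 0, and the support has finite volume.\<close>

lemma weighted_Lp_bounded_support:
  fixes h :: "'a::euclidean_space \<Rightarrow> 'b::real_normed_vector"
  assumes "0 \<le> a" "p > 1" "a * p < real DIM('a)"
    and B: "\<And>x. norm (h x) \<le> B" and R: "\<And>x. h x \<noteq> 0 \<Longrightarrow> norm x \<le> R"
  shows "weighted_Lp a p h < \<infinity>"
proof -
  let ?B1 = "indicator (cball (0::'a) 1) :: 'a \<Rightarrow> ennreal"
  let ?BR = "indicator (cball (0::'a) R) :: 'a \<Rightarrow> ennreal"
  have [measurable]: "cball (0::'a) r \<in> sets borel" for r by simp
  have B0: "B \<ge> 0" using B[of 0] norm_ge_zero order_trans by blast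
  have pw: "ennreal ((norm x powr (- a) * norm (h x)) powr p)
      \<le> ennreal (B powr p) * (ennreal (norm x powr (- (a * p))) * ?B1 x + ?BR x)" for x
  proof (cases "h x = 0")
    case False
    then have xR: "norm x \<le> R" by (rule R)
    have "(norm x powr (- a) * norm (h x)) powr p \<le> (norm x powr (- a) * B) powr p"
      using assms B[of x] by (intro powr_mono2 mult_left_mono) auto
    also have "\<dots> = B powr p * norm x powr (- (a * p))"
      using B0 by (simp add: powr_mult powr_powr)
    finally have 1: "ennreal ((norm x powr (- a) * norm (h x)) powr p)
        \<le> ennreal (B powr p) * ennreal (norm x powr (- (a * p)))"
      using B0 by (simp add: ennreal_mult''[symmetric] ennreal_leI)
    have 2: "ennreal (norm x powr (- (a * p))) \<le> ennreal (norm x powr (- (a * p))) * ?B1 x + ?BR x"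
    proof (cases "norm x \<le> 1")
      case True
      then show ?thesis by simp
    next
      case False
      have "x \<noteq> 0" using False by auto
      have "norm x powr (- (a * p)) \<le> norm x powr 0"
        using False assms by (intro powr_mono) auto
      then have "ennreal (norm x powr (- (a * p))) \<le> 1" using \<open>x \<noteq> 0\<close> by simp
      then show ?thesis using False xR by simp
    qed
    show ?thesis
      by (rule order_trans[OF 1 mult_left_mono[OF 2]]) simp
  qed (use assms in simp)
  have "weighted_Lp a p h \<le> (\<integral>\<^sup>+x. ennreal (B powr p) *
      (ennreal (norm x powr (- (a * p))) * ?B1 x + ?BR x) \<partial>lborel)"
    unfolding weighted_Lp_def by (intro nn_integral_mono pw)
  also have "\<dots> = ennreal (B powr p) * ((\<integral>\<^sup>+x. ennreal (norm x powr (- (a * p))) * ?B1 x \<partial>lborel)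
      + (\<integral>\<^sup>+x. ?BR x \<partial>lborel))"
    by (subst nn_integral_cmult, measurable, subst nn_integral_add, measurable)
  also have "\<dots> < \<infinity>"
    using nn_integral_norm_powr_cball[where 'a='a, of "a * p"] assms emeasure_lborel_cball_finite[of "0::'a" R]
    by (simp add: ennreal_mult_less_top)
  finally show ?thesis .
qed

lemma weighted_Lp_gradient_finite:
  fixes \<phi> :: "'a::euclidean_space \<Rightarrow> real"
  assumes "0 \<le> a" "p > 1" "a * p < real DIM('a)" "\<phi> \<in> test_functions"
  shows "weighted_Lp a p (gradient \<phi>) < \<infinity>"
proof -
  obtain B R where "\<And>x. norm (gradient \<phi> x) \<le> B" "\<And>x. gradient \<phi> x \<noteq> 0 \<Longrightarrow> norm x \<le> R"
    using test_function_bounds[OF assms(4)] by metis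
  then show ?thesis using weighted_Lp_bounded_support[OF assms(1-3)] by blast
qed

text \<open>\<open>D_norm\<close> is built on the Bochner integral, which is 0 for non-integrable
  functions, so its smallness carries information only once integrability is known. For test
  functions that is \<open>weighted_Lp_gradient_finite\<close>.\<close>

lemma weighted_Lp_less_D_norm:
  fixes \<phi> :: "'a::euclidean_space \<Rightarrow> real"
  assumes "0 \<le> a" "p > 1" "a * p < real DIM('a)" and \<phi>: "\<phi> \<in> test_functions"
    and "D_norm a p \<phi> < e"
  shows "weighted_Lp a p (gradient \<phi>) \<le> ennreal (e powr p)"
proof -
  have [measurable]: "gradient \<phi> \<in> borel_measurable borel" using \<phi> by (rule test_function_measurable)
  let ?h = "\<lambda>x. (norm x powr (- a) * norm (gradient \<phi> x)) powr p"
  have "integrable lborel ?h"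
    using weighted_Lp_gradient_finite[OF assms(1-4)] by (intro integrableI_nonneg) (auto simp: weighted_Lp_def)
  then have eq: "weighted_Lp a p (gradient \<phi>) = ennreal (LINT x|lborel. ?h x)"
    unfolding weighted_Lp_def by (intro nn_integral_eq_integral) auto
  have "(LINT x|lborel. ?h x) \<ge> 0" by (intro Bochner_Integration.integral_nonneg) auto
  then have "(LINT x|lborel. ?h x) = D_norm a p \<phi> powr p"
    using assms(2) by (simp add: D_norm_def powr_powr)
  also have "\<dots> \<le> e powr p"
    using assms by (intro powr_mono2) (auto simp: D_norm_def)
  finally show ?thesis unfolding eq by (rule ennreal_leI)
qed

subsection \<open>Hardy's inequality\<close>

text \<open>
  Along rays \<open>\<phi>(x) = - \<integral>\<^sub>1\<^sup>\<infinity> x \<bullet> \<nabla>\<phi>(t x) dt\<close>; after inserting the weight \<open>t\<^sup>\<beta>\<close> the inequality follows from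
  Tonelli's theorem and the scaling of Lebesgue measure.
\<close>

lemma test_function_le_radial_integral:
  fixes \<phi> :: "'a::euclidean_space \<Rightarrow> real"
  assumes \<phi>: "\<phi> \<in> test_functions" and "x \<noteq> 0"
  shows "ennreal \<bar>\<phi> x\<bar> \<le> (\<integral>\<^sup>+t. ennreal (norm x * norm (gradient \<phi> (t *\<^sub>R x))) * indicator {1..} t \<partial>lborel)"
proof -
  obtain R where R: "R > 0" "\<And>x. \<phi> x \<noteq> 0 \<Longrightarrow> norm x \<le> R"
    using test_function_bounds[OF \<phi>] by metis
  \<comment> \<open>Far enough along the ray that T x has norm at least R + 1 and lies outside the
    support; the maximum with 1 keeps the interval of integration nonempty.\<close>
  define T where "T = max 1 ((R + 1) / norm x)"
  have T: "T \<ge> 1" by (simp add: T_def)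
  have "norm (T *\<^sub>R x) \<ge> R + 1" using assms(2) T by (simp add: T_def field_simps max_def)
  then have "\<phi> (T *\<^sub>R x) = 0" using R(2)[of "T *\<^sub>R x"] by force
  let ?f = "\<lambda>t. x \<bullet> gradient \<phi> (t *\<^sub>R x)"
  have der: "((\<lambda>t. \<phi> (t *\<^sub>R x)) has_vector_derivative ?f t) (at t within {1..T})" for t
  proof -
    have "((\<lambda>t. \<phi> (t *\<^sub>R x)) has_derivative (\<lambda>h. (h *\<^sub>R x) \<bullet> gradient \<phi> (t *\<^sub>R x))) (at t)"
      by (rule has_derivative_compose[of "\<lambda>t. t *\<^sub>R x" "\<lambda>h. h *\<^sub>R x" t UNIV \<phi> "\<lambda>h. h \<bullet> gradient \<phi> (t *\<^sub>R x)"])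
        (use test_function_GDERIV[OF \<phi>] in \<open>auto simp: gderiv_def intro!: derivative_eq_intros\<close>)
    then show ?thesis
      by (simp add: has_vector_derivative_def has_derivative_at_withinI)
  qed
  have cont: "continuous_on {1..T} ?f"
    by (intro continuous_intros continuous_on_compose2[OF test_function_continuous_gradient[OF \<phi>]]) auto
  have FTC: "has_bochner_integral lborel (\<lambda>t. indicator {1..T} t *\<^sub>R ?f t) (\<phi> (T *\<^sub>R x) - \<phi> (1 *\<^sub>R x))"
    by (rule has_bochner_integral_FTC_Icc[OF T der cont])
  have "ennreal \<bar>\<phi> x\<bar> = ennreal (norm (\<phi> (T *\<^sub>R x) - \<phi> (1 *\<^sub>R x)))"
    using \<open>\<phi> (T *\<^sub>R x) = 0\<close> by simp
  also have "\<dots> \<le> (\<integral>\<^sup>+t. norm (indicator {1..T} t *\<^sub>R ?f t) \<partial>lborel)"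
    by (rule has_bochner_integral_norm_bound[OF FTC])
  also have "\<dots> \<le> (\<integral>\<^sup>+t. ennreal (norm x * norm (gradient \<phi> (t *\<^sub>R x))) * indicator {1..} t \<partial>lborel)"
    by (intro nn_integral_mono) (auto simp: indicator_def Cauchy_Schwarz_ineq2 intro!: ennreal_leI)
  finally show ?thesis .
qed

text \<open>In effect Hoelder's inequality on the ray: the weight t^(\<beta> (p - 1)) is dual to
  t^(-\<beta>), which is integrable on t >= 1 because \<beta> > 1.\<close>

lemma test_function_powr_le_radial_integral:
  fixes \<phi> :: "'a::euclidean_space \<Rightarrow> real"
  assumes \<phi>: "\<phi> \<in> test_functions" and "x \<noteq> 0" "p > 1" "\<beta> > 1"
  shows "ennreal (\<bar>\<phi> x\<bar> powr p) \<le> ennreal (2 * (2 / (\<beta> - 1)) powr (p - 1)) *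
    (\<integral>\<^sup>+t. ennreal (t powr (\<beta> * (p - 1)) * (norm x * norm (gradient \<phi> (t *\<^sub>R x))) powr p) * indicator {1..} t \<partial>lborel)"
    (is "_ \<le> ennreal ?C * ?J")
proof (cases "\<phi> x = 0 \<or> ?J = \<infinity>")
  case True
  have "?C > 0" using assms by simp
  then show ?thesis using True assms by (auto simp: ennreal_mult_top)
next
  case False
  obtain j where j: "?J = ennreal j" "j \<ge> 0" using False by (cases ?J) auto
  have [measurable]: "gradient \<phi> \<in> borel_measurable borel" using \<phi> by (rule test_function_measurable)
  let ?y = "\<lambda>t. norm x * norm (gradient \<phi> (t *\<^sub>R x))"
  define f where "f = \<bar>\<phi> x\<bar>"
  define c where "c = 1 / (\<beta> - 1)"
  \<comment> \<open>Young's inequality is applied with A = 1 and d = M t^(-\<beta>). Since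
    t^(-\<beta>) has integral c, this M makes the first term integrate to f / 2, which is absorbed
    on the left.\<close>
  define M where "M = f / (2 * c)"
  have pos: "f > 0" "c > 0" "M > 0" using False assms by (auto simp: f_def c_def M_def)
  have Young: "?y t \<le> M * t powr (- \<beta>) + M powr (1 - p) * (t powr (\<beta> * (p - 1)) * ?y t powr p)" if "t \<ge> 1" for t
  proof -
    have "1 powr (p - 1) * ?y t \<le> (M * t powr (- \<beta>)) * 1 powr p + (M * t powr (- \<beta>)) powr (1 - p) * ?y t powr p"
      by (rule weak_Young) (use assms pos that in auto)
    moreover have "(M * t powr (- \<beta>)) powr (1 - p) = M powr (1 - p) * t powr (\<beta> * (p - 1))"
      using pos by (simp add: powr_mult powr_powr algebra_simps)
    ultimately show ?thesis by simp
  qed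
  have "ennreal f \<le> (\<integral>\<^sup>+t. ennreal (?y t) * indicator {1..} t \<partial>lborel)"
    unfolding f_def by (rule test_function_le_radial_integral[OF \<phi> assms(2)])
  also have "\<dots> \<le> (\<integral>\<^sup>+t. ennreal M * (ennreal (t powr (- \<beta>)) * indicator {1..} t)
      + ennreal (M powr (1 - p)) * (ennreal (t powr (\<beta> * (p - 1)) * ?y t powr p) * indicator {1..} t) \<partial>lborel)"
  proof (intro nn_integral_mono)
    fix t :: real
    show "ennreal (?y t) * indicator {1..} t \<le> ennreal M * (ennreal (t powr (- \<beta>)) * indicator {1..} t)
        + ennreal (M powr (1 - p)) * (ennreal (t powr (\<beta> * (p - 1)) * ?y t powr p) * indicator {1..} t)"
    proof (cases "t \<ge> 1")
      case True
      have "ennreal (?y t) \<le> ennreal (M * t powr (- \<beta>) + M powr (1 - p) * (t powr (\<beta> * (p - 1)) * ?y t powr p))"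
        by (intro ennreal_leI Young True)
      also have "\<dots> = ennreal M * ennreal (t powr (- \<beta>))
          + ennreal (M powr (1 - p)) * ennreal (t powr (\<beta> * (p - 1)) * ?y t powr p)"
        using pos by (subst ennreal_plus) (auto simp: ennreal_mult)
      finally show ?thesis using True by simp
    qed simp
  qed
  also have "\<dots> = ennreal M * (\<integral>\<^sup>+t. ennreal (t powr (- \<beta>)) * indicator {1..} t \<partial>lborel) + ennreal (M powr (1 - p)) * ?J"
    by (subst nn_integral_add, measurable) (subst nn_integral_cmult, measurable)+
  also have "\<dots> = ennreal (M * c + M powr (1 - p) * j)"
    unfolding nn_integral_powr_atLeast_1[OF assms(4)] j(1) c_def[symmetric]
    using pos j(2) by (subst ennreal_plus) (auto simp: ennreal_mult)
  finally have "f \<le> M * c + M powr (1 - p) * j"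
    using pos j by (subst (asm) ennreal_le_iff) auto
  then have "f / 2 \<le> M powr (1 - p) * j" using pos by (simp add: M_def)
  then have "f / 2 * M powr (p - 1) \<le> M powr (1 - p) * j * M powr (p - 1)"
    by (rule mult_right_mono) simp
  also have "\<dots> = j" using pos by (simp add: mult.commute mult.left_commute flip: powr_add)
  finally have "f * M powr (p - 1) \<le> 2 * j" by simp
  moreover have "M powr (p - 1) = f powr (p - 1) / (2 * c) powr (p - 1)"
    unfolding M_def using pos by (simp add: powr_divide)
  moreover have "f * f powr (p - 1) = f powr p" using pos by (simp add: powr_diff)
  ultimately have "f powr p \<le> ?C * j"
    using pos by (simp add: c_def[symmetric] field_simps) (simp add: c_def)
  then show ?thesis
    unfolding j(1) f_def[symmetric] using assms by (simp add: ennreal_mult''[symmetric] ennreal_leI j(2))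
qed

lemma Hardy_inequality:
  assumes "p > 1" "a < (real DIM('a::euclidean_space) - p) / p"
  obtains K where "K > 0" "\<And>\<phi> :: 'a \<Rightarrow> real. \<phi> \<in> test_functions \<Longrightarrow>
    weighted_Lp (a + 1) p \<phi> \<le> ennreal K * weighted_Lp a p (gradient \<phi>)"
proof -
  let ?n = "real DIM('a)"
  have gap: "?n - a * p - p > 0" using assms by (simp add: field_simps)
  \<comment> \<open>Half of the gap is spent on \<beta> and half is left for \<gamma>: \<beta> = 1 +
    \<delta> / (p - 1) and \<gamma> = 1 + \<delta>, so both t^(-\<beta>) and t^(-\<gamma>) are
    integrable on t >= 1.\<close>
  define \<delta> where "\<delta> = (?n - a * p - p) / 2"
  have \<delta>: "\<delta> > 0" "a * p + p + \<delta> < ?n" using gap by (auto simp: \<delta>_def field_simps)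
  define \<beta> where "\<beta> = 1 + \<delta> / (p - 1)"
  have \<beta>: "\<beta> > 1" using \<delta> assms by (simp add: \<beta>_def)
  define \<gamma> where "\<gamma> = ?n - a * p - \<beta> * (p - 1)"
  have "\<beta> * (p - 1) = (p - 1) + \<delta>"
    using assms by (simp add: \<beta>_def distrib_right)
  then have \<gamma>: "\<gamma> > 1" using \<delta> by (simp add: \<gamma>_def)
  define C where "C = 2 * (2 / (\<beta> - 1)) powr (p - 1)"
  have C: "C > 0" using \<beta> by (simp add: C_def)
  show ?thesis
  proof (rule that[of "C * (1 / (\<gamma> - 1))"])
    show "C * (1 / (\<gamma> - 1)) > 0" using C \<gamma> by simp
    fix \<phi> :: "'a \<Rightarrow> real" assume \<phi>: "\<phi> \<in> test_functions"
    have [measurable]: "gradient \<phi> \<in> borel_measurable borel" using \<phi> by (rule test_function_measurable)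
    let ?h = "\<lambda>x. ennreal ((norm x powr (- a) * norm (gradient \<phi> x)) powr p)"
    \<comment> \<open>The additional exponent a p pays for moving the weight from x to t x.\<close>
    let ?q = "\<lambda>t. ennreal (t powr (\<beta> * (p - 1) + a * p)) * indicator {1..} (t::real)"
    have pw: "ennreal ((norm x powr (- (a + 1)) * norm (\<phi> x)) powr p)
        \<le> ennreal C * (\<integral>\<^sup>+t. ?q t * ?h (t *\<^sub>R x) \<partial>lborel)" for x
    proof (cases "x = 0")
      case False
      let ?k = "norm x powr (- ((a + 1) * p))"
      have "(norm x powr (- (a + 1)) * norm (\<phi> x)) powr p = ?k * \<bar>\<phi> x\<bar> powr p"
        by (simp add: powr_mult powr_powr algebra_simps)
      then have "ennreal ((norm x powr (- (a + 1)) * norm (\<phi> x)) powr p) = ennreal ?k * ennreal (\<bar>\<phi> x\<bar> powr p)"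
        by (simp add: ennreal_mult)
      also have "\<dots> \<le> ennreal ?k * (ennreal C * (\<integral>\<^sup>+t. ennreal (t powr (\<beta> * (p - 1)) *
          (norm x * norm (gradient \<phi> (t *\<^sub>R x))) powr p) * indicator {1..} t \<partial>lborel))"
        unfolding C_def
        by (intro mult_left_mono test_function_powr_le_radial_integral \<phi> False assms \<beta>) simp
      also have "\<dots> = ennreal C * (\<integral>\<^sup>+t. ennreal ?k * (ennreal (t powr (\<beta> * (p - 1)) *
          (norm x * norm (gradient \<phi> (t *\<^sub>R x))) powr p) * indicator {1..} t) \<partial>lborel)"
        by (subst nn_integral_cmult) (measurable, simp add: mult.left_commute)
      also have "(\<integral>\<^sup>+t. ennreal ?k * (ennreal (t powr (\<beta> * (p - 1)) *
          (norm x * norm (gradient \<phi> (t *\<^sub>R x))) powr p) * indicator {1..} t) \<partial>lborel)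
          = (\<integral>\<^sup>+t. ?q t * ?h (t *\<^sub>R x) \<partial>lborel)"
      proof (intro nn_integral_cong)
        fix t :: real
        show "ennreal ?k * (ennreal (t powr (\<beta> * (p - 1)) *
          (norm x * norm (gradient \<phi> (t *\<^sub>R x))) powr p) * indicator {1..} t) = ?q t * ?h (t *\<^sub>R x)"
        proof (cases "t \<ge> 1")
          case True
          let ?g = "norm (gradient \<phi> (t *\<^sub>R x)) powr p"
          have "?k * (t powr (\<beta> * (p - 1)) * (norm x * norm (gradient \<phi> (t *\<^sub>R x))) powr p)
              = t powr (\<beta> * (p - 1)) * (norm x powr (- ((a + 1) * p)) * norm x powr p) * ?g"
            by (simp add: powr_mult mult_ac)
          also have "norm x powr (- ((a + 1) * p)) * norm x powr p = norm x powr (- a * p)"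
            by (simp add: algebra_simps flip: powr_add)
          also have "t powr (\<beta> * (p - 1)) * norm x powr (- a * p) * ?g
              = t powr (\<beta> * (p - 1)) * (t powr (a * p) * t powr (- a * p)) * norm x powr (- a * p) * ?g"
            using True by (simp flip: powr_add)
          also have "\<dots> = t powr (\<beta> * (p - 1) + a * p) * (norm (t *\<^sub>R x) powr (- a) * norm (gradient \<phi> (t *\<^sub>R x))) powr p"
            using True by (simp add: powr_mult powr_powr powr_add mult_ac)
          finally show ?thesis using True by (simp add: ennreal_mult[symmetric])
        qed simp
      qed
      finally show ?thesis .
    qed simp
    \<comment> \<open>The dilation contributes t^(-n), so the total exponent is \<beta> (p - 1) + a
      p - n = - \<gamma>.\<close>
    have inner: "?q t * (\<integral>\<^sup>+x. ?h (t *\<^sub>R x) \<partial>lborel)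
        = weighted_Lp a p (gradient \<phi>) * (ennreal (t powr (- \<gamma>)) * indicator {1..} t)" for t
    proof (cases "t \<ge> 1")
      case True
      have "weighted_Lp a p (gradient \<phi>) = ennreal (t ^ DIM('a)) * (\<integral>\<^sup>+x. ?h (t *\<^sub>R x) \<partial>lborel)"
        unfolding weighted_Lp_def by (rule nn_integral_scale) (use True in \<open>measurable, simp\<close>)
      moreover have "t powr (\<beta> * (p - 1) + a * p) = t powr (- \<gamma>) * t ^ DIM('a)"
        using True by (simp add: powr_realpow[symmetric] \<gamma>_def flip: powr_add)
      ultimately show ?thesis
        using True by (simp add: ennreal_mult mult_ac)
    qed simp
    have "weighted_Lp (a + 1) p \<phi> \<le> (\<integral>\<^sup>+x. ennreal C * (\<integral>\<^sup>+t. ?q t * ?h (t *\<^sub>R x) \<partial>lborel) \<partial>lborel)"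
      unfolding weighted_Lp_def by (intro nn_integral_mono pw)
    also have "\<dots> = ennreal C * (\<integral>\<^sup>+x. (\<integral>\<^sup>+t. ?q t * ?h (t *\<^sub>R x) \<partial>lborel) \<partial>lborel)"
      by (intro nn_integral_cmult) measurable
    also have "(\<integral>\<^sup>+x. (\<integral>\<^sup>+t. ?q t * ?h (t *\<^sub>R x) \<partial>lborel) \<partial>lborel)
        = (\<integral>\<^sup>+t. (\<integral>\<^sup>+x. ?q t * ?h (t *\<^sub>R x) \<partial>lborel) \<partial>lborel)"
      by (rule lborel_pair.Fubini') measurable
    also have "\<dots> = (\<integral>\<^sup>+t. ?q t * (\<integral>\<^sup>+x. ?h (t *\<^sub>R x) \<partial>lborel) \<partial>lborel)"
      by (intro nn_integral_cong nn_integral_cmult) measurable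
    also have "\<dots> = weighted_Lp a p (gradient \<phi>) * ennreal (1 / (\<gamma> - 1))"
      unfolding inner by (subst nn_integral_cmult) (use \<gamma> in \<open>auto simp: nn_integral_powr_atLeast_1\<close>)
    also have "ennreal C * (weighted_Lp a p (gradient \<phi>) * ennreal (1 / (\<gamma> - 1)))
        = ennreal (C * (1 / (\<gamma> - 1))) * weighted_Lp a p (gradient \<phi>)"
      using C \<gamma> by (subst ennreal_mult) (auto simp: mult_ac)
    finally show "weighted_Lp (a + 1) p \<phi> \<le> ennreal (C * (1 / (\<gamma> - 1))) * weighted_Lp a p (gradient \<phi>)" .
  qed
qed

section \<open>Sums, limits and local integrability in the weighted norms\<close>

lemma weighted_Lp_le_sum:
  fixes f :: "'a::euclidean_space \<Rightarrow> 'b::{real_normed_vector, second_countable_topology}"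
    and g :: "'a \<Rightarrow> 'c::{real_normed_vector, second_countable_topology}"
  assumes "p > 1" and [measurable]: "f \<in> borel_measurable borel" "g \<in> borel_measurable borel"
    and le: "\<And>x. norm (h x) \<le> norm (f x) + norm (g x)"
  shows "weighted_Lp a p h \<le> ennreal (2 powr p) * (weighted_Lp a p f + weighted_Lp a p g)"
proof -
  have pw: "ennreal ((norm x powr (- a) * norm (h x)) powr p)
    \<le> ennreal (2 powr p) * (ennreal ((norm x powr (- a) * norm (f x)) powr p)
      + ennreal ((norm x powr (- a) * norm (g x)) powr p))" for x
  proof -
    let ?k = "norm x powr (- a)"
    let ?m = "max (norm (f x)) (norm (g x))"
    \<comment> \<open>A crude stand-in for Minkowski's inequality: the p-th power of a maximum is at
      most the sum of the p-th powers. The factor 2^p affects constants and leaves decay rates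
      intact.\<close>
    have "norm (h x) \<le> 2 * ?m" using le[of x] by linarith
    then have "(?k * norm (h x)) powr p \<le> (?k * (2 * ?m)) powr p"
      using assms(1) by (intro powr_mono2 mult_left_mono) auto
    also have "\<dots> = 2 powr p * (?k * ?m) powr p"
      by (simp add: powr_mult le_max_iff_disj)
    also have "(?k * ?m) powr p \<le> (?k * norm (f x)) powr p + (?k * norm (g x)) powr p"
      by (auto simp: max_def)
    finally have "(?k * norm (h x)) powr p \<le> 2 powr p * ((?k * norm (f x)) powr p + (?k * norm (g x)) powr p)"
      by simp
    then show ?thesis
      by (simp add: ennreal_leI ennreal_mult[symmetric] ennreal_plus[symmetric] del: ennreal_plus)
  qed
  have "weighted_Lp a p h \<le> (\<integral>\<^sup>+x. ennreal (2 powr p) * (ennreal ((norm x powr (- a) * norm (f x)) powr p)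
      + ennreal ((norm x powr (- a) * norm (g x)) powr p)) \<partial>lborel)"
    unfolding weighted_Lp_def by (intro nn_integral_mono pw)
  also have "\<dots> = ennreal (2 powr p) * (weighted_Lp a p f + weighted_Lp a p g)"
    unfolding weighted_Lp_def by (subst nn_integral_cmult, measurable, subst nn_integral_add, measurable)
  finally show ?thesis .
qed

text \<open>Used to send one index of a Cauchy estimate to infinity, and to carry Hardy's inequality
  from test functions to their almost everywhere limits.\<close>

lemma weighted_Lp_Fatou:
  fixes h :: "nat \<Rightarrow> 'a::euclidean_space \<Rightarrow> 'b::{real_normed_vector, second_countable_topology}"
  assumes "p > 1" and [measurable]: "\<And>j. h j \<in> borel_measurable borel"
    and lim: "AE x in lborel. (\<lambda>j. h j x) \<longlonglongrightarrow> g x"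
    and bound: "\<And>j. j \<ge> k \<Longrightarrow> weighted_Lp a p (h j) \<le> c"
  shows "weighted_Lp a p g \<le> c"
proof -
  let ?T = "\<lambda>f x. ennreal ((norm x powr (- a) * norm (f x)) powr p)"
  have "weighted_Lp a p g = (\<integral>\<^sup>+x. liminf (\<lambda>j. ?T (h j) x) \<partial>lborel)"
    unfolding weighted_Lp_def
  proof (rule nn_integral_cong_AE)
    show "AE x in lborel. ?T g x = liminf (\<lambda>j. ?T (h j) x)"
      using lim
    proof eventually_elim
      case (elim x)
      have "(\<lambda>j. ?T (h j) x) \<longlonglongrightarrow> ?T g x"
        using elim assms(1) by (intro tendsto_ennrealI tendsto_powr' tendsto_intros) auto
      then show ?case using lim_imp_Liminf[OF sequentially_bot] by metis
    qed
  qed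
  also have "\<dots> \<le> liminf (\<lambda>j. weighted_Lp a p (h j))"
    unfolding weighted_Lp_def by (rule nn_integral_liminf) measurable
  also have "\<dots> \<le> c"
  proof (rule Liminf_le)
    show "\<forall>\<^sub>F j in sequentially. weighted_Lp a p (h j) \<le> c"
      using bound by (intro eventually_sequentiallyI[of k])
  qed simp
  finally show ?thesis .
qed

text \<open>On the ball the weight is bounded below because a >= 0. Young's inequality with A = 1
  and d = e bounds the weighted function by e + e^(1-p) y^p, whose integral over the ball is at most
  e times (volume + 1). Linearity in e transfers geometric decay from the weighted norm to the local
  L1 norm.\<close>

lemma weighted_Lp_imp_local_L1:
  fixes h :: "'a::euclidean_space \<Rightarrow> 'b::{real_normed_vector, second_countable_topology}"
  assumes "a \<ge> 0" "p > 1" "R > 0" "e > 0" and [measurable]: "h \<in> borel_measurable borel"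
    and le: "weighted_Lp a p h \<le> ennreal (e powr p)"
  shows "(\<integral>\<^sup>+x. ennreal (norm (h x)) * indicator (cball 0 R) x \<partial>lborel)
    \<le> ennreal (R powr a * (measure lborel (cball (0::'a) R) + 1) * e)"
proof -
  let ?B = "indicator (cball (0::'a) R) :: 'a \<Rightarrow> ennreal"
  let ?V = "measure lborel (cball (0::'a) R)"
  let ?y = "\<lambda>x. norm x powr (- a) * norm (h x)"
  have [measurable]: "cball (0::'a) R \<in> sets borel" by simp
  have "AE x in lborel. ennreal (norm (h x)) * ?B x
      \<le> ennreal (R powr a) * (ennreal e * ?B x + ennreal (e powr (1 - p)) * ennreal (?y x powr p))"
    using AE_lborel_nonzero
  proof eventually_elim
    case (elim x)
    show ?case
    proof (cases "norm x \<le> R")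
      case True
      have "norm (h x) = norm x powr a * ?y x"
        using elim by (simp add: powr_minus)
      also have "\<dots> \<le> R powr a * ?y x"
        using True assms by (intro mult_right_mono powr_mono2) auto
      also have "\<dots> \<le> R powr a * (e + e powr (1 - p) * ?y x powr p)"
        using weak_Young[of p 1 "?y x" e] assms by (intro mult_left_mono) auto
      finally have "norm (h x) \<le> R powr a * (e + e powr (1 - p) * ?y x powr p)" .
      then have "ennreal (norm (h x)) \<le> ennreal (R powr a * (e + e powr (1 - p) * ?y x powr p))"
        by (rule ennreal_leI)
      also have "\<dots> = ennreal (R powr a) * (ennreal e + ennreal (e powr (1 - p)) * ennreal (?y x powr p))"
        using assms by (simp add: ennreal_mult ennreal_plus)
      finally show ?thesis using True by simp
    qed simp
  qed
  then have "(\<integral>\<^sup>+x. ennreal (norm (h x)) * ?B x \<partial>lborel)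
      \<le> (\<integral>\<^sup>+x. ennreal (R powr a) * (ennreal e * ?B x + ennreal (e powr (1 - p)) * ennreal (?y x powr p)) \<partial>lborel)"
    by (rule nn_integral_mono_AE)
  also have "\<dots> = ennreal (R powr a) *
      (\<integral>\<^sup>+x. ennreal e * ?B x + ennreal (e powr (1 - p)) * ennreal (?y x powr p) \<partial>lborel)"
    by (rule nn_integral_cmult) measurable
  also have "(\<integral>\<^sup>+x. ennreal e * ?B x + ennreal (e powr (1 - p)) * ennreal (?y x powr p) \<partial>lborel)
      = (\<integral>\<^sup>+x. ennreal e * ?B x \<partial>lborel) + (\<integral>\<^sup>+x. ennreal (e powr (1 - p)) * ennreal (?y x powr p) \<partial>lborel)"
    by (rule nn_integral_add) measurable
  also have "(\<integral>\<^sup>+x. ennreal e * ?B x \<partial>lborel) = ennreal e * emeasure lborel (cball (0::'a) R)"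
    by (rule nn_integral_cmult_indicator) simp
  also have "(\<integral>\<^sup>+x. ennreal (e powr (1 - p)) * ennreal (?y x powr p) \<partial>lborel)
      = ennreal (e powr (1 - p)) * weighted_Lp a p h"
    unfolding weighted_Lp_def by (rule nn_integral_cmult) measurable
  also have "ennreal (R powr a) * (ennreal e * emeasure lborel (cball (0::'a) R) + ennreal (e powr (1 - p)) * weighted_Lp a p h)
      \<le> ennreal (R powr a) * (ennreal e * emeasure lborel (cball (0::'a) R) + ennreal (e powr (1 - p)) * ennreal (e powr p))"
    by (intro mult_left_mono add_left_mono le) auto
  also have "emeasure lborel (cball (0::'a) R) = ennreal ?V"
    using emeasure_lborel_cball_finite[of "0::'a" R] by (intro emeasure_eq_ennreal_measure) auto
  also have "ennreal (R powr a) * (ennreal e * ennreal ?V + ennreal (e powr (1 - p)) * ennreal (e powr p))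
      = ennreal (R powr a * (e * ?V + e powr (1 - p) * e powr p))"
    using assms by (simp add: ennreal_mult ennreal_plus)
  also have "R powr a * (e * ?V + e powr (1 - p) * e powr p) = R powr a * (?V + 1) * e"
    using assms by (simp add: algebra_simps flip: powr_add)
  finally show ?thesis .
qed

lemma weighted_Lp_imp_loc_integrable:
  fixes h :: "'a::euclidean_space \<Rightarrow> 'b::{banach, second_countable_topology}"
  assumes "a \<ge> 0" "p > 1" "e > 0" and [measurable]: "h \<in> borel_measurable borel"
    and le: "weighted_Lp a p h \<le> ennreal (e powr p)"
  shows "loc_integrable h"
proof (rule loc_integrableI)
  fix R :: real assume "R > 0"
  have [measurable]: "cball (0::'a) R \<in> sets borel" by simp
  have "(\<integral>\<^sup>+x. ennreal (norm (indicat_real (cball 0 R) x *\<^sub>R h x)) \<partial>lborel)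
      = (\<integral>\<^sup>+x. ennreal (norm (h x)) * indicator (cball 0 R) x \<partial>lborel)"
    by (intro nn_integral_cong) (auto simp: indicator_def)
  also have "\<dots> < \<infinity>"
    using weighted_Lp_imp_local_L1[OF assms(1,2) \<open>R > 0\<close> assms(3-5)] by (rule le_less_trans) simp
  finally show "integrable lborel (\<lambda>x. indicat_real (cball 0 R) x *\<^sub>R h x)"
    by (intro integrableI_bounded) auto
qed

text \<open>Passes to the limit in the definition of a weak gradient. The differences are supported
  in a ball, where the previous estimates give L1 convergence. It is applied to functions with
  weight a + 1 and to gradients with weight a.\<close>

lemma tendsto_integral_of_local_L1:
  fixes F :: "nat \<Rightarrow> 'a::euclidean_space \<Rightarrow> 'b::{banach, second_countable_topology}"
    and h :: "nat \<Rightarrow> 'a \<Rightarrow> 'c::{real_normed_vector, second_countable_topology}"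
  assumes "a \<ge> 0" "p > 1" "R > 0" "c > 0" and [measurable]: "\<And>k. h k \<in> borel_measurable borel"
    and F: "\<And>k. integrable lborel (F k)" "integrable lborel G"
    and h: "\<And>k. weighted_Lp a p (h k) \<le> ennreal ((c * (1 / 4) ^ k) powr p)"
    and le: "\<And>k x. norm (F k x - G x) \<le> B * norm (h k x)"
    and supp: "\<And>k x. norm x > R \<Longrightarrow> F k x = G x"
  shows "(\<lambda>k. LINT x|lborel. F k x) \<longlonglongrightarrow> (LINT x|lborel. G x)"
proof (rule tendsto_L1_int)
  let ?c = "\<bar>B\<bar> * (R powr a * (measure lborel (cball (0::'a) R) + 1) * c)"
  have [measurable]: "cball (0::'a) R \<in> sets borel" by simp
  have bound: "(\<integral>\<^sup>+x. norm (F k x - G x) \<partial>lborel) \<le> ennreal (?c * (1 / 4) ^ k)" for k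
  proof -
    have "(\<integral>\<^sup>+x. norm (F k x - G x) \<partial>lborel)
        \<le> (\<integral>\<^sup>+x. ennreal \<bar>B\<bar> * (ennreal (norm (h k x)) * indicator (cball 0 R) x) \<partial>lborel)"
    proof (intro nn_integral_mono)
      fix x
      have "B * norm (h k x) \<le> \<bar>B\<bar> * norm (h k x)" by (simp add: mult_right_mono)
      then have "norm (F k x - G x) \<le> \<bar>B\<bar> * norm (h k x)" using le[of k x] by linarith
      then show "ennreal (norm (F k x - G x)) \<le> ennreal \<bar>B\<bar> * (ennreal (norm (h k x)) * indicator (cball 0 R) x)"
        using supp[of x k] by (cases "norm x > R") (auto simp: ennreal_mult[symmetric] ennreal_leI)
    qed
    also have "\<dots> = ennreal \<bar>B\<bar> * (\<integral>\<^sup>+x. ennreal (norm (h k x)) * indicator (cball 0 R) x \<partial>lborel)"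
      by (rule nn_integral_cmult) measurable
    also have "\<dots> \<le> ennreal \<bar>B\<bar> * ennreal (R powr a * (measure lborel (cball (0::'a) R) + 1) * (c * (1 / 4) ^ k))"
      by (intro mult_left_mono weighted_Lp_imp_local_L1 assms h) (use assms in auto)
    also have "\<dots> = ennreal (?c * (1 / 4) ^ k)"
      by (simp add: ennreal_mult'[symmetric] mult_ac)
    finally show ?thesis .
  qed
  have "(\<lambda>k. ennreal (?c * (1 / 4) ^ k)) \<longlonglongrightarrow> ennreal (?c * 0)"
    by (intro tendsto_ennrealI tendsto_intros LIMSEQ_power_zero) simp
  then have "(\<lambda>k. ennreal (?c * (1 / 4) ^ k)) \<longlonglongrightarrow> 0" by simp
  then show "(\<lambda>k. \<integral>\<^sup>+x. norm (F k x - G x) \<partial>lborel) \<longlonglongrightarrow> 0"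
    by (rule tendsto_sandwich[OF _ _ tendsto_const, rotated 2]) (use bound in auto)
qed (use F in auto)

subsection \<open>Completeness and the Sobolev space\<close>

text \<open>The Riesz-Fischer argument: the fast Cauchy rate makes the increments summable almost
  everywhere, and Fatou's lemma carries the Cauchy estimate over to the limit.\<close>

lemma weighted_Lp_complete:
  fixes V :: "nat \<Rightarrow> 'a::euclidean_space \<Rightarrow> 'b::{banach, second_countable_topology}"
  assumes "p > 1" and [measurable]: "\<And>k. V k \<in> borel_measurable borel"
    and cauchy: "\<And>k j. k \<le> j \<Longrightarrow> weighted_Lp a p (\<lambda>x. V k x - V j x) \<le> ennreal (((1 / 4) ^ k) powr p)"
  obtains G where "G \<in> borel_measurable borel"
    "\<And>k. weighted_Lp a p (\<lambda>x. V k x - G x) \<le> ennreal (((1 / 4) ^ k) powr p)"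
proof -
  let ?y = "\<lambda>k x. norm x powr (- a) * norm (V k x - V (Suc k) x)"
  \<comment> \<open>The factor 2^k splits the rate 4^(-k): the integrals of these terms are still
    summable, while finiteness of their sum at a point bounds the k-th increment there by a multiple
    of 2^(-k).\<close>
  let ?T = "\<lambda>k x. ennreal ((2 ^ k) powr p) * ennreal (?y k x powr p)"
  have T: "(\<integral>\<^sup>+x. ?T k x \<partial>lborel) \<le> ennreal ((2 powr (- p)) ^ k)" for k
  proof -
    have "(\<integral>\<^sup>+x. ?T k x \<partial>lborel) = ennreal ((2 ^ k) powr p) * weighted_Lp a p (\<lambda>x. V k x - V (Suc k) x)"
      unfolding weighted_Lp_def by (rule nn_integral_cmult) measurable
    also have "\<dots> \<le> ennreal ((2 ^ k) powr p) * ennreal (((1 / 4) ^ k) powr p)"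
      by (intro mult_left_mono cauchy) auto
    also have "\<dots> = ennreal ((2 ^ k * (1 / 4) ^ k) powr p)"
      by (simp add: ennreal_mult powr_mult)
    also have "(2 ^ k * (1 / 4) ^ k :: real) = 2 powr (- real k)"
      by (simp add: powr_minus powr_realpow power_divide field_simps flip: power_mult_distrib)
    also have "(2 powr (- real k)) powr p = (2 powr (- p)) ^ k"
      by (simp add: powr_powr powr_realpow[symmetric] mult.commute)
    finally show ?thesis .
  qed
  have "(\<integral>\<^sup>+x. (\<Sum>k. ?T k x) \<partial>lborel) = (\<Sum>k. \<integral>\<^sup>+x. ?T k x \<partial>lborel)"
    by (rule nn_integral_suminf) measurable
  also have "\<dots> \<le> (\<Sum>k. ennreal ((2 powr (- p)) ^ k))"
    by (intro suminf_le T) auto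
  also have "\<dots> < \<infinity>"
  proof -
    have "summable (\<lambda>k. (2 powr (- p)) ^ k :: real)"
      using assms(1) by (intro summable_geometric) (simp add: powr_less_one)
    then show ?thesis by (simp add: suminf_ennreal2 less_top[symmetric])
  qed
  finally have "AE x in lborel. (\<Sum>k. ?T k x) \<noteq> \<infinity>"
    by (intro nn_integral_noteq_infinite) auto
  with AE_lborel_nonzero have conv: "AE x in lborel. convergent (\<lambda>k. V k x)"
  proof eventually_elim
    case (elim x)
    obtain S where S: "S \<ge> 0" "(\<Sum>k. ?T k x) = ennreal S"
      using elim(2) by (cases "\<Sum>k. ?T k x") auto
    define C where "C = S powr (1 / p) / norm x powr (- a)"
    have "norm (V (Suc k) x - V k x) \<le> C * (1 / 2) ^ k" for k
    proof -
      have "?T k x \<le> ennreal S"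
        using sum_le_suminf[of "\<lambda>k. ?T k x" "{k}"] S(2) by simp
      then have "ennreal ((2 ^ k * ?y k x) powr p) \<le> ennreal S"
        by (simp add: ennreal_mult'[symmetric] powr_mult)
      then have "(2 ^ k * ?y k x) powr p \<le> S" using S(1) by simp
      then have "((2 ^ k * ?y k x) powr p) powr (1 / p) \<le> S powr (1 / p)"
        using assms(1) by (intro powr_mono2) auto
      then have "2 ^ k * ?y k x \<le> S powr (1 / p)" using assms(1) by (simp add: powr_powr)
      then have "norm (V k x - V (Suc k) x) \<le> C * (1 / 2) ^ k"
        using elim(1) by (simp add: C_def field_simps)
      then show ?thesis by (simp add: norm_minus_commute)
    qed
    then have "summable (\<lambda>k. V (Suc k) x - V k x)"
      by (rule summable_comparison_test'[of "\<lambda>k. C * (1 / 2) ^ k" 0, rotated])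
        (intro summable_mult summable_geometric, simp)
    then have "convergent (\<lambda>n. \<Sum>k<n. V (Suc k) x - V k x)"
      by (simp add: summable_iff_convergent)
    then have "convergent (\<lambda>n. V n x - V 0 x)"
      using sum_lessThan_telescope[of "\<lambda>k. V k x"] by simp
    then show ?case
      using convergent_diff_const_right_iff by blast
  qed
  define G where "G = (\<lambda>x. lim (\<lambda>k. V k x))"
  have [measurable]: "G \<in> borel_measurable borel" unfolding G_def by measurable
  have lim: "AE x in lborel. (\<lambda>k. V k x) \<longlonglongrightarrow> G x"
    using conv by eventually_elim (simp add: G_def convergent_LIMSEQ_iff)
  show ?thesis
  proof (rule that[of G])
    fix k
    show "weighted_Lp a p (\<lambda>x. V k x - G x) \<le> ennreal (((1 / 4) ^ k) powr p)"
    proof (rule weighted_Lp_Fatou[OF assms(1), of "\<lambda>j x. V k x - V j x" _ k])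
      show "AE x in lborel. (\<lambda>j. V k x - V j x) \<longlonglongrightarrow> V k x - G x"
        using lim by eventually_elim (intro tendsto_intros)
    qed (use cauchy in auto)
  qed measurable
qed

text \<open>The gradients of a fast subsequence have a limit G in the weighted norm. Hardy's
  inequality upgrades the almost everywhere convergence of the functions to local L1 convergence, so
  integration by parts passes to the limit and G is a weak gradient of u; uniqueness identifies it
  with the given \<open>U\<close>.\<close>

lemma D1p_approximation:
  fixes u :: "'a::euclidean_space \<Rightarrow> real"
  assumes "0 \<le> a" "p > 1" "a < (real DIM('a) - p) / p" "u \<in> D1p a p" "weak_gradient u U"
  obtains \<phi> where "\<And>k. \<phi> k \<in> test_functions" "AE x in lborel. (\<lambda>k::nat. \<phi> k x) \<longlonglongrightarrow> u x"
    "\<And>k. weighted_Lp a p (\<lambda>x. gradient (\<phi> k) x - U x) \<le> ennreal (((1 / 4) ^ k) powr p)"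
proof -
  have ap: "a * p < real DIM('a)" using assms(2,3) by (simp add: field_simps)
  obtain K where K: "K > 0" "\<And>\<phi> :: 'a \<Rightarrow> real. \<phi> \<in> test_functions \<Longrightarrow>
      weighted_Lp (a + 1) p \<phi> \<le> ennreal K * weighted_Lp a p (gradient \<phi>)"
    using Hardy_inequality[OF assms(2,3)] by metis
  obtain \<phi> where \<phi>: "\<And>k. \<phi> k \<in> test_functions"
      "\<And>e. e > 0 \<Longrightarrow> \<exists>N. \<forall>j\<ge>N. \<forall>k\<ge>N. D_norm a p (\<lambda>x. \<phi> j x - \<phi> k x) < e"
      "AE x in lborel. (\<lambda>k::nat. \<phi> k x) \<longlonglongrightarrow> u x" and [measurable]: "u \<in> borel_measurable borel"
    using assms(4) by (auto simp: D1p_def)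
  have "\<exists>N. \<forall>k. \<forall>i\<ge>N k. \<forall>j\<ge>N k. D_norm a p (\<lambda>x. \<phi> i x - \<phi> j x) < (1 / 4) ^ k"
    by (intro choice allI \<phi>(2)) simp
  then obtain N where N: "\<And>k i j. i \<ge> N k \<Longrightarrow> j \<ge> N k \<Longrightarrow> D_norm a p (\<lambda>x. \<phi> i x - \<phi> j x) < (1 / 4) ^ k"
    by metis
  \<comment> \<open>The sum exceeds every threshold N i with i <= k, so r j >= N k for all j >= k;
    the summand k makes r tend to infinity.\<close>
  define r where "r k = k + (\<Sum>i\<le>k. N i)" for k
  define \<psi> where "\<psi> k = \<phi> (r k)" for k
  have r: "r j \<ge> N k" if "k \<le> j" for j k
    unfolding r_def using that by (intro trans_le_add2 member_le_sum) auto
  have \<psi>: "\<psi> k \<in> test_functions" for k by (simp add: \<psi>_def \<phi>(1))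
  have \<psi>_meas [measurable]: "\<psi> k \<in> borel_measurable borel" "gradient (\<psi> k) \<in> borel_measurable borel" for k
    using \<psi> by (auto intro: test_function_measurable)
  have cauchy: "weighted_Lp a p (\<lambda>x. gradient (\<psi> k) x - gradient (\<psi> j) x) \<le> ennreal (((1 / 4) ^ k) powr p)"
    if "k \<le> j" for k j
  proof -
    have "D_norm a p (\<lambda>x. \<psi> k x - \<psi> j x) < (1 / 4) ^ k"
      unfolding \<psi>_def using r that by (intro N) auto
    from weighted_Lp_less_D_norm[OF assms(1,2) ap test_function_diff[OF \<psi> \<psi>] this]
    show ?thesis by (simp add: gradient_diff[OF \<psi> \<psi>] weighted_Lp_def)
  qed
  have r_top: "filterlim r at_top sequentially"
    by (rule filterlim_at_top_mono[OF filterlim_ident]) (simp add: r_def)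
  have \<psi>u: "AE x in lborel. (\<lambda>k. \<psi> k x) \<longlonglongrightarrow> u x"
    using \<phi>(3)
  proof eventually_elim
    case (elim x)
    show ?case unfolding \<psi>_def using filterlim_compose[OF elim r_top] .
  qed
  obtain G where G [measurable]: "G \<in> borel_measurable borel"
    and lim: "\<And>k. weighted_Lp a p (\<lambda>x. gradient (\<psi> k) x - G x) \<le> ennreal (((1 / 4) ^ k) powr p)"
    using weighted_Lp_complete[OF assms(2) \<psi>_meas(2) cauchy] by blast
  \<comment> \<open>The p-th root of Hardy's constant, so that the estimate keeps the shape (c
    (1/4)^k)^p.\<close>
  define c where "c = K powr (1 / p)"
  have c: "c > 0" "c powr p = K" using K assms(2) by (auto simp: c_def powr_powr)
  have Hardy: "weighted_Lp (a + 1) p (\<lambda>x. \<psi> k x - u x) \<le> ennreal ((c * (1 / 4) ^ k) powr p)" for k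
  proof (rule weighted_Lp_Fatou[OF assms(2), of "\<lambda>j x. \<psi> k x - \<psi> j x" _ k])
    show "AE x in lborel. (\<lambda>j. \<psi> k x - \<psi> j x) \<longlonglongrightarrow> \<psi> k x - u x"
      using \<psi>u by eventually_elim (intro tendsto_intros)
    fix j assume "j \<ge> k"
    have "weighted_Lp (a + 1) p (\<lambda>x. \<psi> k x - \<psi> j x)
        \<le> ennreal K * weighted_Lp a p (gradient (\<lambda>x. \<psi> k x - \<psi> j x))"
      by (intro K test_function_diff \<psi>)
    also have "gradient (\<lambda>x. \<psi> k x - \<psi> j x) = (\<lambda>x. gradient (\<psi> k) x - gradient (\<psi> j) x)"
      by (intro ext gradient_diff \<psi>)
    also have "ennreal K * weighted_Lp a p \<dots> \<le> ennreal K * ennreal (((1 / 4) ^ k) powr p)"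
      by (intro mult_left_mono cauchy \<open>j \<ge> k\<close>) simp
    also have "\<dots> = ennreal ((c * (1 / 4) ^ k) powr p)"
      using c K by (simp add: powr_mult ennreal_mult)
    finally show "weighted_Lp (a + 1) p (\<lambda>x. \<psi> k x - \<psi> j x) \<le> ennreal ((c * (1 / 4) ^ k) powr p)" .
  qed measurable
  have locu: "loc_integrable u" using assms(5) by (simp add: weak_gradient_def)
  have loc\<psi>: "loc_integrable (gradient (\<psi> k))" for k
    by (intro loc_integrable_continuous test_function_continuous_gradient \<psi>)
  have "loc_integrable (\<lambda>x. gradient (\<psi> 0) x - G x)"
    using lim[of 0] assms by (intro weighted_Lp_imp_loc_integrable[of a p 1]) auto
  from loc_integrable_diff[OF loc\<psi>[of 0] this] have locG: "loc_integrable G" by simp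
  have "weak_gradient u G"
    unfolding weak_gradient_def
  proof (intro conjI ballI locu locG)
    fix \<xi> :: "'a \<Rightarrow> real" assume \<xi>: "\<xi> \<in> test_functions"
    obtain B R where BR: "R > 0" "\<And>x. \<bar>\<xi> x\<bar> \<le> B" "\<And>x. norm (gradient \<xi> x) \<le> B"
      "\<And>x. \<xi> x \<noteq> 0 \<Longrightarrow> norm x \<le> R" "\<And>x. gradient \<xi> x \<noteq> 0 \<Longrightarrow> norm x \<le> R"
      using test_function_bounds[OF \<xi>] by metis
    have [measurable]: "\<xi> \<in> borel_measurable borel" "gradient \<xi> \<in> borel_measurable borel"
      using \<xi> by (auto intro: test_function_measurable)
    have "(\<lambda>k. LINT x|lborel. \<psi> k x *\<^sub>R gradient \<xi> x) \<longlonglongrightarrow> (LINT x|lborel. u x *\<^sub>R gradient \<xi> x)"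
    proof (rule tendsto_integral_of_local_L1[where h = "\<lambda>k x. \<psi> k x - u x" and a = "a + 1" and B = B and R = R and c = c and p = p])
      show "integrable lborel (\<lambda>x. \<psi> k x *\<^sub>R gradient \<xi> x)" for k
        by (intro integrable_test_scaleR \<psi> loc_integrable_continuous test_function_continuous_gradient \<xi>)
      show "integrable lborel (\<lambda>x. u x *\<^sub>R gradient \<xi> x)"
      proof (rule loc_integrable_imp_integrable[OF locu, of _ B R])
        show "AE x in lborel. norm (u x *\<^sub>R gradient \<xi> x) \<le> B * norm (u x)"
        proof (rule AE_I2)
          fix x show "norm (u x *\<^sub>R gradient \<xi> x) \<le> B * norm (u x)"
            using mult_right_mono[OF BR(3)[of x], of "\<bar>u x\<bar>"] by (simp add: mult.commute)
        qed
        show "u x *\<^sub>R gradient \<xi> x = 0" if "norm x > R" for x using BR(5)[of x] that by fastforce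
      qed measurable
      show "norm (\<psi> k x *\<^sub>R gradient \<xi> x - u x *\<^sub>R gradient \<xi> x) \<le> B * norm (\<psi> k x - u x)" for k x
        using mult_right_mono[OF BR(3)[of x], of "\<bar>\<psi> k x - u x\<bar>"]
        by (simp add: mult.commute flip: scaleR_left_diff_distrib)
      show "\<psi> k x *\<^sub>R gradient \<xi> x = u x *\<^sub>R gradient \<xi> x" if "norm x > R" for k x
        using BR(5)[of x] that by fastforce
    qed (use assms BR c Hardy in auto)
    moreover have "(\<lambda>k. LINT x|lborel. \<xi> x *\<^sub>R gradient (\<psi> k) x) \<longlonglongrightarrow> (LINT x|lborel. \<xi> x *\<^sub>R G x)"
    proof (rule tendsto_integral_of_local_L1[where h = "\<lambda>k x. gradient (\<psi> k) x - G x" and a = a and B = B and R = R and c = 1 and p = p])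
      show "integrable lborel (\<lambda>x. \<xi> x *\<^sub>R gradient (\<psi> k) x)" for k
        by (intro integrable_test_scaleR \<xi> loc\<psi>)
      show "integrable lborel (\<lambda>x. \<xi> x *\<^sub>R G x)"
        by (intro integrable_test_scaleR \<xi> locG)
      show "norm (\<xi> x *\<^sub>R gradient (\<psi> k) x - \<xi> x *\<^sub>R G x) \<le> B * norm (gradient (\<psi> k) x - G x)" for k x
        using mult_right_mono[OF BR(2)[of x], of "norm (gradient (\<psi> k) x - G x)"]
        by (simp flip: scaleR_right_diff_distrib)
      show "\<xi> x *\<^sub>R gradient (\<psi> k) x = \<xi> x *\<^sub>R G x" if "norm x > R" for k x
        using BR(4)[of x] that by fastforce
    qed (use assms BR lim in auto)
    moreover have "(LINT x|lborel. \<psi> k x *\<^sub>R gradient \<xi> x) = - (LINT x|lborel. \<xi> x *\<^sub>R gradient (\<psi> k) x)" for k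
      by (rule integration_by_parts[OF \<psi> \<xi>])
    ultimately show "(LINT x|lborel. u x *\<^sub>R gradient \<xi> x) = - (LINT x|lborel. \<xi> x *\<^sub>R G x)"
      using LIMSEQ_unique[OF _ tendsto_minus] by simp
  qed
  then have GU: "AE x in lborel. G x = U x" using assms(5) by (rule weak_gradient_unique)
  show ?thesis
  proof (rule that[OF \<psi> \<psi>u])
    fix k
    have "weighted_Lp a p (\<lambda>x. gradient (\<psi> k) x - U x) = weighted_Lp a p (\<lambda>x. gradient (\<psi> k) x - G x)"
      unfolding weighted_Lp_def using GU by (intro nn_integral_cong_AE) auto
    then show "weighted_Lp a p (\<lambda>x. gradient (\<psi> k) x - U x) \<le> ennreal (((1 / 4) ^ k) powr p)"
      using lim by simp
  qed
qed

subsection \<open>The comparison argument\<close>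

text \<open>By Cauchy-Schwarz the pairing is at least (s^(p-1) - t^(p-1)) (s - t), where s and t are
  the two norms, and r^(p-1) is increasing. If the pairing vanishes then s = t, and it becomes
  s^(p-2) times the squared distance; for s = 0 both vectors are zero anyway.\<close>

lemma p_Laplace_monotone:
  fixes \<xi> \<eta> :: "'a::real_inner"
  assumes "p > 1"
  shows "0 \<le> (norm \<xi> powr (p - 2) *\<^sub>R \<xi> - norm \<eta> powr (p - 2) *\<^sub>R \<eta>) \<bullet> (\<xi> - \<eta>)" (is "0 \<le> ?L")
    and "(norm \<xi> powr (p - 2) *\<^sub>R \<xi> - norm \<eta> powr (p - 2) *\<^sub>R \<eta>) \<bullet> (\<xi> - \<eta>) = 0 \<Longrightarrow> \<xi> = \<eta>"
proof -
  define s t where "s = norm \<xi>" and "t = norm \<eta>"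
  have st: "s \<ge> 0" "t \<ge> 0" by (auto simp: s_def t_def)
  \<comment> \<open>At r = 0 both sides are 0 by \<open>0 powr\<close>, whatever the sign of p -
    2.\<close>
  have pw: "r powr (p - 2) * r = r powr (p - 1)" if "r \<ge> 0" for r
    using that by (cases "r = 0") (auto simp: powr_diff power2_eq_square field_simps)
  have L: "?L = s powr (p - 2) * (s * s) + t powr (p - 2) * (t * t) - (s powr (p - 2) + t powr (p - 2)) * (\<xi> \<bullet> \<eta>)"
    by (simp add: s_def t_def inner_diff_left inner_diff_right inner_commute[of \<eta> \<xi>] dot_square_norm
        power2_eq_square algebra_simps)
  have "(s powr (p - 2) + t powr (p - 2)) * (\<xi> \<bullet> \<eta>) \<le> (s powr (p - 2) + t powr (p - 2)) * (s * t)"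
    unfolding s_def t_def by (intro mult_left_mono norm_cauchy_schwarz) auto
  then have "?L \<ge> (s powr (p - 2) * s - t powr (p - 2) * t) * (s - t)"
    unfolding L by (simp add: algebra_simps)
  then have ge: "?L \<ge> (s powr (p - 1) - t powr (p - 1)) * (s - t)"
    using st by (simp add: pw)
  have mono: "(s powr (p - 1) - t powr (p - 1)) * (s - t) > 0" if "s \<noteq> t"
  proof (cases "s < t")
    case True
    then have "s powr (p - 1) < t powr (p - 1)" using st assms by (intro powr_less_mono2) auto
    then show ?thesis using True by (intro mult_neg_neg) auto
  next
    case False
    then have "t powr (p - 1) < s powr (p - 1)" using st assms that by (intro powr_less_mono2) auto
    then show ?thesis using False that by (intro mult_pos_pos) auto
  qed
  show "0 \<le> ?L" using ge mono by (cases "s = t") auto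
  assume 0: "?L = 0"
  have "s = t" using ge mono 0 by force
  then have "s powr (p - 2) * ((\<xi> - \<eta>) \<bullet> (\<xi> - \<eta>)) = 0"
    using 0 by (simp add: s_def t_def flip: scaleR_right_diff_distrib)
  then show "\<xi> = \<eta>" using \<open>s = t\<close> by (auto simp: s_def t_def)
qed

lemma flux_diff_inner:
  assumes "p > 1" "x \<noteq> 0"
  shows "0 \<le> (flux a p U x - flux a p V x) \<bullet> (U x - V x)"
    and "(flux a p U x - flux a p V x) \<bullet> (U x - V x) = 0 \<Longrightarrow> U x = V x"
proof -
  have "(flux a p U x - flux a p V x) \<bullet> (U x - V x) = norm x powr (- a * p) *
      ((norm (U x) powr (p - 2) *\<^sub>R U x - norm (V x) powr (p - 2) *\<^sub>R V x) \<bullet> (U x - V x))"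
    by (simp add: flux_def inner_diff_left algebra_simps)
  moreover have "norm x powr (- a * p) > 0" using assms by simp
  ultimately show "0 \<le> (flux a p U x - flux a p V x) \<bullet> (U x - V x)"
    and "(flux a p U x - flux a p V x) \<bullet> (U x - V x) = 0 \<Longrightarrow> U x = V x"
    using p_Laplace_monotone[OF assms(1), of "U x" "V x"] by auto
qed

lemma norm_flux:
  assumes "p > 1"
  shows "norm (flux a p U x) = norm x powr (- a * p) * norm (U x) powr (p - 1)"
  using assms by (cases "U x = 0") (auto simp: flux_def powr_diff power2_eq_square field_simps)

text \<open>Takes the place of Hoelder's inequality. Writing |x|^(-a p) as (|x|^(-a))^(p-1) |x|^(-a)
  brings the integrand to the form A^(p-1) y of \<open>weak_Young\<close>. With d = e the two terms
  contribute e I and at most e^(1-p) e^p = e; the factor 2 counts the two fluxes.\<close>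

lemma flux_diff_pairing:
  fixes U V :: "'a::euclidean_space \<Rightarrow> 'a" and Y :: "'a \<Rightarrow> 'b::{real_normed_vector, second_countable_topology}"
  assumes "p > 1" "e > 0" "I \<ge> 0"
    and [measurable]: "U \<in> borel_measurable borel" "V \<in> borel_measurable borel" "Y \<in> borel_measurable borel"
    and I: "weighted_Lp a p (\<lambda>x. norm (U x) + norm (V x)) = ennreal I"
    and Y: "weighted_Lp a p Y \<le> ennreal (e powr p)"
  shows "(\<integral>\<^sup>+x. ennreal (norm (flux a p U x - flux a p V x) * norm (Y x)) \<partial>lborel) \<le> ennreal (2 * (I + 1) * e)"
proof -
  let ?S = "\<lambda>x. norm (U x) + norm (V x)"
  let ?A = "\<lambda>x. norm x powr (- a) * norm (?S x)"
  let ?y = "\<lambda>x. norm x powr (- a) * norm (Y x)"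
  have pw: "norm (flux a p U x - flux a p V x) * norm (Y x) \<le> 2 * (e * ?A x powr p + e powr (1 - p) * ?y x powr p)" for x
  proof -
    have "norm (flux a p U x - flux a p V x) \<le> norm (flux a p U x) + norm (flux a p V x)"
      by (rule norm_triangle_ineq4)
    also have "\<dots> \<le> norm x powr (- a * p) * ?S x powr (p - 1) + norm x powr (- a * p) * ?S x powr (p - 1)"
      unfolding norm_flux[OF assms(1)] using assms(1) by (intro add_mono mult_left_mono powr_mono2) auto
    also have "norm x powr (- a * p) = (norm x powr (- a)) powr (p - 1) * norm x powr (- a)"
      by (simp add: powr_powr algebra_simps flip: powr_add)
    finally have "norm (flux a p U x - flux a p V x) \<le> 2 * (?A x powr (p - 1) * norm x powr (- a))"
      by (simp add: powr_mult mult_ac)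
    then have "norm (flux a p U x - flux a p V x) * norm (Y x) \<le> 2 * (?A x powr (p - 1) * norm x powr (- a)) * norm (Y x)"
      by (rule mult_right_mono) simp
    also have "\<dots> = 2 * (?A x powr (p - 1) * ?y x)" by simp
    also have "\<dots> \<le> 2 * (e * ?A x powr p + e powr (1 - p) * ?y x powr p)"
      using weak_Young[of p "?A x" "?y x" e] assms by (intro mult_left_mono) auto
    finally show ?thesis .
  qed
  have "(\<integral>\<^sup>+x. ennreal (norm (flux a p U x - flux a p V x) * norm (Y x)) \<partial>lborel)
      \<le> (\<integral>\<^sup>+x. ennreal (2 * e) * ennreal (?A x powr p) + ennreal (2 * e powr (1 - p)) * ennreal (?y x powr p) \<partial>lborel)"
  proof (intro nn_integral_mono)
    fix x
    have "ennreal (norm (flux a p U x - flux a p V x) * norm (Y x))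
        \<le> ennreal (2 * e * ?A x powr p + 2 * e powr (1 - p) * ?y x powr p)"
      using pw[of x] by (intro ennreal_leI) (simp add: algebra_simps)
    also have "\<dots> = ennreal (2 * e) * ennreal (?A x powr p) + ennreal (2 * e powr (1 - p)) * ennreal (?y x powr p)"
      using assms by (subst ennreal_plus) (auto simp: ennreal_mult'')
    finally show "ennreal (norm (flux a p U x - flux a p V x) * norm (Y x))
        \<le> ennreal (2 * e) * ennreal (?A x powr p) + ennreal (2 * e powr (1 - p)) * ennreal (?y x powr p)" .
  qed
  also have "\<dots> = (\<integral>\<^sup>+x. ennreal (2 * e) * ennreal (?A x powr p) \<partial>lborel)
      + (\<integral>\<^sup>+x. ennreal (2 * e powr (1 - p)) * ennreal (?y x powr p) \<partial>lborel)"
    by (rule nn_integral_add) measurable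
  also have "(\<integral>\<^sup>+x. ennreal (2 * e) * ennreal (?A x powr p) \<partial>lborel) = ennreal (2 * e) * ennreal I"
    unfolding I[symmetric] weighted_Lp_def by (rule nn_integral_cmult) measurable
  also have "(\<integral>\<^sup>+x. ennreal (2 * e powr (1 - p)) * ennreal (?y x powr p) \<partial>lborel)
      = ennreal (2 * e powr (1 - p)) * weighted_Lp a p Y"
    unfolding weighted_Lp_def by (rule nn_integral_cmult) measurable
  also have "ennreal (2 * e) * ennreal I + ennreal (2 * e powr (1 - p)) * weighted_Lp a p Y
      \<le> ennreal (2 * e) * ennreal I + ennreal (2 * e powr (1 - p)) * ennreal (e powr p)"
    by (intro add_left_mono mult_left_mono Y) simp
  also have "\<dots> = ennreal (2 * e * I + 2 * e powr (1 - p) * e powr p)"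
    using assms by (subst ennreal_plus) (auto simp: ennreal_mult'')
  also have "2 * e * I + 2 * e powr (1 - p) * e powr p = 2 * (I + 1) * e"
    using assms by (simp add: algebra_simps flip: powr_add)
  finally show ?thesis .
qed

section \<open>Truncation by arctan in the weak formulation\<close>

lemma abs_arctan_le: "\<bar>arctan x\<bar> \<le> \<bar>x\<bar>"
proof -
  have "norm (arctan x - arctan 0) \<le> 1 * norm (x - 0)"
  proof (rule field_differentiable_bound[of UNIV arctan "\<lambda>x. inverse (1 + x\<^sup>2)"])
    show "(arctan has_field_derivative inverse (1 + z\<^sup>2)) (at z within UNIV)" for z
      using DERIV_arctan[of z] by simp
    show "norm (inverse (1 + z\<^sup>2)) \<le> 1" for z :: real
      by (simp add: inverse_le_1_iff)
  qed auto
  then show ?thesis by simp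
qed

lemma abs_arctan_le_2: "\<bar>arctan x\<bar> \<le> 2"
  using arctan_bounded[of x] pi_less_4 by linarith

lemma one_plus_square_pos: "1 + (y::real)\<^sup>2 > 0"
  by (rule add_pos_nonneg) auto

lemma abs_divide_one_plus_square_le:
  fixes y z :: real
  assumes "\<bar>z\<bar> \<le> B"
  shows "\<bar>z / (1 + y\<^sup>2)\<bar> \<le> B"
proof -
  have "\<bar>z / (1 + y\<^sup>2)\<bar> = \<bar>z\<bar> / (1 + y\<^sup>2)" by simp
  also have "\<dots> \<le> \<bar>z\<bar> / 1" by (intro divide_left_mono) (auto simp: one_plus_square_pos)
  finally show ?thesis using assms by simp
qed

lemma gradient_arctan_mult:
  assumes "\<rho> \<in> test_functions" "\<zeta> \<in> test_functions"
  shows "gradient (\<lambda>x. arctan (\<rho> x) * \<zeta> x) x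
    = arctan (\<rho> x) *\<^sub>R gradient \<zeta> x + (\<zeta> x / (1 + (\<rho> x)\<^sup>2)) *\<^sub>R gradient \<rho> x"
proof -
  have "GDERIV (\<lambda>x. arctan (\<rho> x)) x :> inverse (1 + (\<rho> x)\<^sup>2) *\<^sub>R gradient \<rho> x"
    by (rule GDERIV_DERIV_compose[OF test_function_GDERIV[OF assms(1)] DERIV_arctan])
  from gradient_eqI[OF GDERIV_mult[OF this test_function_GDERIV[OF assms(2)]]]
  show ?thesis by (simp add: divide_inverse)
qed

text \<open>
  The test function is \<open>arctan \<rho>\<^sub>k \<zeta>\<close>: since it stays bounded with fixed support, \<open>k\<close> can tend to
  infinity although \<open>H\<close> is only locally integrable and \<open>H w\<close> need not be integrable.
\<close>

lemma truncated_identity: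
  fixes F W :: "'a::euclidean_space \<Rightarrow> 'a" and H w :: "'a \<Rightarrow> real"
  assumes F: "loc_integrable F" and H: "loc_integrable H"
    and weak: "\<And>\<xi>. \<xi> \<in> test_functions \<Longrightarrow> (LINT x|lborel. F x \<bullet> gradient \<xi> x) = (LINT x|lborel. H x * \<xi> x)"
    and \<rho>: "\<And>k. \<rho> k \<in> test_functions" "AE x in lborel. (\<lambda>k::nat. \<rho> k x) \<longlonglongrightarrow> w x"
    and [measurable]: "w \<in> borel_measurable borel" "W \<in> borel_measurable borel"
    and FW: "integrable lborel (\<lambda>x. F x \<bullet> W x)" and "c \<ge> 0"
    and conv: "\<And>k. (\<integral>\<^sup>+x. ennreal (norm (F x) * norm (gradient (\<rho> k) x - W x)) \<partial>lborel) \<le> ennreal (c * (1 / 4) ^ k)"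
    and \<zeta>: "\<zeta> \<in> test_functions"
  shows "(LINT x|lborel. \<zeta> x / (1 + (w x)\<^sup>2) * (F x \<bullet> W x)) + (LINT x|lborel. arctan (w x) * (F x \<bullet> gradient \<zeta> x))
    = (LINT x|lborel. H x * (arctan (w x) * \<zeta> x))"
proof -
  have [measurable]: "F \<in> borel_measurable borel" "H \<in> borel_measurable borel"
    using F H by (auto intro: loc_integrable_measurable)
  have [measurable]: "\<rho> k \<in> borel_measurable borel" "gradient (\<rho> k) \<in> borel_measurable borel" for k
    using \<rho>(1) by (auto intro: test_function_measurable)
  have [measurable]: "\<zeta> \<in> borel_measurable borel" "gradient \<zeta> \<in> borel_measurable borel"
    using \<zeta> by (auto intro: test_function_measurable)
  have arctan_measurable [measurable]: "arctan \<in> borel_measurable borel"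
    by (intro borel_measurable_continuous_onI continuous_intros)
  obtain B where B: "B > 0" "\<And>x. \<bar>\<zeta> x\<bar> \<le> B"
    using test_function_bounds[OF \<zeta>] by metis
  have \<zeta>_le: "\<bar>\<zeta> x / (1 + y\<^sup>2)\<bar> \<le> B" for x y
    using B(2) by (rule abs_divide_one_plus_square_le)
  \<comment> \<open>The tested left-hand side splits into three terms: \<open>a1\<close> has the
    derivative on the cutoff, \<open>b1\<close> carries the limit gradient W, and \<open>c1\<close>
    is the error of replacing the gradient of \<rho> k by W. The first two converge by domination,
    the third tends to 0 in L1 by \<open>conv\<close>.\<close>
  define a1 where "a1 k x = arctan (\<rho> k x) * (F x \<bullet> gradient \<zeta> x)" for k x
  define b1 where "b1 k x = \<zeta> x / (1 + (\<rho> k x)\<^sup>2) * (F x \<bullet> W x)" for k x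
  define c1 where "c1 k x = \<zeta> x / (1 + (\<rho> k x)\<^sup>2) * (F x \<bullet> (gradient (\<rho> k) x - W x))" for k x
  have [measurable]: "a1 k \<in> borel_measurable borel" "b1 k \<in> borel_measurable borel" "c1 k \<in> borel_measurable borel" for k
    unfolding a1_def b1_def c1_def by measurable
  have G\<zeta>: "integrable lborel (\<lambda>x. 2 * \<bar>F x \<bullet> gradient \<zeta> x\<bar>)"
    using integrable_gradient_inner[OF \<zeta> F] by simp
  have BFW: "integrable lborel (\<lambda>x. B * \<bar>F x \<bullet> W x\<bar>)" using FW by simp
  have a_le: "norm (a1 k x) \<le> 2 * \<bar>F x \<bullet> gradient \<zeta> x\<bar>" for k x
    unfolding a1_def by (auto simp: abs_mult intro!: mult_right_mono abs_arctan_le_2)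
  have b_le: "norm (b1 k x) \<le> B * \<bar>F x \<bullet> W x\<bar>" for k x
    unfolding b1_def using \<zeta>_le[of x "\<rho> k x"] by (simp only: real_norm_def abs_mult) (intro mult_right_mono, auto)
  have a_int: "integrable lborel (a1 k)" for k
    by (rule Bochner_Integration.integrable_bound[OF G\<zeta>]) (use a_le in auto)
  have b_int: "integrable lborel (b1 k)" for k
    by (rule Bochner_Integration.integrable_bound[OF BFW]) (use b_le B in \<open>auto simp: abs_mult\<close>)
  have a_lim: "(\<lambda>k. LINT x|lborel. a1 k x) \<longlonglongrightarrow> (LINT x|lborel. arctan (w x) * (F x \<bullet> gradient \<zeta> x))"
  proof (rule integral_dominated_convergence[OF _ _ G\<zeta>])
    show "AE x in lborel. (\<lambda>k. a1 k x) \<longlonglongrightarrow> arctan (w x) * (F x \<bullet> gradient \<zeta> x)"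
      using \<rho>(2) unfolding a1_def by eventually_elim (intro tendsto_intros)
  qed (use a_le in auto)
  have b_lim: "(\<lambda>k. LINT x|lborel. b1 k x) \<longlonglongrightarrow> (LINT x|lborel. \<zeta> x / (1 + (w x)\<^sup>2) * (F x \<bullet> W x))"
  proof (rule integral_dominated_convergence[OF _ _ BFW])
    show "AE x in lborel. (\<lambda>k. b1 k x) \<longlonglongrightarrow> \<zeta> x / (1 + (w x)\<^sup>2) * (F x \<bullet> W x)"
      using \<rho>(2) unfolding b1_def
    proof eventually_elim
      case (elim x)
      show ?case using one_plus_square_pos[of "w x"] by (intro tendsto_intros elim) simp
    qed
  qed (use b_le in auto)
  have c_bound: "(\<integral>\<^sup>+x. norm (c1 k x) \<partial>lborel) \<le> ennreal (B * c * (1 / 4) ^ k)" for k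
  proof -
    have "(\<integral>\<^sup>+x. norm (c1 k x) \<partial>lborel)
        \<le> (\<integral>\<^sup>+x. ennreal B * ennreal (norm (F x) * norm (gradient (\<rho> k) x - W x)) \<partial>lborel)"
    proof (intro nn_integral_mono)
      fix x
      have "norm (c1 k x) = \<bar>\<zeta> x / (1 + (\<rho> k x)\<^sup>2)\<bar> * \<bar>F x \<bullet> (gradient (\<rho> k) x - W x)\<bar>"
        unfolding c1_def by (simp only: real_norm_def abs_mult)
      also have "\<dots> \<le> B * (norm (F x) * norm (gradient (\<rho> k) x - W x))"
        using \<zeta>_le B by (intro mult_mono Cauchy_Schwarz_ineq2) auto
      finally show "ennreal (norm (c1 k x)) \<le> ennreal B * ennreal (norm (F x) * norm (gradient (\<rho> k) x - W x))"
        using B by (simp add: ennreal_mult[symmetric] ennreal_leI)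
    qed
    also have "\<dots> = ennreal B * (\<integral>\<^sup>+x. ennreal (norm (F x) * norm (gradient (\<rho> k) x - W x)) \<partial>lborel)"
      by (rule nn_integral_cmult) measurable
    also have "\<dots> \<le> ennreal B * ennreal (c * (1 / 4) ^ k)"
      by (intro mult_left_mono conv) simp
    also have "\<dots> = ennreal (B * c * (1 / 4) ^ k)"
      using B \<open>c \<ge> 0\<close> by (simp add: ennreal_mult[symmetric] mult.assoc)
    finally show ?thesis .
  qed
  have c_int: "integrable lborel (c1 k)" for k
    by (rule integrableI_bounded) (use c_bound[of k] in \<open>auto intro: le_less_trans\<close>)
  have c_lim: "(\<lambda>k. LINT x|lborel. c1 k x) \<longlonglongrightarrow> 0"
  proof (rule tendsto_rabs_zero_cancel, rule tendsto_sandwich[OF _ _ tendsto_const])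
    show "\<forall>\<^sub>F k in sequentially. \<bar>LINT x|lborel. c1 k x\<bar> \<le> B * c * (1 / 4) ^ k"
    proof (rule always_eventually, rule allI)
      fix k
      have "ennreal (norm (LINT x|lborel. c1 k x)) \<le> ennreal (B * c * (1 / 4) ^ k)"
        using integral_norm_bound_ennreal[OF c_int] c_bound by (rule order_trans)
      then show "\<bar>LINT x|lborel. c1 k x\<bar> \<le> B * c * (1 / 4) ^ k"
        using B \<open>c \<ge> 0\<close> by (subst (asm) ennreal_le_iff) auto
    qed
    have "(\<lambda>k. B * c * (1 / 4) ^ k) \<longlonglongrightarrow> B * c * 0"
      by (intro tendsto_intros LIMSEQ_power_zero) simp
    then show "(\<lambda>k. B * c * (1 / 4) ^ k) \<longlonglongrightarrow> 0" by simp
  qed simp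
  have H\<zeta>: "integrable lborel (\<lambda>x. 2 * \<bar>\<zeta> x * H x\<bar>)"
    using integrable_test_scaleR[OF \<zeta> H] by simp
  have H_lim: "(\<lambda>k. LINT x|lborel. H x * (arctan (\<rho> k x) * \<zeta> x)) \<longlonglongrightarrow> (LINT x|lborel. H x * (arctan (w x) * \<zeta> x))"
  proof (rule integral_dominated_convergence[OF _ _ H\<zeta>])
    show "AE x in lborel. (\<lambda>k. H x * (arctan (\<rho> k x) * \<zeta> x)) \<longlonglongrightarrow> H x * (arctan (w x) * \<zeta> x)"
      using \<rho>(2) by eventually_elim (intro tendsto_intros)
    show "AE x in lborel. norm (H x * (arctan (\<rho> k x) * \<zeta> x)) \<le> 2 * \<bar>\<zeta> x * H x\<bar>" for k
    proof (rule AE_I2)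
      fix x
      have "\<bar>arctan (\<rho> k x)\<bar> * \<bar>\<zeta> x * H x\<bar> \<le> 2 * \<bar>\<zeta> x * H x\<bar>"
        by (intro mult_right_mono abs_arctan_le_2) simp
      then show "norm (H x * (arctan (\<rho> k x) * \<zeta> x)) \<le> 2 * \<bar>\<zeta> x * H x\<bar>" by (simp add: abs_mult mult_ac)
    qed
  qed measurable
  have eq: "(LINT x|lborel. a1 k x) + (LINT x|lborel. b1 k x) + (LINT x|lborel. c1 k x)
      = (LINT x|lborel. H x * (arctan (\<rho> k x) * \<zeta> x))" for k
  proof -
    have "(\<lambda>x. arctan (\<rho> k x) * \<zeta> x) \<in> test_functions"
      by (intro test_function_mult_left Ck_arctan test_function_Ck[OF \<rho>(1)] \<zeta>)
    from weak[OF this] have "(LINT x|lborel. H x * (arctan (\<rho> k x) * \<zeta> x))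
        = (LINT x|lborel. F x \<bullet> gradient (\<lambda>x. arctan (\<rho> k x) * \<zeta> x) x)" by simp
    also have "\<dots> = (LINT x|lborel. a1 k x + b1 k x + c1 k x)"
      unfolding gradient_arctan_mult[OF \<rho>(1) \<zeta>] a1_def b1_def c1_def
      by (simp add: inner_add_right inner_diff_right algebra_simps)
    also have "\<dots> = (LINT x|lborel. a1 k x) + (LINT x|lborel. b1 k x) + (LINT x|lborel. c1 k x)"
      using a_int b_int c_int by simp
    finally show ?thesis by simp
  qed
  have "(\<lambda>k. (LINT x|lborel. a1 k x) + (LINT x|lborel. b1 k x) + (LINT x|lborel. c1 k x)) \<longlonglongrightarrow>
      (LINT x|lborel. arctan (w x) * (F x \<bullet> gradient \<zeta> x)) + (LINT x|lborel. \<zeta> x / (1 + (w x)\<^sup>2) * (F x \<bullet> W x)) + 0"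
    by (intro tendsto_add a_lim b_lim c_lim)
  from LIMSEQ_unique[OF this[unfolded eq] H_lim] show ?thesis by simp
qed

text \<open>
  Removing the cutoff \<open>\<zeta>\<close> by dilation costs a term of order \<open>|F| |w| / |x|\<close>, which Hardy's inequality
  makes integrable.
\<close>

lemma pairing_zero:
  fixes F W :: "'a::euclidean_space \<Rightarrow> 'a" and H w :: "'a \<Rightarrow> real"
  assumes F: "loc_integrable F" and H: "loc_integrable H"
    and weak: "\<And>\<xi>. \<xi> \<in> test_functions \<Longrightarrow> (LINT x|lborel. F x \<bullet> gradient \<xi> x) = (LINT x|lborel. H x * \<xi> x)"
    and \<rho>: "\<And>k. \<rho> k \<in> test_functions" "AE x in lborel. (\<lambda>k::nat. \<rho> k x) \<longlonglongrightarrow> w x"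
    and [measurable]: "w \<in> borel_measurable borel" "W \<in> borel_measurable borel"
    and FW: "integrable lborel (\<lambda>x. F x \<bullet> W x)" and "c \<ge> 0"
    and conv: "\<And>k. (\<integral>\<^sup>+x. ennreal (norm (F x) * norm (gradient (\<rho> k) x - W x)) \<partial>lborel) \<le> ennreal (c * (1 / 4) ^ k)"
    and Fw: "integrable lborel (\<lambda>x. norm (F x) * (\<bar>w x\<bar> / norm x))"
    and pos: "AE x in lborel. 0 \<le> F x \<bullet> W x" and neg: "AE x in lborel. H x * w x \<le> 0"
  shows "AE x in lborel. F x \<bullet> W x = 0"
proof -
  have [measurable]: "F \<in> borel_measurable borel" "H \<in> borel_measurable borel"
    using F H by (auto intro: loc_integrable_measurable)
  have arctan_measurable [measurable]: "arctan \<in> borel_measurable borel"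
    by (intro borel_measurable_continuous_onI continuous_intros)
  \<comment> \<open>Any nonnegative test function that is positive at 0 would serve: its dilations
    converge pointwise to the constant \<open>\<zeta> 0\<close>.\<close>
  define \<zeta> :: "'a \<Rightarrow> real" where "\<zeta> = box_bump (- One) One 0"
  have \<zeta>: "\<zeta> \<in> test_functions" unfolding \<zeta>_def by (rule box_bump_test_function)
  have \<zeta>_ge: "\<zeta> x \<ge> 0" for x unfolding \<zeta>_def by (rule box_bump_bounds)
  have \<zeta>0: "\<zeta> 0 > 0"
    unfolding \<zeta>_def box_bump_def by (intro prod_pos ballI) (simp add: exp_bump_def)
  obtain B R where B: "B > 0" "R > 0" "\<And>x. \<bar>\<zeta> x\<bar> \<le> B" "\<And>x. norm (gradient \<zeta> x) \<le> B"
    "\<And>x. gradient \<zeta> x \<noteq> 0 \<Longrightarrow> norm x \<le> R"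
    using test_function_bounds[OF \<zeta>] by metis
  define \<zeta>' where "\<zeta>' m x = \<zeta> (inverse (real (Suc m)) *\<^sub>R x)" for m x
  have \<zeta>': "\<zeta>' m \<in> test_functions" for m
    unfolding \<zeta>'_def by (intro test_function_scale \<zeta>) simp
  have [measurable]: "\<zeta>' m \<in> borel_measurable borel" "gradient (\<zeta>' m) \<in> borel_measurable borel" for m
    using \<zeta>' by (auto intro: test_function_measurable)
  have grad: "gradient (\<zeta>' m) x = inverse (real (Suc m)) *\<^sub>R gradient \<zeta> (inverse (real (Suc m)) *\<^sub>R x)" for m x
    unfolding \<zeta>'_def by (rule gradient_scale[OF \<zeta>])
  have grad_le: "norm (gradient (\<zeta>' m) x) \<le> B * inverse (real (Suc m))" for m x
    unfolding grad using mult_left_mono[OF B(4)[of "inverse (real (Suc m)) *\<^sub>R x"], of "inverse (real (Suc m))"]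
    by (simp add: mult.commute[of B])
  \<comment> \<open>The bound \<open>grad_le\<close> gives pointwise decay in m; this one is uniform
    in m and provides the dominating function. Where the dilated gradient is nonzero, |x| <= R (m +
    1), hence 1/(m + 1) <= R/|x|.\<close>
  have grad_le': "norm (gradient (\<zeta>' m) x) \<le> B * R / norm x" if "x \<noteq> 0" for m x
  proof (cases "gradient (\<zeta>' m) x = 0")
    case False
    then have "gradient \<zeta> (inverse (real (Suc m)) *\<^sub>R x) \<noteq> 0" unfolding grad by simp
    then have "norm (inverse (real (Suc m)) *\<^sub>R x) \<le> R" by (rule B)
    then have "inverse (real (Suc m)) \<le> R / norm x" using that by (simp add: pos_le_divide_eq)
    then have "B * inverse (real (Suc m)) \<le> B * (R / norm x)" using B by (intro mult_left_mono) auto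
    then show ?thesis using grad_le[of m x] by simp
  qed (use B in simp)
  let ?P = "\<lambda>m x. \<zeta>' m x / (1 + (w x)\<^sup>2) * (F x \<bullet> W x)"
  let ?Q = "\<lambda>m x. arctan (w x) * (F x \<bullet> gradient (\<zeta>' m) x)"
  let ?L = "\<lambda>x. \<zeta> 0 / (1 + (w x)\<^sup>2) * (F x \<bullet> W x)"
  have PQ: "(LINT x|lborel. ?P m x) + (LINT x|lborel. ?Q m x) \<le> 0" for m
  proof -
    have "AE x in lborel. H x * (arctan (w x) * \<zeta>' m x) \<le> 0"
      using neg
    proof eventually_elim
      case (elim x)
      \<comment> \<open>arctan has the sign of its argument, so the truncation preserves the sign
        condition on H w.\<close>
      have "H x * arctan (w x) \<le> 0" using elim by (auto simp: mult_le_0_iff)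
      then have "H x * arctan (w x) * \<zeta>' m x \<le> 0"
        by (rule mult_nonpos_nonneg) (simp add: \<zeta>'_def \<zeta>_ge)
      then show ?case by (simp add: mult.assoc)
    qed
    then have "(LINT x|lborel. H x * (arctan (w x) * \<zeta>' m x)) \<le> 0"
      using integral_nonneg_AE[where M = lborel and f = "\<lambda>x. - (H x * (arctan (w x) * \<zeta>' m x))"] by simp
    then show ?thesis
      using truncated_identity[OF F H weak \<rho> assms(6,7) FW \<open>c \<ge> 0\<close> conv \<zeta>'] by simp
  qed
  have BFW: "integrable lborel (\<lambda>x. B * \<bar>F x \<bullet> W x\<bar>)" using FW by simp
  have scale_lim: "(\<lambda>m. inverse (real (Suc m)) *\<^sub>R x) \<longlonglongrightarrow> 0" for x :: 'a
    using tendsto_scaleR[OF LIMSEQ_inverse_real_of_nat tendsto_const[of x]] by simp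
  have P_lim: "(\<lambda>m. LINT x|lborel. ?P m x) \<longlonglongrightarrow> (LINT x|lborel. ?L x)"
  proof (rule integral_dominated_convergence[OF _ _ BFW])
    show "AE x in lborel. (\<lambda>m. ?P m x) \<longlonglongrightarrow> ?L x"
    proof (rule AE_I2)
      fix x
      have "isCont \<zeta> 0"
        using test_function_continuous[OF \<zeta>] by (simp add: continuous_on_eq_continuous_at)
      then have "(\<lambda>m. \<zeta>' m x) \<longlonglongrightarrow> \<zeta> 0"
        unfolding \<zeta>'_def by (rule isCont_tendsto_compose[OF _ scale_lim])
      then show "(\<lambda>m. ?P m x) \<longlonglongrightarrow> ?L x"
        using one_plus_square_pos[of "w x"] by (intro tendsto_intros) auto
    qed
    show "AE x in lborel. norm (?P m x) \<le> B * \<bar>F x \<bullet> W x\<bar>" for m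
    proof (rule AE_I2)
      fix x
      have "\<bar>\<zeta>' m x\<bar> \<le> B" unfolding \<zeta>'_def by (rule B)
      then show "norm (?P m x) \<le> B * \<bar>F x \<bullet> W x\<bar>"
        unfolding real_norm_def abs_mult by (intro mult_right_mono abs_divide_one_plus_square_le) auto
    qed
  qed measurable
  have Q_dom: "integrable lborel (\<lambda>x. B * R * (norm (F x) * (\<bar>w x\<bar> / norm x)))"
    using Fw by (intro integrable_mult_right)
  have Q_lim: "(\<lambda>m. LINT x|lborel. ?Q m x) \<longlonglongrightarrow> (LINT x|(lborel :: 'a measure). (0::real))"
  proof (rule integral_dominated_convergence[OF _ _ Q_dom])
    show "AE x in lborel. (\<lambda>m. ?Q m x) \<longlonglongrightarrow> 0"
    proof (rule AE_I2)
      fix x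
      have "(\<lambda>m. B * inverse (real (Suc m))) \<longlonglongrightarrow> B * 0"
        by (intro tendsto_intros LIMSEQ_inverse_real_of_nat)
      then have "(\<lambda>m. gradient (\<zeta>' m) x) \<longlonglongrightarrow> 0"
        by (intro Lim_null_comparison[OF always_eventually[OF allI[OF grad_le]]]) simp
      then have "(\<lambda>m. ?Q m x) \<longlonglongrightarrow> arctan (w x) * (F x \<bullet> 0)" by (intro tendsto_intros)
      then show "(\<lambda>m. ?Q m x) \<longlonglongrightarrow> 0" by simp
    qed
    show "AE x in lborel. norm (?Q m x) \<le> B * R * (norm (F x) * (\<bar>w x\<bar> / norm x))" for m
      using AE_lborel_nonzero
    proof eventually_elim
      case (elim x)
      have "norm (?Q m x) = \<bar>arctan (w x)\<bar> * \<bar>F x \<bullet> gradient (\<zeta>' m) x\<bar>" by (simp add: abs_mult)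
      also have "\<dots> \<le> \<bar>w x\<bar> * (norm (F x) * norm (gradient (\<zeta>' m) x))"
        by (intro mult_mono abs_arctan_le Cauchy_Schwarz_ineq2) auto
      also have "\<dots> \<le> \<bar>w x\<bar> * (norm (F x) * (B * R / norm x))"
        by (intro mult_left_mono grad_le' elim) auto
      finally show ?case by (simp add: mult_ac)
    qed
  qed measurable
  have "(\<lambda>m. (LINT x|lborel. ?P m x) + (LINT x|lborel. ?Q m x)) \<longlonglongrightarrow> (LINT x|lborel. ?L x) + (LINT x|(lborel :: 'a measure). (0::real))"
    by (intro tendsto_add P_lim Q_lim)
  then have le: "(LINT x|lborel. ?L x) \<le> 0"
    using PQ by (intro LIMSEQ_le_const2[where X = "\<lambda>m. (LINT x|lborel. ?P m x) + (LINT x|lborel. ?Q m x)"]) auto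
  have L_int: "integrable lborel ?L"
  proof (rule Bochner_Integration.integrable_bound[OF BFW])
    show "AE x in lborel. norm (?L x) \<le> norm (B * \<bar>F x \<bullet> W x\<bar>)"
    proof (rule AE_I2)
      fix x
      have "norm (?L x) \<le> B * \<bar>F x \<bullet> W x\<bar>"
        unfolding real_norm_def abs_mult by (intro mult_right_mono abs_divide_one_plus_square_le B) auto
      then show "norm (?L x) \<le> norm (B * \<bar>F x \<bullet> W x\<bar>)" by simp
    qed
  qed measurable
  have L_pos: "AE x in lborel. 0 \<le> ?L x"
    using pos
  proof eventually_elim
    case (elim x)
    then show ?case
      using \<zeta>0 one_plus_square_pos[of "w x"] by (intro mult_nonneg_nonneg divide_nonneg_pos) auto
  qed
  have "(LINT x|lborel. ?L x) = 0"
    using le integral_nonneg_AE[OF L_pos] by simp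
  then have "AE x in lborel. ?L x = 0"
    using integral_nonneg_eq_0_iff_AE[OF L_int L_pos] by simp
  then show ?thesis
  proof eventually_elim
    case (elim x)
    then show ?case using \<zeta>0 one_plus_square_pos[of "w x"] by auto
  qed
qed

text \<open>The weighted p-Laplacian is monotone and the sign condition makes the difference of the
  data point the other way, so the pairing of flux difference and gradient difference vanishes.
  Strict monotonicity then gives equal gradients, and Hardy's inequality turns this into u = v,
  excluding an additive constant.\<close>

theorem D1p_comparison:
  fixes u v :: "'a::euclidean_space \<Rightarrow> real"
  assumes ap: "0 \<le> a" "p > 1" "a < (real DIM('a) - p) / p"
    and u: "u \<in> D1p a p" "weak_eq a p u f" and v: "v \<in> D1p a p" "weak_eq a p v g"
    and sign: "AE x in lborel. (f x - g x) * (u x - v x) \<le> 0"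
  shows "AE x in lborel. u x = v x"
proof -
  have ap': "a * p < real DIM('a)" using ap by (simp add: field_simps)
  obtain K where K: "K > 0" "\<And>\<phi> :: 'a \<Rightarrow> real. \<phi> \<in> test_functions \<Longrightarrow>
      weighted_Lp (a + 1) p \<phi> \<le> ennreal K * weighted_Lp a p (gradient \<phi>)"
    using Hardy_inequality[OF ap(2,3)] by metis
  obtain U where U: "weak_gradient u U" "loc_integrable (flux a p U)" and f: "loc_integrable f"
    and eqU: "\<And>\<phi>. \<phi> \<in> test_functions \<Longrightarrow>
      (LINT x|lborel. flux a p U x \<bullet> gradient \<phi> x) = (LINT x|lborel. f x * \<phi> x)"
    using u(2) by (auto simp: weak_eq_def)
  obtain V where V: "weak_gradient v V" "loc_integrable (flux a p V)" and g: "loc_integrable g"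
    and eqV: "\<And>\<phi>. \<phi> \<in> test_functions \<Longrightarrow>
      (LINT x|lborel. flux a p V x \<bullet> gradient \<phi> x) = (LINT x|lborel. g x * \<phi> x)"
    using v(2) by (auto simp: weak_eq_def)
  have [measurable]: "u \<in> borel_measurable borel" "v \<in> borel_measurable borel"
      "U \<in> borel_measurable borel" "V \<in> borel_measurable borel"
    using U(1) V(1) by (auto simp: weak_gradient_def intro: loc_integrable_measurable)
  obtain \<phi> where \<phi>: "\<And>k. \<phi> k \<in> test_functions" "AE x in lborel. (\<lambda>k::nat. \<phi> k x) \<longlonglongrightarrow> u x"
    "\<And>k. weighted_Lp a p (\<lambda>x. gradient (\<phi> k) x - U x) \<le> ennreal (((1 / 4) ^ k) powr p)"
    using D1p_approximation[OF ap u(1) U(1)] by blast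
  obtain \<psi> where \<psi>: "\<And>k. \<psi> k \<in> test_functions" "AE x in lborel. (\<lambda>k::nat. \<psi> k x) \<longlonglongrightarrow> v x"
    "\<And>k. weighted_Lp a p (\<lambda>x. gradient (\<psi> k) x - V x) \<le> ennreal (((1 / 4) ^ k) powr p)"
    using D1p_approximation[OF ap v(1) V(1)] by blast
  have [measurable]: "\<phi> k \<in> borel_measurable borel" "gradient (\<phi> k) \<in> borel_measurable borel"
      "\<psi> k \<in> borel_measurable borel" "gradient (\<psi> k) \<in> borel_measurable borel" for k
    using \<phi>(1) \<psi>(1) by (auto intro: test_function_measurable)
  define \<rho> where "\<rho> k x = \<phi> k x - \<psi> k x" for k x
  define w where "w = (\<lambda>x. u x - v x)"
  define W where "W = (\<lambda>x. U x - V x)"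
  define F where "F = (\<lambda>x. flux a p U x - flux a p V x)"
  define H where "H = (\<lambda>x. f x - g x)"
  have [measurable]: "w \<in> borel_measurable borel" "W \<in> borel_measurable borel" "F \<in> borel_measurable borel"
    unfolding w_def W_def F_def by measurable
  have \<rho>: "\<rho> k \<in> test_functions" for k
    unfolding \<rho>_def by (intro test_function_diff \<phi> \<psi>)
  have [measurable]: "\<rho> k \<in> borel_measurable borel" "gradient (\<rho> k) \<in> borel_measurable borel" for k
    using \<rho> by (auto intro: test_function_measurable)
  have \<rho>w: "AE x in lborel. (\<lambda>k. \<rho> k x) \<longlonglongrightarrow> w x"
    unfolding \<rho>_def w_def using \<phi>(2) \<psi>(2) by eventually_elim (intro tendsto_intros)
  have grad: "gradient (\<rho> k) x = gradient (\<phi> k) x - gradient (\<psi> k) x" for k x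
    unfolding \<rho>_def by (intro gradient_diff \<phi> \<psi>)
  \<comment> \<open>The constant 4 collects one factor 2 from the quasi-triangle inequality and one
    from adding two equal errors, since 2 <= 2^p.\<close>
  have lim: "weighted_Lp a p (\<lambda>x. gradient (\<rho> k) x - W x) \<le> ennreal ((4 * (1 / 4) ^ k) powr p)" for k
  proof -
    let ?e = "((1 / 4) ^ k) powr p :: real"
    have "weighted_Lp a p (\<lambda>x. gradient (\<rho> k) x - W x) \<le> ennreal (2 powr p) *
        (weighted_Lp a p (\<lambda>x. gradient (\<phi> k) x - U x) + weighted_Lp a p (\<lambda>x. gradient (\<psi> k) x - V x))"
    proof (rule weighted_Lp_le_sum[OF ap(2)])
      fix x
      have "gradient (\<rho> k) x - W x = (gradient (\<phi> k) x - U x) - (gradient (\<psi> k) x - V x)"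
        by (simp add: grad W_def)
      then show "norm (gradient (\<rho> k) x - W x) \<le> norm (gradient (\<phi> k) x - U x) + norm (gradient (\<psi> k) x - V x)"
        by (simp only: norm_triangle_ineq4)
    qed measurable
    also have "\<dots> \<le> ennreal (2 powr p) * (ennreal ?e + ennreal ?e)"
      by (intro mult_left_mono add_mono \<phi> \<psi>) simp
    also have "\<dots> = ennreal (2 powr p * (2 * ?e))"
      by (simp add: ennreal_mult ennreal_plus[symmetric] del: ennreal_plus)
    also have "\<dots> \<le> ennreal (2 powr p * (2 powr p * ?e))"
      using ap(2) powr_mono[of 1 p 2] by (intro ennreal_leI mult_left_mono mult_right_mono) auto
    also have "2 powr p * (2 powr p * ?e) = (4 * (1 / 4) ^ k) powr p"
      by (simp add: powr_mult mult.assoc[symmetric] flip: powr_mult)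
    finally show ?thesis .
  qed
  have finite_Lp: "weighted_Lp a p X < \<infinity>"
    if [measurable]: "X \<in> borel_measurable borel" and X: "\<xi> \<in> test_functions"
      "weighted_Lp a p (\<lambda>x. gradient \<xi> x - X x) \<le> ennreal c" for X :: "'a \<Rightarrow> 'a" and \<xi> c
  proof -
    have [measurable]: "gradient \<xi> \<in> borel_measurable borel" using X(1) by (rule test_function_measurable)
    have "weighted_Lp a p X \<le> ennreal (2 powr p) *
        (weighted_Lp a p (gradient \<xi>) + weighted_Lp a p (\<lambda>x. gradient \<xi> x - X x))"
      by (rule weighted_Lp_le_sum[OF ap(2)]) (measurable, metis norm_minus_commute norm_triangle_sub)
    also have "\<dots> < \<infinity>"
      using weighted_Lp_gradient_finite[OF ap(1,2) ap' X(1)] le_less_trans[OF X(2) ennreal_less_top]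
      by (simp add: ennreal_mult_less_top)
    finally show ?thesis .
  qed
  have "weighted_Lp a p (\<lambda>x. norm (U x) + norm (V x)) \<le> ennreal (2 powr p) * (weighted_Lp a p U + weighted_Lp a p V)"
    by (rule weighted_Lp_le_sum[OF ap(2)]) auto
  also have "\<dots> < \<infinity>"
    using finite_Lp[OF _ \<phi>(1) \<phi>(3)[of 0]] finite_Lp[OF _ \<psi>(1) \<psi>(3)[of 0]] by (simp add: ennreal_mult_less_top)
  finally obtain I where I: "I \<ge> 0" "weighted_Lp a p (\<lambda>x. norm (U x) + norm (V x)) = ennreal I"
    by (cases "weighted_Lp a p (\<lambda>x. norm (U x) + norm (V x))") auto
  have pairing: "(\<integral>\<^sup>+x. ennreal (norm (F x) * norm (Y x)) \<partial>lborel) \<le> ennreal (2 * (I + 1) * e)"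
    if "e > 0" "Y \<in> borel_measurable borel" "weighted_Lp a p Y \<le> ennreal (e powr p)" for e and Y :: "'a \<Rightarrow> 'a"
    unfolding F_def by (rule flux_diff_pairing) (use that ap I in auto)
  have pairing_int: "(\<integral>\<^sup>+x. ennreal (norm (F x) * norm (Y x)) \<partial>lborel) < \<infinity>"
    if Y: "Y \<in> borel_measurable borel" "weighted_Lp a p Y < \<infinity>" for Y :: "'a \<Rightarrow> 'a"
  proof -
    obtain r where r: "weighted_Lp a p Y = ennreal r" "r \<ge> 0" using Y(2) by (cases "weighted_Lp a p Y") auto
    \<comment> \<open>Taking r + 1 instead of r keeps e = (r + 1)^(1/p) positive, as
      \<open>pairing\<close> requires.\<close>
    have "weighted_Lp a p Y \<le> ennreal (((r + 1) powr (1 / p)) powr p)"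
      using r ap(2) by (simp add: powr_powr)
    then have "(\<integral>\<^sup>+x. ennreal (norm (F x) * norm (Y x)) \<partial>lborel) \<le> ennreal (2 * (I + 1) * ((r + 1) powr (1 / p)))"
      using r by (intro pairing Y(1)) auto
    then show ?thesis by (rule le_less_trans) simp
  qed
  have "weighted_Lp a p W < \<infinity>" by (rule finite_Lp[OF _ \<rho> lim[of 0]]) measurable
  then have "(\<integral>\<^sup>+x. ennreal (norm (F x) * norm (W x)) \<partial>lborel) < \<infinity>" by (intro pairing_int) auto
  then have "integrable lborel (\<lambda>x. norm (F x) * norm (W x))" by (intro integrableI_nonneg) auto
  then have FW: "integrable lborel (\<lambda>x. F x \<bullet> W x)"
    by (rule Bochner_Integration.integrable_bound) (auto simp: Cauchy_Schwarz_ineq2)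
  \<comment> \<open>The starting index k admits bounds that hold only eventually. This is used
    twice: with a crude uniform bound to make the weighted norm of w finite, and with bounds tending
    to 0 once W = 0 is known.\<close>
  have w_Hardy: "weighted_Lp (a + 1) p w \<le> ennreal K * c" if "\<And>j. j \<ge> k \<Longrightarrow> weighted_Lp a p (gradient (\<rho> j)) \<le> c" for c and k :: nat
  proof (rule weighted_Lp_Fatou[OF ap(2) _ \<rho>w])
    fix j assume "j \<ge> k"
    have "weighted_Lp (a + 1) p (\<rho> j) \<le> ennreal K * weighted_Lp a p (gradient (\<rho> j))"
      by (rule K(2)[OF \<rho>])
    also have "\<dots> \<le> ennreal K * c" by (intro mult_left_mono that \<open>j \<ge> k\<close>) simp
    finally show "weighted_Lp (a + 1) p (\<rho> j) \<le> ennreal K * c" .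
  qed measurable
  have "weighted_Lp a p (gradient (\<rho> j)) \<le> ennreal (2 powr p) * (weighted_Lp a p W + ennreal (4 powr p))" for j
  proof -
    have "weighted_Lp a p (gradient (\<rho> j)) \<le> ennreal (2 powr p) *
        (weighted_Lp a p W + weighted_Lp a p (\<lambda>x. gradient (\<rho> j) x - W x))"
      by (rule weighted_Lp_le_sum[OF ap(2)]) (measurable, metis norm_triangle_sub)
    also have "\<dots> \<le> ennreal (2 powr p) * (weighted_Lp a p W + ennreal (4 powr p))"
    proof (intro mult_left_mono add_left_mono)
      have "weighted_Lp a p (\<lambda>x. gradient (\<rho> j) x - W x) \<le> ennreal ((4 * (1 / 4) ^ j) powr p)" by (rule lim)
      also have "\<dots> \<le> ennreal (4 powr p)"
        using ap(2) by (intro ennreal_leI powr_mono2) (auto simp: power_le_one)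
      finally show "weighted_Lp a p (\<lambda>x. gradient (\<rho> j) x - W x) \<le> ennreal (4 powr p)" .
    qed simp
    finally show ?thesis .
  qed
  then have "weighted_Lp (a + 1) p w \<le> ennreal K * (ennreal (2 powr p) * (weighted_Lp a p W + ennreal (4 powr p)))"
    by (intro w_Hardy)
  also have "\<dots> < \<infinity>" using \<open>weighted_Lp a p W < \<infinity>\<close> by (simp add: ennreal_mult_less_top)
  finally have w_fin: "weighted_Lp (a + 1) p w < \<infinity>" .
  \<comment> \<open>\<open>pairing_int\<close> expects a vector field, so the scalar |w|/|x| is
    attached to a fixed unit vector. The factor 1/|x| converts weight a into a + 1, where Hardy's
    inequality gives finiteness.\<close>
  obtain i :: 'a where i: "i \<in> Basis" using nonempty_Basis by blast
  define Y where "Y = (\<lambda>x. (\<bar>w x\<bar> / norm x) *\<^sub>R i)"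
  have [measurable]: "Y \<in> borel_measurable borel" unfolding Y_def by measurable
  have Y_norm: "norm (Y x) = \<bar>w x\<bar> / norm x" for x using i by (simp add: Y_def)
  have "weighted_Lp a p Y = weighted_Lp (a + 1) p w"
    unfolding weighted_Lp_def
  proof (intro nn_integral_cong)
    fix x
    have "norm x powr (- a) * norm (Y x) = norm x powr (- (a + 1)) * norm (w x)"
      unfolding Y_norm by (cases "x = 0") (auto simp: powr_diff powr_minus field_simps)
    then show "ennreal ((norm x powr (- a) * norm (Y x)) powr p) = ennreal ((norm x powr (- (a + 1)) * norm (w x)) powr p)"
      by simp
  qed
  with w_fin have "(\<integral>\<^sup>+x. ennreal (norm (F x) * norm (Y x)) \<partial>lborel) < \<infinity>" by (intro pairing_int) auto
  then have Fw: "integrable lborel (\<lambda>x. norm (F x) * (\<bar>w x\<bar> / norm x))"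
    unfolding Y_norm by (intro integrableI_nonneg) auto
  have F: "loc_integrable F" unfolding F_def using U(2) V(2) by (rule loc_integrable_diff)
  have H: "loc_integrable H" unfolding H_def using f g by (rule loc_integrable_diff)
  have "AE x in lborel. F x \<bullet> W x = 0"
  proof (rule pairing_zero[OF F H _ \<rho> \<rho>w _ _ FW])
    show "(LINT x|lborel. F x \<bullet> gradient \<xi> x) = (LINT x|lborel. H x * \<xi> x)" if \<xi>: "\<xi> \<in> test_functions" for \<xi>
    proof -
      have "integrable lborel (\<lambda>x. f x * \<xi> x)" "integrable lborel (\<lambda>x. g x * \<xi> x)"
        using integrable_test_scaleR[OF \<xi> f] integrable_test_scaleR[OF \<xi> g] by (simp_all add: mult.commute)
      then show ?thesis
        using integrable_gradient_inner[OF \<xi> U(2)] integrable_gradient_inner[OF \<xi> V(2)] eqU[OF \<xi>] eqV[OF \<xi>]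
        by (simp add: F_def H_def inner_diff_left left_diff_distrib)
    qed
    show "(\<integral>\<^sup>+x. ennreal (norm (F x) * norm (gradient (\<rho> k) x - W x)) \<partial>lborel)
        \<le> ennreal (2 * (I + 1) * 4 * (1 / 4) ^ k)" for k
    proof -
      have "(\<integral>\<^sup>+x. ennreal (norm (F x) * norm (gradient (\<rho> k) x - W x)) \<partial>lborel)
          \<le> ennreal (2 * (I + 1) * (4 * (1 / 4) ^ k))"
        by (intro pairing lim) auto
      then show ?thesis by (simp only: mult.assoc)
    qed
    show "AE x in lborel. 0 \<le> F x \<bullet> W x"
      using AE_lborel_nonzero
    proof eventually_elim
      case (elim x)
      then show ?case unfolding F_def W_def by (rule flux_diff_inner(1)[OF ap(2)])
    qed
    show "AE x in lborel. H x * w x \<le> 0" using sign by (simp add: H_def w_def)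
  qed (use I Fw in auto)
  with AE_lborel_nonzero have W0: "AE x in lborel. W x = 0"
  proof eventually_elim
    case (elim x)
    then show ?case using flux_diff_inner(2)[OF ap(2), of x a U V] by (simp add: F_def W_def)
  qed
  \<comment> \<open>With W = 0 the approximation error is the gradient of \<rho> j itself, so these
    gradients tend to 0 and Hardy's inequality forces w = 0.\<close>
  have small: "weighted_Lp a p (gradient (\<rho> j)) \<le> ennreal ((4 * (1 / 4) ^ k) powr p)" if "j \<ge> k" for j k
  proof -
    have "weighted_Lp a p (gradient (\<rho> j)) = weighted_Lp a p (\<lambda>x. gradient (\<rho> j) x - W x)"
      unfolding weighted_Lp_def using W0 by (intro nn_integral_cong_AE) auto
    also have "\<dots> \<le> ennreal ((4 * (1 / 4) ^ j) powr p)" by (rule lim)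
    also have "\<dots> \<le> ennreal ((4 * (1 / 4) ^ k) powr p)"
      using ap(2) that by (intro ennreal_leI powr_mono2 mult_left_mono power_decreasing) auto
    finally show ?thesis .
  qed
  have "weighted_Lp (a + 1) p w \<le> ennreal (K * (4 * (1 / 4) ^ k) powr p)" for k
    using w_Hardy[OF small, of k] K(1) by (simp add: ennreal_mult)
  moreover have "(\<lambda>k. ennreal (K * (4 * (1 / 4) ^ k) powr p)) \<longlonglongrightarrow> ennreal (K * (4 * 0) powr p)"
    using ap(2) by (intro tendsto_ennrealI tendsto_mult tendsto_const tendsto_powr' LIMSEQ_power_zero) auto
  ultimately have "weighted_Lp (a + 1) p w \<le> ennreal (K * (4 * 0) powr p)"
    by (intro LIMSEQ_le_const) auto
  then have "weighted_Lp (a + 1) p w = 0" by simp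
  then have "AE x in lborel. ennreal ((norm x powr (- (a + 1)) * norm (w x)) powr p) = 0"
    unfolding weighted_Lp_def by (subst (asm) nn_integral_0_iff_AE) auto
  with AE_lborel_nonzero show ?thesis
  proof eventually_elim
    case (elim x)
    then have "(norm x powr (- (a + 1)) * norm (w x)) powr p \<le> 0" by (simp only: ennreal_eq_0_iff)
    then have "norm x powr (- (a + 1)) * norm (w x) = 0" by simp
    then show ?case using elim(1) by (simp add: w_def)
  qed
qed

text \<open>Invariance is tested on solution pairs of finite energy: an infinite energy is preserved
  by every rescaling and would put no condition on the exponents \<sigma>1 and \<sigma>2. Equality
  of u and v is almost everywhere, the sense in which elements of \<open>D1p\<close> are
  determined.\<close>

theorem theorem3p3:
  fixes p a b q1 q2 :: real
  assumes "CARD('n::finite) \<ge> 3" and "p > 1"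
    and "0 \<le> a" and "a < (real CARD('n) - p) / p"
    and "a \<le> b" and "b \<le> a + 1"
    and "q1 > 1" and "q2 > 1"
  shows
    "(\<forall>u v :: real ^ 'n \<Rightarrow> real.
        solves_system a b p q1 q2 u v \<and> energy b q1 u < \<infinity> \<and> energy b q2 v < \<infinity> \<longrightarrow>
        ((\<exists>\<sigma>1 \<sigma>2. scaling_invariant a b p q1 q2 \<sigma>1 \<sigma>2 u v) \<longleftrightarrow>
           (p = 2 \<and> 1 / (q1 + 1) + 1 / (q2 + 1)
                     = (real CARD('n) + 2 * (b - a - 1)) / real CARD('n)) \<or>
           (q1 = q2 \<and> q1 = real CARD('n) * p / (real CARD('n) - p + p * (b - a)) - 1)) \<and>
        (p = 2 \<longrightarrow>
           ((\<exists>\<sigma>1 \<sigma>2. scaling_invariant a b p q1 q2 \<sigma>1 \<sigma>2 u v) \<longleftrightarrow>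
            1 / (q1 + 1) + 1 / (q2 + 1)
              = (real CARD('n) + 2 * (b - a - 1)) / real CARD('n))) \<and>
        (q1 = q2 \<longrightarrow>
           ((\<exists>\<sigma>1 \<sigma>2. scaling_invariant a b p q1 q2 \<sigma>1 \<sigma>2 u v) \<longleftrightarrow>
            q1 = real CARD('n) * p / (real CARD('n) - p + p * (b - a)) - 1))) \<and>
     (q1 = q2 \<longrightarrow>
        (\<forall>u \<in> D1p a p. \<forall>v :: real ^ 'n \<Rightarrow> real. v \<in> D1p a p \<longrightarrow>
           (solves_system a b p q1 q2 u v \<longleftrightarrow>
            (AE x in lborel. u x = v x) \<and> solves_single a b p q1 u)))"
proof (rule conjI)
  let ?n = "real CARD('n)"
  have n: "real DIM(real ^ 'n) = ?n" by simp
  have "p + a * p < ?n" using assms(2,4) by (simp add: field_simps)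
  moreover have "0 \<le> a * p" "0 \<le> p * (b - a)" using assms by auto
  ultimately have pos: "?n - p + p * (b - a) > 0" by linarith
  show "\<forall>u v :: real ^ 'n \<Rightarrow> real.
        solves_system a b p q1 q2 u v \<and> energy b q1 u < \<infinity> \<and> energy b q2 v < \<infinity> \<longrightarrow>
        ((\<exists>\<sigma>1 \<sigma>2. scaling_invariant a b p q1 q2 \<sigma>1 \<sigma>2 u v) \<longleftrightarrow>
           (p = 2 \<and> 1 / (q1 + 1) + 1 / (q2 + 1) = (?n + 2 * (b - a - 1)) / ?n) \<or>
           (q1 = q2 \<and> q1 = ?n * p / (?n - p + p * (b - a)) - 1)) \<and>
        (p = 2 \<longrightarrow>
           ((\<exists>\<sigma>1 \<sigma>2. scaling_invariant a b p q1 q2 \<sigma>1 \<sigma>2 u v) \<longleftrightarrow>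
            1 / (q1 + 1) + 1 / (q2 + 1) = (?n + 2 * (b - a - 1)) / ?n)) \<and>
        (q1 = q2 \<longrightarrow>
           ((\<exists>\<sigma>1 \<sigma>2. scaling_invariant a b p q1 q2 \<sigma>1 \<sigma>2 u v) \<longleftrightarrow>
            q1 = ?n * p / (?n - p + p * (b - a)) - 1))"
  proof (intro allI impI)
    fix u v :: "real ^ 'n \<Rightarrow> real"
    assume "solves_system a b p q1 q2 u v \<and> energy b q1 u < \<infinity> \<and> energy b q2 v < \<infinity>"
    then have ex: "(\<exists>\<sigma>1 \<sigma>2. scaling_invariant a b p q1 q2 \<sigma>1 \<sigma>2 u v) \<longleftrightarrow>
      (p - 1) * (?n / (q1 + 1)) + ?n / (q2 + 1) = ?n + p * (b - a - 1) \<and>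
      (p - 1) * (?n / (q2 + 1)) + ?n / (q1 + 1) = ?n + p * (b - a - 1)"
      using ex_scaling_invariant_iff[of a b p q1 q2 u v] assms(7,8) unfolding n by blast
    have "?n > 0" by simp
    note crit = critical_condition_iff[OF this pos assms(7,8)]
    show "((\<exists>\<sigma>1 \<sigma>2. scaling_invariant a b p q1 q2 \<sigma>1 \<sigma>2 u v) \<longleftrightarrow>
           (p = 2 \<and> 1 / (q1 + 1) + 1 / (q2 + 1) = (?n + 2 * (b - a - 1)) / ?n) \<or>
           (q1 = q2 \<and> q1 = ?n * p / (?n - p + p * (b - a)) - 1)) \<and>
        (p = 2 \<longrightarrow>
           ((\<exists>\<sigma>1 \<sigma>2. scaling_invariant a b p q1 q2 \<sigma>1 \<sigma>2 u v) \<longleftrightarrow>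
            1 / (q1 + 1) + 1 / (q2 + 1) = (?n + 2 * (b - a - 1)) / ?n)) \<and>
        (q1 = q2 \<longrightarrow>
           ((\<exists>\<sigma>1 \<sigma>2. scaling_invariant a b p q1 q2 \<sigma>1 \<sigma>2 u v) \<longleftrightarrow>
            q1 = ?n * p / (?n - p + p * (b - a)) - 1))"
      unfolding ex using crit by (intro conjI impI)
  qed
  show "q1 = q2 \<longrightarrow>
        (\<forall>u \<in> D1p a p. \<forall>v :: real ^ 'n \<Rightarrow> real. v \<in> D1p a p \<longrightarrow>
           (solves_system a b p q1 q2 u v \<longleftrightarrow>
            (AE x in lborel. u x = v x) \<and> solves_single a b p q1 u))"
  proof (intro impI ballI allI)
    fix u v :: "real ^ 'n \<Rightarrow> real"
    assume q: "q1 = q2" and u: "u \<in> D1p a p" and v: "v \<in> D1p a p"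
    let ?k = "\<lambda>x::real ^ 'n. norm x powr (- b * (q1 + 1))"
    have [measurable]: "u \<in> borel_measurable borel" "v \<in> borel_measurable borel"
      using u v by (auto simp: D1p_def)
    show "solves_system a b p q1 q2 u v \<longleftrightarrow> (AE x in lborel. u x = v x) \<and> solves_single a b p q1 u"
    proof
      assume sys: "solves_system a b p q1 q2 u v"
      then have pos: "AE x in lborel. u x > 0" "AE x in lborel. v x > 0"
        and eq: "weak_eq a p u (\<lambda>x. ?k x * v x powr q1)" "weak_eq a p v (\<lambda>x. ?k x * u x powr q1)"
        by (auto simp: solves_system_def q)
      have "AE x in lborel. (?k x * v x powr q1 - ?k x * u x powr q1) * (u x - v x) \<le> 0"
        using pos
      proof eventually_elim
        case (elim x)
        have "(v x powr q1 - u x powr q1) * (u x - v x) \<le> 0"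
        proof (cases "u x \<le> v x")
          case True
          then have "u x powr q1 \<le> v x powr q1" using elim assms(7) by (intro powr_mono2) auto
          then show ?thesis using True by (intro mult_nonneg_nonpos) auto
        next
          case False
          then have "v x powr q1 \<le> u x powr q1" using elim assms(7) by (intro powr_mono2) auto
          then show ?thesis using False by (intro mult_nonpos_nonneg) auto
        qed
        then have "?k x * ((v x powr q1 - u x powr q1) * (u x - v x)) \<le> 0"
          by (rule mult_nonneg_nonpos[rotated]) simp
        then show ?case by (simp add: right_diff_distrib mult.assoc left_diff_distrib)
      qed
      then have uv: "AE x in lborel. u x = v x"
        using D1p_comparison[OF assms(3,2) _ u eq(1) v eq(2)] assms(4) by simp
      then have "AE x in lborel. ?k x * v x powr q1 = ?k x * u x powr q1"
        by eventually_elim simp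
      then have "weak_eq a p u (\<lambda>x. ?k x * u x powr q1)"
        by (intro weak_eq_cong[OF eq(1)]) auto
      then show "(AE x in lborel. u x = v x) \<and> solves_single a b p q1 u"
        using uv pos by (simp add: solves_single_def)
    next
      assume "(AE x in lborel. u x = v x) \<and> solves_single a b p q1 u"
      then have uv: "AE x in lborel. u x = v x" and pos: "AE x in lborel. u x > 0"
        and eq: "weak_eq a p u (\<lambda>x. ?k x * u x powr q1)"
        by (auto simp: solves_single_def)
      have kuv: "AE x in lborel. ?k x * u x powr q1 = ?k x * v x powr q1"
        using uv by eventually_elim simp
      have "AE x in lborel. v x > 0" using uv pos by eventually_elim simp
      moreover have "weak_eq a p u (\<lambda>x. ?k x * v x powr q1)"
        using kuv by (intro weak_eq_cong[OF eq]) auto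
      moreover have "weak_eq a p v (\<lambda>x. ?k x * u x powr q1)"
        using uv by (intro weak_eq_cong[OF eq]) auto
      ultimately show "solves_system a b p q1 q2 u v"
        using pos q by (simp add: solves_system_def)
    qed
  qed
qed

end
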